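(* Let $q\ge 1$ and $p\ge 2q$ be integers, let $G=SU(p+q)$ and $K_1=SU(p)\times SU(q)$ (block diagonally embedded in $G$), and regard $K_1$-biinvariant functions on $G$ as functions on the cone $X_q$ via $\varphi(x):=\varphi(b_x)$, $x\in X_q$. Then the product formula for the spherical functions $\varphi$ of the Gelfand pair $(G,K_1)$, considered as functions on $X_q$, can be written as $$\varphi([\cos t,z])\,\varphi([\cos t',z'])=\frac1{\kappa_p}\int_{B_q}\int_{SU(q)}\varphi\Bigl(\bigl[\sigma_{sing}(-\sin\underline t\,w\,\sin\underline t'+\cos\underline t\,v\,\cos\underline t'),\; zz'\cdot\arg\Delta(-\sin\underline t\,w\,\sin\underline t'+\cos\underline t\,v\,\cos\underline t')\bigr]\Bigr)\,\Delta(I_q-w^*w)^{p-2q}\,dv\,dw$$ for all $t,t'\in A_q$ and $z,z'\in\mathbb T$, where $\kappa_p=\int_{B_q}\Delta(I_q-w^*w)^{p-2q}\,dw$.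
   Context: Notation. $\mathbb T=\{z\in\mathbb C:|z|=1\}$. $A_q=\{t\in\mathbb R^q:\ \pi/2\ge t_1\ge t_2\ge\dots\ge t_q\ge 0\}$. $$X_q=\{(zr_1,r_2,\dots,r_q):\ z\in\mathbb T,\ r_i\in\mathbb R,\ 0\le r_1\le\dots\le r_q\le1\}\subset\mathbb C\times\mathbb R^{q-1}.$$ For such $r=(r_1,\dots,r_q)$ and $z$ write $[r,z]:=(zr_1,r_2,\dots,r_q)\in X_q$ (if $r_1=0$ the phase $z$ is irrelevant). For $t\in A_q$, $\cos t=(\cos t_1,\dots,\cos t_q)$; $\underline t$ is the diagonal matrix with entries $t_1,\dots,t_q$, and $\cos\underline t,\sin\underline t$ are the diagonal matrices with entries $\cos t_j$, $\sin t_j$. Every element of $X_q$ has the form $[\cos t,z]$ with $t\in A_q$, $z\in\mathbb T$. For $z\in\mathbb T$ let $h(z)=\mathrm{diag}(z,1,\dots,1)\in M_q(\mathbb C)$, and for $x=[\cos t,z]\in X_q$ put $$b_x=\begin{pmatrix}I_{p-q}&0&0\\0&h(z^{-1})\cos\underline t&-\sin\underline t\\0&\sin\underline t&h(z)\cos\underline t\end{pmatrix}\in SU(p+q).$$ The matrices $b_x$, $x\in X_q$, form a set of representatives of the double cosets $K_1gK_1$, so $K_1$-biinvariant functions on $G$ correspond to functions on $X_q$. A spherical function of $(G,K_1)$ is a continuous, $K_1$-biinvariant function $\varphi:G\to\mathbb C$, not identically zero, satisfying the product formula $\varphi(g)\varphi(h)=\int_{K_1}\varphi(gkh)\,dk$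 for all $g,h\in G$, where $dk$ is the normalized Haar measure on $K_1$. $\Delta$ denotes the determinant. For $X\in M_q(\mathbb C)$, $\sigma_{sing}(X)\in\mathbb R^q$ is the vector of singular values of $X$ (square roots of the eigenvalues of $X^*X$, with multiplicity), listed in increasing order, so that $[\sigma_{sing}(X),z]\in X_q$ when all singular values are $\le1$. $\arg z:=z/|z|$ for $z\in\mathbb C\setminus\{0\}$ and $\arg 0:=1$. $B_q=\{w\in M_q(\mathbb C):\ I_q-w^*w \text{ positive semidefinite}\}$; $dw$ is Lebesgue measure on $B_q\subset M_q(\mathbb C)\cong\mathbb R^{2q^2}$; $dv$ is the normalized Haar measure on $SU(q)$. *)

theory Defs
  imports
    "HOL-Analysis.Analysis"
    "HOL-Computational_Algebra.Fundamental_Theorem_Algebra"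
begin

(*
  The type 'q, finite and linearly ordered, plays the role of {1,...,q}.  The index set {1,...,p} is
  the sum 'r + 'q, so that CARD('r) = p - q, and {1,...,p+q} is ('r + 'q) + 'q; the block
  decomposition of sizes p - q, q, q is thus the decomposition of the sum type.
  Since 'r is nonempty, p > q; this is implied by q >= 1 and p >= 2q.
*)

section \<open>Matrices\<close>

definition cadjoint :: "complex^'n^'m \<Rightarrow> complex^'m^'n" where
  "cadjoint A = (\<chi> i j. cnj (A $ j $ i))"

definition diag_matrix :: "'a::zero^'n \<Rightarrow> 'a^'n^'n" where
  "diag_matrix d = (\<chi> i j. if i = j then d $ i else 0)"

definition charpoly :: "complex^'n^'n \<Rightarrow> complex poly" where
  "charpoly A = det (mat [:0, 1:] - (\<chi> i j. [:A $ i $ j:]))"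

(* Hermitian, hence the quadratic form is real valued *)
definition pos_semidef :: "complex^'n^'n \<Rightarrow> bool" where
  "pos_semidef A \<longleftrightarrow>
     cadjoint A = A \<and> (\<forall>u. 0 \<le> Re (\<Sum>i\<in>UNIV. cnj (u $ i) * (A *v u) $ i))"

(* The eigenvalues of X^* X, counted by the multiset of roots of the characteristic polynomial, are
   real and nonnegative, so Re loses nothing.  The entry at index i is the one whose position in the
   increasing list is the rank of i (counted from 0) in the order of the index type. *)
definition sigma_sing :: "complex^'n::{finite,linorder}^'n::{finite,linorder} \<Rightarrow> real^'n::{finite,linorder}" where
  "sigma_sing X =
     (\<chi> i. sorted_list_of_multiset
             (image_mset (\<lambda>c. sqrt (Re c)) (proots (charpoly (cadjoint X ** X)))) ! card {j. j < i})"

definition arg_phase :: "complex \<Rightarrow> complex" where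
  "arg_phase z = (if z = 0 then 1 else z / of_real (cmod z))"

section \<open>Groups, Haar measure, spherical functions\<close>

definition SU :: "(complex^'n^'n) set" where
  "SU = {A. cadjoint A ** A = mat 1 \<and> A ** cadjoint A = mat 1 \<and> det A = 1}"

definition block_diag :: "'a::zero^'m^'m \<Rightarrow> 'a^'n^'n \<Rightarrow> 'a^('m + 'n)^('m + 'n)" where
  "block_diag A B = (\<chi> i j. case (i, j) of
      (Inl a, Inl b) \<Rightarrow> A $ a $ b
    | (Inr a, Inr b) \<Rightarrow> B $ a $ b
    | _ \<Rightarrow> 0)"

definition K1 :: "(complex^('m::finite + 'n::finite)^('m + 'n)) set" where
  "K1 = {block_diag u v | u v. u \<in> SU \<and> v \<in> SU}"

(* \<mu> is the normalized Haar measure of the compact matrix group H; it lives on the Borel sets of H,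
   so space \<mu> = H. *)
definition normalized_haar :: "(complex^'n^'n) set \<Rightarrow> (complex^'n^'n) measure \<Rightarrow> bool" where
  "normalized_haar H \<mu> \<longleftrightarrow>
     sets \<mu> = sets (restrict_space borel H) \<and> emeasure \<mu> H = 1 \<and>
     (\<forall>g\<in>H. distr \<mu> \<mu> (\<lambda>x. g ** x) = \<mu>)"

(* The values of \<phi> outside the group G are irrelevant; \<mu> is the normalized Haar measure of K. *)
definition spherical_function ::
  "(complex^'n^'n) set \<Rightarrow> (complex^'n^'n) set \<Rightarrow> (complex^'n^'n) measure
    \<Rightarrow> (complex^'n^'n \<Rightarrow> complex) \<Rightarrow> bool" where
  "spherical_function G K \<mu> \<phi> \<longleftrightarrow>
     continuous_on G \<phi> \<and>
     (\<forall>g\<in>G. \<forall>k\<in>K. \<forall>k'\<in>K. \<phi> (k ** g ** k') = \<phi> g) \<and>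
     (\<exists>g\<in>G. \<phi> g \<noteq> 0) \<and>
     (\<forall>g\<in>G. \<forall>h\<in>G. \<phi> g * \<phi> h = (LINT k|\<mu>. \<phi> (g ** k ** h)))"

section \<open>The cone and the double coset representatives\<close>

definition A_chamber :: "(real^'q::{finite,linorder}) set" where
  "A_chamber = {t. (\<forall>i. 0 \<le> t $ i \<and> t $ i \<le> pi / 2) \<and> (\<forall>i j. i \<le> j \<longrightarrow> t $ j \<le> t $ i)}"

(* [r, z] = (z r_1, r_2, ..., r_q), the first index being Min UNIV *)
definition cone_pt :: "real^'q::{finite,linorder} \<Rightarrow> complex \<Rightarrow> complex^'q::{finite,linorder}" where
  "cone_pt r z = (\<chi> i. if i = Min UNIV then z * of_real (r $ i) else of_real (r $ i))"

definition X_cone :: "(complex^'q::{finite,linorder}) set" where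
  "X_cone = {cone_pt r z | r z.
     cmod z = 1 \<and> (\<forall>i. 0 \<le> r $ i \<and> r $ i \<le> 1) \<and> (\<forall>i j. i \<le> j \<longrightarrow> r $ i \<le> r $ j)}"

definition cos_vec :: "real^'q \<Rightarrow> real^'q" where
  "cos_vec t = (\<chi> i. cos (t $ i))"

definition cos_mat :: "real^'q \<Rightarrow> complex^'q^'q" where
  "cos_mat t = diag_matrix (\<chi> i. of_real (cos (t $ i)))"

definition sin_mat :: "real^'q \<Rightarrow> complex^'q^'q" where
  "sin_mat t = diag_matrix (\<chi> i. of_real (sin (t $ i)))"

definition h_mat :: "complex \<Rightarrow> complex^'q::{finite,linorder}^'q::{finite,linorder}" where
  "h_mat z = diag_matrix (\<chi> i. if i = Min UNIV then z else 1)"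

definition b_mat :: "real^'q::{finite,linorder} \<Rightarrow> complex
    \<Rightarrow> complex^(('r::finite + 'q) + 'q)^(('r + 'q) + 'q)" where
  "b_mat t z = (\<chi> i j. case (i, j) of
      (Inl (Inl a), Inl (Inl b)) \<Rightarrow> mat 1 $ a $ b
    | (Inl (Inr a), Inl (Inr b)) \<Rightarrow> (h_mat (inverse z) ** cos_mat t) $ a $ b
    | (Inl (Inr a), Inr b)       \<Rightarrow> (- sin_mat t) $ a $ b
    | (Inr a, Inl (Inr b))       \<Rightarrow> sin_mat t $ a $ b
    | (Inr a, Inr b)             \<Rightarrow> (h_mat z ** cos_mat t) $ a $ b
    | _                          \<Rightarrow> 0)"

(* b_x for x = [cos t, z]; see b_rep_cone_pt and X_cone_eq for well-definedness *)
definition b_rep :: "complex^'q::{finite,linorder}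
    \<Rightarrow> complex^(('r::finite + 'q) + 'q)^(('r + 'q) + 'q)" where
  "b_rep x =
     (THE g. \<exists>t z. t \<in> A_chamber \<and> cmod z = 1 \<and> x = cone_pt (cos_vec t) z \<and> g = b_mat t z)"

lemma diag_matrix_mult:
  fixes a b :: "'a::semiring_1^'n"
  shows "diag_matrix a ** diag_matrix b = diag_matrix (\<chi> i. a $ i * b $ i)"
proof -
  have "(\<Sum>k\<in>UNIV. (if i = k then a $ i else 0) * (if k = j then b $ k else 0)) =
        (if i = j then a $ i * b $ i else 0)" for i j
  proof -
    have "(\<Sum>k\<in>UNIV. (if i = k then a $ i else 0) * (if k = j then b $ k else 0)) =
          (\<Sum>k\<in>UNIV. if k = i then (if i = j then a $ i * b $ i else 0) else 0)"
      by (rule sum.cong) auto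
    then show ?thesis by simp
  qed
  then show ?thesis
    by (simp add: diag_matrix_def matrix_matrix_mult_def vec_eq_iff)
qed

lemma b_mat_cong:
  fixes t s :: "real^'q::{finite,linorder}"
  assumes t: "t \<in> A_chamber" and s: "s \<in> A_chamber" and z: "cmod z = 1" and w: "cmod w = 1"
    and eq: "cone_pt (cos_vec t) z = cone_pt (cos_vec s) w"
  shows "(b_mat t z :: complex^(('r::finite + 'q) + 'q)^(('r + 'q) + 'q)) = b_mat s w"
proof -
  have e: "(if i = Min UNIV then z * of_real (cos (t $ i)) else of_real (cos (t $ i))) =
           (if i = Min UNIV then w * of_real (cos (s $ i)) else of_real (cos (s $ i)))" for i
    using arg_cong[OF eq, of "\<lambda>x. x $ i"] by (simp only: cone_pt_def cos_vec_def vec_lambda_beta)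
  have bt: "0 \<le> t $ i" "t $ i \<le> pi / 2" and bs: "0 \<le> s $ i" "s $ i \<le> pi / 2" for i
    using t s by (auto simp: A_chamber_def)
  have nonneg: "0 \<le> cos (t $ i)" "0 \<le> cos (s $ i)" for i
    using bt[of i] bs[of i] by (simp_all add: cos_ge_zero)
  have c: "cos (t $ i) = cos (s $ i)" for i
  proof -
    have "cmod (if i = Min UNIV then z * of_real (cos (t $ i)) else of_real (cos (t $ i))) = cos (t $ i)"
      using nonneg(1)[of i] z by (cases "i = Min UNIV") (simp_all add: norm_mult)
    moreover have "cmod (if i = Min UNIV then w * of_real (cos (s $ i)) else of_real (cos (s $ i))) =
        cos (s $ i)"
      using nonneg(2)[of i] w by (cases "i = Min UNIV") (simp_all add: norm_mult)
    ultimately show ?thesis using e[of i] by metis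
  qed
  have "t $ i = s $ i" for i
  proof -
    have "t $ i \<le> pi" "s $ i \<le> pi"
      using bt(2)[of i] bs(2)[of i] pi_ge_zero by linarith+
    then show ?thesis
      using c[of i] bt(1)[of i] bs(1)[of i] by (metis cos_inj_pi)
  qed
  then have ts: "t = s" by (simp add: vec_eq_iff)
  have zw: "z = w \<or> cos (t $ Min UNIV) = 0"
    using e[of "Min UNIV"] unfolding c[of "Min UNIV"] if_True simp_thms mult_cancel_right of_real_eq_0_iff
    by blast
  have hc: "h_mat u ** cos_mat t = h_mat u' ** cos_mat t"
    if "u = u' \<or> cos (t $ Min UNIV) = 0" for u u'
    unfolding h_mat_def cos_mat_def diag_matrix_mult
    by (rule arg_cong[of _ _ diag_matrix]) (use that in \<open>auto simp: vec_eq_iff\<close>)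
  have 1: "h_mat z ** cos_mat t = h_mat w ** cos_mat t"
    and 2: "h_mat (inverse z) ** cos_mat t = h_mat (inverse w) ** cos_mat t"
    using zw by (blast intro: hc)+
  show ?thesis
    by (simp only: b_mat_def 1 2 ts[symmetric])
qed

lemma b_rep_cone_pt:
  assumes "t \<in> A_chamber" and "cmod z = 1"
  shows "b_rep (cone_pt (cos_vec t) z) = b_mat t z"
  unfolding b_rep_def
proof (rule the_equality)
  show "\<exists>s w. s \<in> A_chamber \<and> cmod w = 1 \<and> cone_pt (cos_vec t) z = cone_pt (cos_vec s) w \<and>
          b_mat t z = b_mat s w"
    using assms by blast
next
  fix g assume "\<exists>s w. s \<in> A_chamber \<and> cmod w = 1 \<and>
      cone_pt (cos_vec t) z = cone_pt (cos_vec s) w \<and> g = b_mat s w"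
  then show "g = b_mat t z" using assms b_mat_cong by metis
qed

lemma X_cone_eq: "X_cone = {cone_pt (cos_vec t) z | t z. t \<in> A_chamber \<and> cmod z = 1}"
proof (intro equalityI subsetI)
  fix x :: "complex^'q::{finite,linorder}" assume "x \<in> X_cone"
  then obtain r z where x: "x = cone_pt r z" and z: "cmod z = 1"
    and r: "\<And>i. 0 \<le> r $ i" "\<And>i. r $ i \<le> 1" and mono: "\<And>i j. i \<le> j \<Longrightarrow> r $ i \<le> r $ j"
    by (auto simp: X_cone_def)
  define t where "t = (\<chi> i. arccos (r $ i))"
  have r': "-1 \<le> r $ i" for i using r(1)[of i] by linarith
  have "cos_vec t = r"
    by (simp add: t_def cos_vec_def vec_eq_iff r' r)
  moreover have "t \<in> A_chamber"
    unfolding A_chamber_def t_def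
    using arccos_lbound[OF r' r(2)] arccos_le_pi2[OF r] arccos_le_arccos[OF r' mono r(2)] by simp
  ultimately show "x \<in> {cone_pt (cos_vec t) z | t z. t \<in> A_chamber \<and> cmod z = 1}"
    using x z by blast
next
  fix x :: "complex^'q::{finite,linorder}"
  assume "x \<in> {cone_pt (cos_vec t) z | t z. t \<in> A_chamber \<and> cmod z = 1}"
  then obtain t z where x: "x = cone_pt (cos_vec t) z" and z: "cmod z = 1" and t: "t \<in> A_chamber"
    by blast
  have "0 \<le> cos (t $ i)" for i
  proof -
    have "0 \<le> t $ i" "t $ i \<le> pi / 2" using t by (auto simp: A_chamber_def)
    then show ?thesis by (simp add: cos_ge_zero)
  qed
  moreover have "cos (t $ i) \<le> cos (t $ j)" if "i \<le> j" for i j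
  proof -
    have "0 \<le> t $ j" "t $ j \<le> t $ i" "t $ i \<le> pi / 2" using t that by (auto simp: A_chamber_def)
    then show ?thesis by (simp add: cos_monotone_0_pi_le)
  qed
  ultimately show "x \<in> X_cone"
    using x z unfolding X_cone_def by (auto simp: cos_vec_def intro!: exI[of _ "cos_vec t"] exI[of _ z])
qed

section \<open>The matrix ball\<close>

definition B_ball :: "(complex^'q^'q) set" where
  "B_ball = {w. pos_semidef (mat 1 - cadjoint w ** w)}"

(* The determinants are real and nonnegative on the matrix ball; the constant is kept complex
   because it multiplies a complex integral. *)
definition kappa :: "'q::finite itself \<Rightarrow> nat \<Rightarrow> complex" where
  "kappa _ p = (LINT w:(B_ball :: (complex^'q^'q) set)|lborel.
                  det (mat 1 - cadjoint w ** w) ^ (p - 2 * CARD('q)))"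

end

(*
  A K1-biinvariant function on SU(p+q) depends on g only through its lower right q x q block, and there
  only through the singular values and the phase of the determinant.  The lower right block of
  b_x diag(u, v) b_x' is -sin t w sin t' + h(z) cos t v cos t' h(z'), where w is the lower right block
  of u, so the product formula needs only the law of w for Haar distributed u in SU(p), which has
  density proportional to det(1 - w^* w)^(p-2q) on the matrix ball.  This law is found by adding one row
  of w at a time: given some rows of u, the next row is uniformly distributed on the unit sphere of
  their orthogonal complement, and q coordinates of a uniform unit vector of C^N have density
  (1 - |y|^2)^(N-q-1).  Finally the phases are moved out of the block by the substitution
  w -> h(z) w h(z'), which preserves the law of w.
*)

theory Submission
  imports Defs
begin

section \<open>Unitary matrices\<close>

text \<open>The Haar measure of K_1 is known only through left invariance, neither as a product nor
  in coordinates. Every law is therefore obtained by averaging over translations: independence of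
  the two blocks by multiplying with diag(1, v), the law of a row by a left translation replacing
  this row by a unit combination of the rows not yet treated. The uniform law on a sphere is
  realised by s / |s| with s in a bounded set under Lebesgue measure. The induction over rows is
  governed by the defect Q = I - sum of w_l^* w_l over the chosen rows. If Q = R^* R and x = R^T y,
  then Q - x^* x = R^* (I - y^* y) R. Density and Jacobian together leave the normalizing factor det
  Q^(-D) in the law of the next row, which cancels the density det Q^D of the preceding rows; hence
  the exponent drops by one per row, from p - q to p - 2q. The condition p >= 2q leaves room for q
  coordinates away from the chosen rows. Constants stay unspecified until total mass 1 identifies
  the last one with 1 / kappa_p. Up to that point all integrals are nonnegative and extended, so
  that integrability need not be tracked.\<close>

type_synonym 'n cmat = "((complex, 'n) vec, 'n) vec"

definition cinner :: "complex^'n \<Rightarrow> complex^'n \<Rightarrow> complex" where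
  "cinner x y = (\<Sum>i\<in>UNIV. cnj (x $ i) * y $ i)"

definition unitary :: "complex^'n^'n \<Rightarrow> bool" where
  "unitary A \<longleftrightarrow> cadjoint A ** A = mat 1"

lemma cadjoint_nth [simp]: "cadjoint A $ i $ j = cnj (A $ j $ i)"
  by (simp add: cadjoint_def)

lemma cadjoint_cadjoint [simp]: "cadjoint (cadjoint A) = A"
  by (simp add: vec_eq_iff)

lemma cadjoint_mat_1 [simp]: "cadjoint (mat 1) = mat 1"
  by (simp add: vec_eq_iff mat_def)

lemma cadjoint_mult: "cadjoint (A ** B) = cadjoint B ** cadjoint A"
  by (simp add: vec_eq_iff matrix_matrix_mult_def mult.commute)

lemma det_cadjoint [simp]: "det (cadjoint A) = cnj (det A)"
proof -
  have "det (cadjoint A) = det (transpose (cadjoint A))" by simp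
  also have "\<dots> = cnj (det A)"
    by (simp add: det_def transpose_def)
  finally show ?thesis .
qed

lemma cinner_cadjoint: "cinner (A *v x) y = cinner x (cadjoint A *v y)"
proof -
  have "cinner (A *v x) y = (\<Sum>i\<in>UNIV. \<Sum>j\<in>UNIV. cnj (x $ j) * cnj (A $ i $ j) * y $ i)"
    by (simp add: cinner_def matrix_vector_mult_def sum_distrib_left sum_distrib_right mult_ac)
  also have "\<dots> = (\<Sum>j\<in>UNIV. \<Sum>i\<in>UNIV. cnj (x $ j) * cnj (A $ i $ j) * y $ i)"
    by (rule sum.swap)
  also have "\<dots> = cinner x (cadjoint A *v y)"
    by (simp add: cinner_def matrix_vector_mult_def sum_distrib_left mult_ac)
  finally show ?thesis .
qed

lemma cinner_commute: "cinner y x = cnj (cinner x y)"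
  by (simp add: cinner_def mult.commute)

lemma cinner_add_left: "cinner (x + y) z = cinner x z + cinner y z"
  and cinner_add_right: "cinner z (x + y) = cinner z x + cinner z y"
  and cinner_diff_left: "cinner (x - y) z = cinner x z - cinner y z"
  and cinner_diff_right: "cinner z (x - y) = cinner z x - cinner z y"
  by (simp_all add: cinner_def algebra_simps sum.distrib sum_subtractf)

lemma cinner_scale_right: "cinner x (c *s y) = c * cinner x y"
  and cinner_scale_left: "cinner (c *s x) y = cnj c * cinner x y"
  by (simp_all add: cinner_def sum_distrib_left mult_ac)

lemma cinner_scaleR_right: "cinner x (r *\<^sub>R y) = of_real r * cinner x y"
  by (simp add: cinner_def sum_distrib_left) (simp add: mult_ac scaleR_conv_of_real)

lemma cinner_self: "cinner x x = of_real ((norm x)\<^sup>2)"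
proof -
  have "cinner x x = of_real (\<Sum>i\<in>UNIV. (norm (x $ i))\<^sup>2)"
    unfolding cinner_def of_real_sum
    by (intro sum.cong refl) (metis complex_norm_square mult.commute)
  also have "(\<Sum>i\<in>UNIV. (norm (x $ i))\<^sup>2) = (norm x)\<^sup>2"
    by (simp add: norm_vec_def L2_set_def sum_nonneg)
  finally show ?thesis .
qed

lemma norm_sq_vec: "(norm x)\<^sup>2 = (\<Sum>i\<in>UNIV. (norm (x $ i))\<^sup>2)"
  by (simp add: norm_vec_def L2_set_def sum_nonneg)

lemma cinner_axis_left: "cinner (axis i 1) x = x $ i"
proof -
  have "cinner (axis i 1) x = (\<Sum>k\<in>UNIV. if k = i then x $ k else 0)"
    unfolding cinner_def axis_def by (rule sum.cong) auto
  then show ?thesis by simp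
qed

lemma matrix_vector_axis: "(A :: complex^'n^'m) *v axis i 1 = (\<chi> k. A $ k $ i)"
proof -
  have "(\<Sum>j\<in>UNIV. A $ k $ j * axis i 1 $ j) = A $ k $ i" for k
  proof -
    have "(\<Sum>j\<in>UNIV. A $ k $ j * axis i 1 $ j) = (\<Sum>j\<in>UNIV. if j = i then A $ k $ j else 0)"
      unfolding axis_def by (rule sum.cong) auto
    then show ?thesis by simp
  qed
  then show ?thesis by (simp add: matrix_vector_mult_def vec_eq_iff)
qed

lemma unitary_right: "unitary A \<Longrightarrow> A ** cadjoint A = mat 1"
  by (simp add: unitary_def matrix_left_right_inverse)

lemma unitary_cadjoint: "unitary A \<Longrightarrow> unitary (cadjoint A)"
  by (simp add: unitary_def matrix_left_right_inverse)

lemma unitary_mat_1 [simp]: "unitary (mat 1)"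
  by (simp add: unitary_def)

lemma unitary_transpose:
  assumes "unitary A"
  shows "unitary (transpose A)"
proof -
  have "transpose (A ** cadjoint A) = mat 1"
    using unitary_right[OF assms] by (simp add: transpose_mat)
  then have "transpose (cadjoint A) ** transpose A = mat 1" by (simp add: matrix_transpose_mul)
  moreover have "transpose (cadjoint A) = cadjoint (transpose A)" by (simp add: vec_eq_iff transpose_def)
  ultimately show ?thesis by (simp add: unitary_def)
qed

lemma unitary_mult: "unitary A \<Longrightarrow> unitary B \<Longrightarrow> unitary (A ** B)"
  unfolding unitary_def cadjoint_mult
  by (metis matrix_mul_assoc matrix_mul_rid)

lemma unitary_cinner: "unitary A \<Longrightarrow> cinner (A *v x) (A *v y) = cinner x y"
  by (simp add: cinner_cadjoint matrix_vector_mul_assoc unitary_def)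

lemma unitary_norm: "unitary A \<Longrightarrow> norm (A *v x) = norm x"
proof -
  assume "unitary A"
  then have "(norm (A *v x))\<^sup>2 = (norm x)\<^sup>2"
    using unitary_cinner[of A x x] unfolding cinner_self of_real_eq_iff by simp
  then show ?thesis by (simp add: power2_eq_iff_nonneg)
qed

lemma SU_iff: "A \<in> SU \<longleftrightarrow> unitary A \<and> det A = 1"
  using unitary_right by (auto simp: SU_def unitary_def)

lemma SU_mult: "A \<in> SU \<Longrightarrow> B \<in> SU \<Longrightarrow> A ** B \<in> SU"
  by (simp add: SU_iff unitary_mult det_mul)

lemma SU_cadjoint: "A \<in> SU \<Longrightarrow> cadjoint A \<in> SU"
  by (simp add: SU_iff unitary_cadjoint)

lemma SU_mat_1: "mat 1 \<in> SU"
  by (simp add: SU_iff)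

lemma unitary_norm_det: "unitary A \<Longrightarrow> cmod (det A) = 1"
proof -
  assume "unitary A"
  then have "cnj (det A) * det A = 1"
    by (metis det_I det_cadjoint det_mul unitary_def)
  then have "cmod (cnj (det A) * det A) = 1" by simp
  then have "(cmod (det A))\<^sup>2 = 1" by (simp add: norm_mult power2_eq_square)
  then show ?thesis by (simp add: power2_eq_1_iff) (smt (verit) norm_ge_zero)
qed


section \<open>Rank-one updates of the identity and the unitary action on frames\<close>

definition rank_one_update :: "complex \<Rightarrow> complex^'n \<Rightarrow> complex^'n^'n" where
  "rank_one_update a x = mat 1 + (\<chi> i j. a * x $ i * cnj (x $ j))"

lemma rank_one_update_vec: "rank_one_update a x *v z = z + (a * cinner x z) *s x"
proof -
  have "(\<chi> i j. a * x $ i * cnj (x $ j)) *v z = (a * cinner x z) *s x"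
    by (simp add: vec_eq_iff matrix_vector_mult_def cinner_def sum_distrib_left sum_distrib_right mult_ac)
  then show ?thesis by (simp add: rank_one_update_def matrix_vector_mult_add_rdistrib)
qed

lemma unitaryI_cinner:
  assumes "\<And>u v. cinner (U *v u) (U *v v) = cinner u v"
  shows "unitary U"
  unfolding unitary_def
proof (subst vec_eq_iff, intro allI, subst vec_eq_iff, intro allI)
  fix i j
  have "cinner (axis i 1) ((cadjoint U ** U) *v axis j 1) = cinner (axis i 1) (mat 1 *v axis j 1)"
    using assms[of "axis i 1" "axis j 1"] by (simp add: cinner_cadjoint matrix_vector_mul_assoc)
  then show "(cadjoint U ** U) $ i $ j = mat 1 $ i $ j"
    unfolding cinner_axis_left matrix_vector_axis by simp
qed

text \<open>For U = I + a x x^* one has U^* U = I + (a + cnj a + |a|^2 |x|^2) x x^*, and the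
  assumption says that the bracket vanishes.\<close>

lemma unitary_rank_one:
  assumes "a + cnj a + a * cnj a * cinner x x = 0"
  shows "unitary (rank_one_update a x)"
proof (rule unitaryI_cinner)
  fix u v
  have "cinner (rank_one_update a x *v u) (rank_one_update a x *v v)
      = cinner u v + cnj (cinner x u) * cinner x v * (a + cnj a + a * cnj a * cinner x x)"
    unfolding rank_one_update_vec cinner_add_left cinner_add_right cinner_scale_left
      cinner_scale_right cinner_commute[of u x] complex_cnj_mult
    by (simp add: algebra_simps)
  then show "cinner (rank_one_update a x *v u) (rank_one_update a x *v v) = cinner u v"
    using assms by simp
qed

text \<open>A complex reflection in the direction w = x - y. The real coefficient 2 / |w|^2 would be
  wrong when \<open>cinner x y\<close> is not real; the right one is 1 / \<open>cinner w x\<close>.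
  Equality of the norms gives |w|^2 = 2 Re (\<open>cinner w x\<close>), which makes the matrix
  unitary and the denominator nonzero. Being an update along w, it fixes everything orthogonal to
  w.\<close>

lemma unitary_exchange:
  fixes x y :: "complex^'n"
  assumes nxy: "norm x = norm y"
  shows "\<exists>U. unitary U \<and> (\<exists>a w. U = rank_one_update a w) \<and> U *v x = y \<and>
    (\<forall>z. cinner (x - y) z = 0 \<longrightarrow> U *v z = z)"
proof (cases "x = y")
  case True
  moreover have "mat 1 = rank_one_update 0 x" by (simp add: rank_one_update_def vec_eq_iff)
  moreover have "unitary (mat 1 :: complex^'n^'n)" by simp
  ultimately show ?thesis by (metis matrix_vector_mul_lid)
next
  case False
  define w where "w = x - y"
  define a where "a = cinner w x"
  have xy: "cinner x x = cinner y y" by (simp add: cinner_self nxy)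
  have cy: "cnj (cinner y y) = cinner y y" by (simp add: cinner_self)
  have ww: "cinner w w = a + cnj a"
    unfolding a_def w_def cinner_diff_left cinner_diff_right
    using cinner_commute[of x y] xy cy by simp
  have "cinner w w \<noteq> 0" using False by (simp add: cinner_self w_def)
  then have a0: "a \<noteq> 0" using ww by auto
  define U where "U = rank_one_update (- 1 / a) w"
  have "unitary U"
    unfolding U_def by (rule unitary_rank_one) (use a0 in \<open>simp add: ww field_simps\<close>)
  moreover have "U *v x = y"
    using a0 by (simp add: U_def rank_one_update_vec flip: a_def) (simp add: w_def vec_eq_iff)
  moreover have "U *v z = z" if "cinner (x - y) z = 0" for z
    using that by (simp add: U_def rank_one_update_vec flip: w_def)
  moreover have "\<exists>a w. U = rank_one_update a w" unfolding U_def by blast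
  ultimately show ?thesis by blast
qed

text \<open>One reflection per vector: the reflection that corrects the image of \<open>x k\<close>
  fixes each earlier \<open>y i\<close>, because equality of the Gram entries makes
  \<open>y i\<close> orthogonal to the difference \<open>U *v x k - y k\<close>. Carrying
  \<open>P\<close> along lets the same induction show both transitivity on frames and generation of
  the unitary group by rank-one updates.\<close>

lemma unitary_gram_closed:
  fixes x y :: "'i \<Rightarrow> complex^'n" and P :: "complex^'n^'n \<Rightarrow> bool"
  assumes "finite I" and "\<And>i j. i \<in> I \<Longrightarrow> j \<in> I \<Longrightarrow> cinner (x i) (x j) = cinner (y i) (y j)"
    and one: "P (mat 1)" and rank_one: "\<And>a w. P (rank_one_update a w)"
    and mult: "\<And>A B. P A \<Longrightarrow> P B \<Longrightarrow> P (A ** B)"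
  shows "\<exists>U. unitary U \<and> P U \<and> (\<forall>i\<in>I. U *v x i = y i)"
  using assms(1,2)
proof (induction I rule: finite_induct)
  case empty
  show ?case using one by (intro exI[of _ "mat 1"]) simp
next
  case (insert k I)
  obtain U where U: "unitary U" and PU: "P U" and Ux: "\<And>i. i \<in> I \<Longrightarrow> U *v x i = y i"
    using insert by auto
  have "of_real ((norm (U *v x k))\<^sup>2) = (of_real ((norm (y k))\<^sup>2) :: complex)"
    using insert.prems[of k k] unfolding unitary_norm[OF U] cinner_self[symmetric] by simp
  then have n: "norm (U *v x k) = norm (y k)"
    unfolding of_real_eq_iff by (simp add: power2_eq_iff_nonneg)
  obtain V where V: "unitary V" "V *v (U *v x k) = y k" and PV: "P V"
    and Vz: "\<And>z. cinner (U *v x k - y k) z = 0 \<Longrightarrow> V *v z = z"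
    using unitary_exchange[OF n] rank_one by metis
  have "V *v y i = y i" if i: "i \<in> I" for i
  proof (rule Vz)
    have "cinner (U *v x k) (y i) = cinner (x k) (x i)"
      using unitary_cinner[OF U] Ux[OF i] by metis
    also have "\<dots> = cinner (y k) (y i)" using insert.prems i by auto
    finally show "cinner (U *v x k - y k) (y i) = 0" by (simp add: cinner_diff_left)
  qed
  then have "\<forall>i\<in>insert k I. (V ** U) *v x i = y i"
    using V Ux by (auto simp flip: matrix_vector_mul_assoc)
  then show ?case using unitary_mult[OF V(1) U] mult[OF PV PU] by blast
qed

lemma unitary_gram:
  fixes x y :: "'i \<Rightarrow> complex^'n"
  assumes "finite I" and "\<And>i j. i \<in> I \<Longrightarrow> j \<in> I \<Longrightarrow> cinner (x i) (x j) = cinner (y i) (y j)"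
  shows "\<exists>U. unitary U \<and> (\<forall>i\<in>I. U *v x i = y i)"
  using unitary_gram_closed[of I x y "\<lambda>_. True"] assms by blast

text \<open>The standard basis and its image under \<open>U\<close> have the same Gram matrix, so
  some matrix with property \<open>P\<close> has the same columns as \<open>U\<close>.\<close>

lemma unitary_rank_one_induct [consumes 1, case_names one rank_one mult]:
  fixes U :: "complex^'n^'n"
  assumes U: "unitary U" and "P (mat 1)" "\<And>a w. P (rank_one_update a w)"
    and "\<And>A B. P A \<Longrightarrow> P B \<Longrightarrow> P (A ** B)"
  shows "P U"
proof -
  obtain V where "P V" and V: "\<And>i. V *v axis i 1 = U *v axis i 1"
    using unitary_gram_closed[of UNIV "\<lambda>i. axis i 1" "\<lambda>i. U *v axis i 1" P] assms
    by (auto simp: unitary_cinner)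
  have "V = U" using V unfolding matrix_vector_axis by (simp add: vec_eq_iff)
  then show ?thesis using \<open>P V\<close> by simp
qed

lemma unitary_diag:
  assumes "\<And>i. cmod (d $ i) = 1"
  shows "unitary (diag_matrix d)"
proof -
  have "cadjoint (diag_matrix d) = diag_matrix (\<chi> i. cnj (d $ i))"
    by (simp add: vec_eq_iff diag_matrix_def)
  moreover have "cnj (d $ i) * d $ i = 1" for i
    using complex_norm_square[of "d $ i"] assms[of i] by (simp add: mult.commute)
  ultimately show ?thesis
    by (simp add: unitary_def diag_matrix_mult) (simp add: diag_matrix_def mat_def vec_eq_iff)
qed

lemma det_diag_matrix: "det (diag_matrix d :: 'a::comm_ring_1^'n^'n) = (\<Prod>i\<in>UNIV. d $ i)"
  by (subst det_diagonal) (simp_all add: diag_matrix_def)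

lemma det_diag_one:
  "det (diag_matrix (\<chi> j. if j = i then c else 1) :: complex^'n^'n) = c"
  by (simp add: det_diag_matrix prod.delta)

text \<open>A real dimension count: complex orthogonality to \<open>y i\<close> is real
  orthogonality to \<open>y i\<close> and to its multiple by the imaginary unit, and these at most 2
  card I vectors cannot span a space of real dimension 2n.\<close>

lemma orthogonal_vector_exists:
  fixes y :: "'i \<Rightarrow> complex^'n"
  assumes "finite I" and "card I < CARD('n)"
  shows "\<exists>v. norm v = 1 \<and> (\<forall>i\<in>I. cinner (y i) v = 0)"
proof -
  define V where "V = (\<Union>i\<in>I. {y i, (\<i> *s y i)})"
  have fV: "finite V" using assms by (simp add: V_def)
  have "card V \<le> (\<Sum>i\<in>I. card {y i, (\<i> *s y i)})"
    unfolding V_def by (rule card_UN_le[OF assms(1)])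
  also have "\<dots> \<le> (\<Sum>i\<in>I. 2)" by (intro sum_mono) (simp add: card_insert_if)
  finally have "card V < DIM(complex^'n)" using assms(2) by simp
  then have "dim (span V) < DIM(complex^'n)" using dim_le_card'[OF fV] by (simp add: dim_span)
  then obtain v :: "complex^'n" where v: "v \<noteq> 0" "\<forall>x\<in>span V. orthogonal v x"
    using orthogonal_to_subspace_exists[of V] by (metis dim_span)
  have 1: "x \<bullet> v = Re (cinner x v)" for x :: "complex^'n"
    by (simp add: inner_vec_def cinner_def inner_complex_def)
  have "cinner (y i) v = 0" if i: "i \<in> I" for i
  proof -
    have "y i \<in> span V" "\<i> *s y i \<in> span V" using i by (auto simp: V_def intro!: span_base)
    then have "Re (cinner (y i) v) = 0" "Re (cinner (\<i> *s y i) v) = 0"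
      using v(2) 1 unfolding orthogonal_def by (metis inner_commute)+
    then show ?thesis by (simp add: cinner_scale_left complex_eq_iff)
  qed
  then have "\<forall>i\<in>I. cinner (y i) (v /\<^sub>R norm v) = 0"
    by (simp add: cinner_scaleR_right)
  then show ?thesis using v(1) by (intro exI[of _ "v /\<^sub>R norm v"]) simp
qed

text \<open>With fewer than n vectors there is a unit vector v orthogonal to all targets. Rescaling
  along v corrects the determinant of the unitary matrix found by \<open>unitary_gram\<close>
  without moving any target.\<close>

lemma SU_gram:
  fixes x y :: "'i \<Rightarrow> complex^'n"
  assumes I: "finite I" "card I < CARD('n)"
    and gram: "\<And>i j. i \<in> I \<Longrightarrow> j \<in> I \<Longrightarrow> cinner (x i) (x j) = cinner (y i) (y j)"
  shows "\<exists>U\<in>SU. \<forall>i\<in>I. U *v x i = y i"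
proof -
  obtain U where U: "unitary U" "\<And>i. i \<in> I \<Longrightarrow> U *v x i = y i"
    using unitary_gram[of I x y] I(1) gram by blast
  obtain v where v: "norm v = 1" "\<And>i. i \<in> I \<Longrightarrow> cinner (y i) v = 0"
    using orthogonal_vector_exists[OF I] by blast
  obtain k :: 'n where True by auto
  have nk: "norm v = norm (axis k 1 :: complex^'n)" using v(1) by simp
  obtain V where V: "unitary V" "V *v v = axis k 1"
    using unitary_exchange[OF nk] by blast
  \<comment> \<open>\<open>V\<close> carries v to the k-th axis, so conjugating \<open>D\<close> by
    \<open>V\<close> scales v by the conjugate of \<open>det U\<close>, which is its inverse because
    \<open>U\<close> is unitary.\<close>
  define D :: "complex^'n^'n" where "D = diag_matrix (\<chi> j. if j = k then cnj (det U) else 1)"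
  have D: "unitary D" unfolding D_def
    by (rule unitary_diag) (simp add: unitary_norm_det U)
  have VV: "cadjoint V ** V = mat 1" using V(1) by (simp add: unitary_def)
  define W where "W = cadjoint V ** D ** V"
  have W: "unitary W" unfolding W_def by (intro unitary_mult unitary_cadjoint V D)
  have "det W = cnj (det V) * det V * cnj (det U)"
    unfolding W_def det_mul D_def det_diag_one by simp
  also have "cnj (det V) * det V = 1" using arg_cong[OF VV, of det] by (simp add: det_mul)
  finally have dW: "det W = cnj (det U)" by simp
  have "cnj (det U) * det U = 1"
    using U(1) unfolding unitary_def by (metis det_I det_cadjoint det_mul)
  then have WU: "W ** U \<in> SU" by (simp add: SU_iff unitary_mult W U det_mul dW)
  have "W *v y i = y i" if i: "i \<in> I" for i
  proof -
    have "(V *v y i) $ k = cinner (V *v v) (V *v y i)" by (simp add: V cinner_axis_left)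
    also have "\<dots> = cinner v (y i)" by (rule unitary_cinner[OF V(1)])
    also have "\<dots> = 0" using v(2)[OF i] cinner_commute[of v "y i"] by simp
    finally have k0: "(V *v y i) $ k = 0" .
    have "D *v z = z" if "z $ k = 0" for z
    proof -
      have "(D *v z) $ j = z $ j" for j
      proof -
        have "(D *v z) $ j = (\<Sum>l\<in>UNIV. if l = j then z $ l else 0)"
          unfolding D_def diag_matrix_def matrix_vector_mult_def vec_lambda_beta
          by (rule sum.cong) (use that in auto)
        then show ?thesis by simp
      qed
      then show ?thesis by (simp add: vec_eq_iff)
    qed
    from this[OF k0] have "W *v y i = cadjoint V *v (V *v y i)"
      unfolding W_def by (simp flip: matrix_vector_mul_assoc)
    then show ?thesis by (simp add: matrix_vector_mul_assoc VV)
  qed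
  then have "\<forall>i\<in>I. (W ** U) *v x i = y i" using U(2) by (simp flip: matrix_vector_mul_assoc)
  then show ?thesis using WU by blast
qed

section \<open>Singular values\<close>

lemma pos_semidef_cinner:
  "pos_semidef A \<longleftrightarrow> cadjoint A = A \<and> (\<forall>u. 0 \<le> Re (cinner u (A *v u)))"
  by (simp add: pos_semidef_def cinner_def)

text \<open>Polarization: the vectors e_i + e_j and e_i + \<i> e_j give the imaginary and the real
  part of the relation between the entries (i, j) and (j, i).\<close>

lemma hermitian_if_real_form:
  assumes "\<And>x. Im (cinner x (P *v x)) = 0"
  shows "cadjoint P = P"
proof -
  have P: "cinner (axis i 1) (P *v axis j 1) = P $ i $ j" for i j
    by (simp add: cinner_axis_left matrix_vector_axis)
  have "cnj (P $ j $ i) = P $ i $ j" for i j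
  proof -
    let ?x = "axis i 1 + axis j 1 :: complex^'a" and ?y = "axis i 1 + \<i> *s axis j 1 :: complex^'a"
    have d: "Im (P $ k $ k) = 0" for k using assms[of "axis k 1"] by (simp add: P)
    have "Im (P $ i $ j + P $ j $ i) = 0"
      using assms[of ?x] d by (simp add: matrix_vector_right_distrib cinner_add_left cinner_add_right P)
    moreover have "Re (P $ i $ j - P $ j $ i) = 0"
      using assms[of ?y] d
      by (simp add: matrix_vector_right_distrib vector_scalar_commute cinner_add_left cinner_add_right
          cinner_scale_left cinner_scale_right P)
    ultimately show ?thesis by (simp add: complex_eq_iff)
  qed
  then show ?thesis by (simp add: vec_eq_iff)
qed

section \<open>Continuity of matrix operations and compactness of the unitary groups\<close>

lemma continuous_on_matrix_mult [continuous_intros]: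
  fixes f :: "'a::topological_space \<Rightarrow> 'b::real_normed_algebra_1^'n^'m"
  assumes "continuous_on S f" "continuous_on S g"
  shows "continuous_on S (\<lambda>x. f x ** g x)"
  unfolding matrix_matrix_mult_def
  by (intro continuous_intros assms)

lemma continuous_on_cadjoint [continuous_intros]:
  assumes "continuous_on S f"
  shows "continuous_on S (\<lambda>x. cadjoint (f x))"
  unfolding cadjoint_def by (intro continuous_intros assms)

lemma continuous_on_det [continuous_intros]:
  fixes f :: "'a::topological_space \<Rightarrow> complex^'n^'n"
  assumes "continuous_on S f"
  shows "continuous_on S (\<lambda>x. det (f x))"
  unfolding det_def by (intro continuous_intros assms)

lemma unitary_entry_le: "unitary U \<Longrightarrow> cmod (U $ i $ j) \<le> 1"
proof -
  assume "unitary U"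
  then have "norm (U *v axis j 1) = 1" by (simp add: unitary_norm)
  then show ?thesis
    using Finite_Cartesian_Product.norm_nth_le[of "U *v axis j 1" i]
    by (simp add: matrix_vector_axis)
qed

lemma compact_unitary: "compact {U :: complex^'n^'n. unitary U}"
proof (unfold compact_eq_bounded_closed, intro conjI)
  show "bounded {U :: complex^'n^'n. unitary U}"
    unfolding bounded_iff
  proof (intro exI ballI)
    fix U :: "complex^'n^'n" assume "U \<in> {U. unitary U}"
    then have U: "cmod (U $ i $ j) \<le> 1" for i j using unitary_entry_le by blast
    have "norm U \<le> (\<Sum>i\<in>UNIV. norm (U $ i))"
      unfolding norm_vec_def[of U] by (rule L2_set_le_sum) simp
    also have "\<dots> \<le> (\<Sum>i\<in>(UNIV::'n set). \<Sum>j\<in>(UNIV::'n set). cmod (U $ i $ j))"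
      by (intro sum_mono) (simp add: norm_vec_def[of "U $ _"] L2_set_le_sum)
    also have "\<dots> \<le> (\<Sum>i\<in>(UNIV::'n set). \<Sum>j\<in>(UNIV::'n set). 1)"
      by (intro sum_mono U)
    finally show "norm U \<le> (\<Sum>i\<in>(UNIV::'n set). \<Sum>j\<in>(UNIV::'n set). 1)" .
  qed
  show "closed {U :: complex^'n^'n. unitary U}"
    unfolding unitary_def by (intro closed_Collect_eq continuous_intros)
qed

lemma compact_SU: "compact (SU :: (complex^'n^'n) set)"
proof -
  have "SU = {U :: complex^'n^'n. unitary U} \<inter> det -` {1}"
    by (auto simp: SU_iff)
  moreover have "closed (det -` {1} :: (complex^'n^'n) set)"
    by (intro closed_vimage) (auto intro!: continuous_intros)
  ultimately show ?thesis using compact_unitary by (metis compact_Int_closed)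
qed

lemma matrix_add_rdistrib: "(B + C) ** A = B ** A + C ** (A :: 'a::semiring_1^'n^'m)"
  by (simp add: matrix_matrix_mult_def vec_eq_iff algebra_simps sum.distrib)

text \<open>The rotation c = cnj s / |s| carries s to |s|, so |s| \<le> Re s, which is possible only
  for real nonnegative s. This converts maximality under phase rotations into positivity of a
  form.\<close>

lemma psd_form_if_rotation_max:
  assumes "\<And>c. cmod c = 1 \<Longrightarrow> Re ((c - 1) * s) \<le> 0"
  shows "Im s = 0 \<and> 0 \<le> Re s"
proof (cases "s = 0")
  case False
  have "cmod (cnj s / of_real (cmod s)) = 1" using False by (simp add: norm_divide)
  from assms[OF this] have "Re (cnj s / of_real (cmod s) * s) \<le> Re s"
    by (simp add: algebra_simps)
  also have "cnj s / of_real (cmod s) * s = of_real (cmod s)"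
  proof -
    have "cnj s / of_real (cmod s) * s = (s * cnj s) / of_real (cmod s)" by simp
    also have "\<dots> = of_real (cmod s)"
      unfolding complex_norm_square[symmetric] using False by (simp add: power2_eq_square)
    finally show ?thesis .
  qed
  finally have 1: "cmod s \<le> Re s" by simp
  then have "(cmod s)\<^sup>2 \<le> (Re s)\<^sup>2" by (intro power_mono) auto
  then have "(Im s)\<^sup>2 \<le> 0" by (simp add: cmod_power2)
  then show ?thesis using order_trans[OF norm_ge_zero 1] by simp
qed simp

text \<open>A singular value decomposition $N = UAV$ is obtained by maximizing $\mathrm{Re}\,\mathrm{tr}(dUAV)$ over
  unitary $U$ and $V$: varying them by $I + (c - 1) x x^*$ with $|c| = |x| = 1$ shows that $Nd$ and $dN$ are
  positive semidefinite, hence $N$ is diagonal.\<close>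

lemma svd_weighted:
  fixes A :: "complex^'n^'n" and d :: "'n \<Rightarrow> real"
  assumes d0: "\<And>i. 0 < d i" and inj: "inj d"
  obtains U V :: "complex^'n^'n" and n :: "real^'n" where "unitary U" "unitary V"
    "\<And>i. 0 \<le> n $ i" "\<And>i j. d i \<le> d j \<Longrightarrow> n $ i \<le> n $ j"
    "A = U ** diag_matrix (\<chi> i. of_real (n $ i)) ** V"
proof -
  define T :: "complex^'n^'n \<Rightarrow> complex" where "T B = (\<Sum>i\<in>UNIV. of_real (d i) * B $ i $ i)" for B
  let ?UU = "{U :: complex^'n^'n. unitary U}"
  have "compact (?UU \<times> ?UU)" by (intro compact_Times compact_unitary)
  moreover have "?UU \<times> ?UU \<noteq> {}" using unitary_mat_1 by blast
  moreover have "continuous_on (?UU \<times> ?UU) (\<lambda>P. Re (T (fst P ** A ** snd P)))"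
    unfolding T_def by (intro continuous_intros)
  ultimately obtain P where "P \<in> ?UU \<times> ?UU"
    "\<And>Q. Q \<in> ?UU \<times> ?UU \<Longrightarrow> Re (T (fst Q ** A ** snd Q)) \<le> Re (T (fst P ** A ** snd P))"
    using continuous_attains_sup[of "?UU \<times> ?UU"] by blast
  then obtain U V where U: "unitary U" and V: "unitary V"
    and max: "\<And>U' V'. unitary U' \<Longrightarrow> unitary V' \<Longrightarrow> Re (T (U' ** A ** V')) \<le> Re (T (U ** A ** V))"
    by (cases P) fastforce
  define N where "N = U ** A ** V"
  have maxN: "Re (T (U' ** N ** V')) \<le> Re (T N)" if "unitary U'" "unitary V'" for U' V'
  proof -
    have "U' ** N ** V' = (U' ** U) ** A ** (V ** V')" by (simp add: N_def matrix_mul_assoc)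
    then show ?thesis using max that U V unfolding N_def by (metis unitary_mult)
  qed
  define DD :: "complex^'n^'n" where "DD = diag_matrix (\<chi> i. of_real (d i))"
  have DDl: "(DD ** B) $ i $ j = of_real (d i) * B $ i $ j" for B i j
  proof -
    have "(DD ** B) $ i $ j = (\<Sum>k\<in>UNIV. if k = i then of_real (d i) * B $ k $ j else 0)"
      unfolding matrix_matrix_mult_def DD_def diag_matrix_def vec_lambda_beta
      by (rule sum.cong) auto
    then show ?thesis by simp
  qed
  have DDr: "(B ** DD) $ i $ j = B $ i $ j * of_real (d j)" for B i j
  proof -
    have "(B ** DD) $ i $ j = (\<Sum>k\<in>UNIV. if k = j then B $ i $ k * of_real (d k) else 0)"
      unfolding matrix_matrix_mult_def DD_def diag_matrix_def vec_lambda_beta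
      by (rule sum.cong) auto
    then show ?thesis by simp
  qed
  have T_add: "T (B + C) = T B + T C" for B C
    by (simp add: T_def algebra_simps sum.distrib)
  define R where "R c x = (\<chi> i j. c * x $ i * cnj (x $ j))" for c and x :: "complex^'n"
  \<comment> \<open>Cyclicity of the weighted trace: a rank-one perturbation on the left of
    \<open>N\<close> tests the form of \<open>N ** DD\<close>, one on the right that of
    \<open>DD ** N\<close>.\<close>
  have TR1: "T (R c x ** N) = c * cinner x ((N ** DD) *v x)" for c x
  proof -
    have "T (R c x ** N) = (\<Sum>i\<in>UNIV. \<Sum>j\<in>UNIV. c * (cnj (x $ j) * N $ j $ i * of_real (d i) * x $ i))"
      by (simp add: T_def R_def matrix_matrix_mult_def sum_distrib_left mult_ac)
    also have "\<dots> = (\<Sum>j\<in>UNIV. \<Sum>i\<in>UNIV. c * (cnj (x $ j) * N $ j $ i * of_real (d i) * x $ i))"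
      by (rule sum.swap)
    also have "\<dots> = c * cinner x ((N ** DD) *v x)"
      by (simp add: cinner_def matrix_vector_mult_def DDr sum_distrib_left mult_ac)
    finally show ?thesis .
  qed
  have TR2: "T (N ** R c x) = c * cinner x ((DD ** N) *v x)" for c x
    by (simp add: T_def R_def matrix_matrix_mult_def[of N] cinner_def matrix_vector_mult_def DDl
        sum_distrib_left mult_ac)
  have form: "Im (cinner x ((N ** DD) *v x)) = 0 \<and> 0 \<le> Re (cinner x ((N ** DD) *v x))"
       "Im (cinner x ((DD ** N) *v x)) = 0 \<and> 0 \<le> Re (cinner x ((DD ** N) *v x))"
    if x: "norm x = 1" for x
  proof -
    have uni: "unitary (rank_one_update (c - 1) x)" if c: "cmod c = 1" for c
    proof (rule unitary_rank_one)
      have "c * cnj c = 1" using complex_norm_square[of c] c by simp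
      then show "c - 1 + cnj (c - 1) + (c - 1) * cnj (c - 1) * cinner x x = 0"
        by (simp add: cinner_self x algebra_simps)
    qed
    show "Im (cinner x ((N ** DD) *v x)) = 0 \<and> 0 \<le> Re (cinner x ((N ** DD) *v x))"
    proof (rule psd_form_if_rotation_max)
      fix c assume "cmod c = 1"
      from maxN[OF uni[OF this] unitary_mat_1]
      show "Re ((c - 1) * cinner x ((N ** DD) *v x)) \<le> 0"
        unfolding rank_one_update_def matrix_add_rdistrib T_add matrix_mul_lid matrix_mul_rid
        using TR1[of "c - 1" x] by (simp add: R_def)
    qed
    show "Im (cinner x ((DD ** N) *v x)) = 0 \<and> 0 \<le> Re (cinner x ((DD ** N) *v x))"
    proof (rule psd_form_if_rotation_max)
      fix c assume "cmod c = 1"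
      from maxN[OF unitary_mat_1 uni[OF this]]
      show "Re ((c - 1) * cinner x ((DD ** N) *v x)) \<le> 0"
        unfolding rank_one_update_def matrix_add_ldistrib T_add matrix_mul_lid matrix_mul_rid
        using TR2[of "c - 1" x] by (simp add: R_def)
    qed
  qed
  \<comment> \<open>The forms are controlled on unit vectors; homogeneity extends this to all
    vectors.\<close>
  have scale: "cinner x (P *v x) = of_real ((norm x)\<^sup>2) * cinner (x /\<^sub>R norm x) (P *v (x /\<^sub>R norm x))"
    if "x \<noteq> 0" for x :: "complex^'n" and P
  proof -
    have "x = of_real (norm x) *s (x /\<^sub>R norm x)"
      unfolding vec_eq_iff vector_scaleR_component vector_smult_component
      using that by (simp add: scaleR_conv_of_real)
    then have "cinner x (P *v x) = cinner (of_real (norm x) *s (x /\<^sub>R norm x)) (P *v (of_real (norm x) *s (x /\<^sub>R norm x)))"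
      by simp
    then show ?thesis
      unfolding vector_scalar_commute cinner_scale_left cinner_scale_right
      by (simp add: power2_eq_square mult_ac)
  qed
  have "Im (cinner x ((N ** DD) *v x)) = 0" "Im (cinner x ((DD ** N) *v x)) = 0" for x
    using form[of "x /\<^sub>R norm x"] scale[of x "N ** DD"] scale[of x "DD ** N"]
    by (cases "x = 0"; simp add: cinner_def)+
  then have h: "cadjoint (N ** DD) = N ** DD" "cadjoint (DD ** N) = DD ** N"
    by (auto intro: hermitian_if_real_form)
  have h1: "N $ i $ j * of_real (d j) = cnj (N $ j $ i) * of_real (d i)"
   and h2: "of_real (d i) * N $ i $ j = of_real (d j) * cnj (N $ j $ i)" for i j
    using arg_cong[OF h(1), of "\<lambda>B. B $ i $ j"] arg_cong[OF h(2), of "\<lambda>B. B $ i $ j"]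
    by (simp_all add: DDr DDl mult_ac)
  \<comment> \<open>The two Hermitian symmetries combine to N_ij d_j^2 = N_ij d_i^2. Distinct
    positive weights have distinct squares, so the entry vanishes; equal weights would only make
    \<open>N\<close> Hermitian.\<close>
  have off: "N $ i $ j = 0" if "i \<noteq> j" for i j
  proof -
    have "N $ i $ j * (of_real (d j) * of_real (d j)) = N $ i $ j * (of_real (d i) * of_real (d i))"
      using h1[of i j] h2[of i j] by (metis mult.assoc mult.commute)
    then have "N $ i $ j = 0 \<or> d j * d j = d i * d i"
      by (simp flip: of_real_mult)
    moreover have "d j * d j \<noteq> d i * d i"
      using that injD[OF inj, of i j] d0[of i] d0[of j]
      by (metis less_irrefl linorder_cases mult_strict_mono' order_less_imp_le)
    ultimately show ?thesis by simp
  qed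
  define n :: "real^'n" where "n = (\<chi> i. Re (N $ i $ i))"
  have diag: "Im (N $ i $ i) = 0 \<and> 0 \<le> Re (N $ i $ i)" for i
    using form(1)[of "axis i 1"] d0[of i]
    by (simp add: cinner_axis_left matrix_vector_axis DDr zero_le_mult_iff)
  have Nn: "N = diag_matrix (\<chi> i. of_real (n $ i))"
    using off diag by (simp add: vec_eq_iff diag_matrix_def n_def complex_eq_iff)
  \<comment> \<open>Rearrangement: conjugation with the permutation matrix of the transposition (i
    j) changes the weighted trace by (d_i - d_j)(n_j - n_i), which maximality forces to be
    nonpositive.\<close>
  have sorted: "n $ i \<le> n $ j" if "d i < d j" for i j
  proof -
    let ?t = "Transposition.transpose i j"
    define S :: "complex^'n^'n" where "S = (\<chi> a b. if b = ?t a then 1 else 0)"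
    have Sv: "S *v x = (\<chi> a. x $ ?t a)" for x
    proof -
      have "(\<Sum>b\<in>UNIV. (if b = ?t a then 1 else 0) * x $ b) = x $ ?t a" for a
      proof -
        have "(\<Sum>b\<in>UNIV. (if b = ?t a then 1 else 0) * x $ b) = (\<Sum>b\<in>UNIV. if b = ?t a then x $ b else 0)"
          by (rule sum.cong) auto
        then show ?thesis by simp
      qed
      then show ?thesis by (simp add: S_def matrix_vector_mult_def vec_eq_iff)
    qed
    have S: "unitary S"
    proof (rule unitaryI_cinner)
      fix u v
      show "cinner (S *v u) (S *v v) = cinner u v"
        unfolding Sv cinner_def vec_lambda_beta
        by (rule sum.reindex_bij_betw[of ?t UNIV UNIV "\<lambda>a. cnj (u $ a) * v $ a"])
           (rule bij_betw_byWitness[where f' = ?t], auto)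
    qed
    have "(S ** N ** cadjoint S) $ a $ a = of_real (n $ ?t a)" for a
    proof -
      have "(S ** N ** cadjoint S) $ a $ a = ((S ** N ** cadjoint S) *v axis a 1) $ a"
        by (simp only: matrix_vector_axis vec_lambda_beta)
      also have "\<dots> = (S *v (N *v (cadjoint S *v axis a 1))) $ a"
        by (simp only: matrix_vector_mul_assoc matrix_mul_assoc)
      also have "cadjoint S *v axis a 1 = (axis (?t a) 1 :: complex^'n)"
        unfolding matrix_vector_axis by (simp add: S_def vec_eq_iff axis_def)
      also have "(S *v (N *v axis (?t a) 1)) $ a = of_real (n $ ?t a)"
        by (simp add: Sv matrix_vector_axis) (simp add: Nn diag_matrix_def)
      finally show ?thesis .
    qed
    then have "Re (T (S ** N ** cadjoint S)) = (\<Sum>a\<in>UNIV. d a * n $ ?t a)"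
      by (simp add: T_def)
    moreover have "Re (T N) = (\<Sum>a\<in>UNIV. d a * n $ a)"
      by (simp add: T_def n_def)
    ultimately have "(\<Sum>a\<in>UNIV. d a * n $ ?t a - d a * n $ a) \<le> 0"
      using maxN[OF S unitary_cadjoint[OF S]] by (simp add: sum_subtractf)
    also have "(\<Sum>a\<in>UNIV. d a * n $ ?t a - d a * n $ a) = (\<Sum>a\<in>{i,j}. d a * n $ ?t a - d a * n $ a)"
      by (rule sum.mono_neutral_right) (auto simp: transpose_eq_iff)
    also have "\<dots> = (d i - d j) * (n $ j - n $ i)" using that by (cases "i = j") (simp_all add: algebra_simps)
    finally show ?thesis using that by (simp add: mult_le_0_iff)
  qed
  show thesis
  proof (rule that[OF unitary_cadjoint[OF U] unitary_cadjoint[OF V]])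
    show "0 \<le> n $ i" for i using diag by (simp add: n_def)
    show "n $ i \<le> n $ j" if "d i \<le> d j" for i j
    proof (cases "i = j")
      case False
      then have "d i \<noteq> d j" using injD[OF inj] by blast
      then show ?thesis using that by (intro sorted) linarith
    qed simp
    have "cadjoint U ** N ** cadjoint V = (cadjoint U ** U) ** A ** (V ** cadjoint V)"
      by (simp add: N_def matrix_mul_assoc)
    then show "A = cadjoint U ** diag_matrix (\<chi> i. of_real (n $ i)) ** cadjoint V"
      using U V Nn by (simp add: unitary_def unitary_right)
  qed
qed

text \<open>The index type carries no order here, so the distinct weights come from an arbitrary
  injection into the naturals and the singular values come unsorted.\<close>

lemma svd_exists:
  fixes A :: "complex^'n^'n"
  obtains U V :: "complex^'n^'n" and n :: "real^'n" where "unitary U" "unitary V"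
    "\<And>i. 0 \<le> n $ i" "A = U ** diag_matrix (\<chi> i. of_real (n $ i)) ** V"
proof -
  obtain e :: "'n \<Rightarrow> nat" where "inj e" using finite_imp_inj_to_nat_seg[of "UNIV :: 'n set"] by auto
  then have inj: "inj (\<lambda>i. 1 + real (e i))" by (auto simp: inj_def)
  have pos: "0 < 1 + real (e i)" for i by simp
  show thesis by (rule svd_weighted[OF pos inj, where A = A], rule that)
qed

section \<open>Characteristic polynomials and ordered singular values\<close>

definition const_poly_mat :: "complex^'n^'n \<Rightarrow> complex poly^'n^'n" where
  "const_poly_mat A = (\<chi> i j. [:A $ i $ j:])"

lemma const_poly_mat_mult: "const_poly_mat (A ** B) = const_poly_mat A ** const_poly_mat B"
proof -
  have "[:\<Sum>k\<in>UNIV. f k:] = (\<Sum>k\<in>UNIV. [:f k:])" for f :: "'a \<Rightarrow> complex"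
    by (simp add: poly_eq_iff coeff_sum coeff_pCons split: nat.split)
  then show ?thesis
    by (simp add: const_poly_mat_def matrix_matrix_mult_def vec_eq_iff mult.commute)
qed

lemma matrix_diff_ldistrib: "A ** (B - C) = A ** B - A ** (C :: 'a::ring_1^'n^'m)"
  and matrix_diff_rdistrib: "(B - C) ** D = B ** D - C ** (D :: 'a::ring_1^'k^'n)"
  by (simp_all add: matrix_matrix_mult_def vec_eq_iff algebra_simps sum_subtractf)

text \<open>The scalar matrix \<open>?X\<close> is central, so over the polynomial ring X - P B Q =
  P (X - B) Q, and the outer determinants cancel.\<close>

lemma charpoly_similar:
  fixes P Q B :: "complex^'n^'n"
  assumes "Q ** P = mat 1"
  shows "charpoly (P ** B ** Q) = charpoly B"
proof -
  let ?X = "mat [:0, 1:] :: complex poly^'n^'n"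
  have X: "?X ** M = M ** ?X" for M
  proof -
    have "(\<Sum>k\<in>UNIV. (if i = k then [:0, 1:] else 0) * M $ k $ j) = [:0, 1:] * M $ i $ j"
     "(\<Sum>k\<in>UNIV. M $ i $ k * (if k = j then [:0, 1:] else 0)) = M $ i $ j * [:0, 1:]" for i j
      by (simp_all add: if_distrib if_distribR sum.delta sum.delta' cong: if_cong)
    then show ?thesis
      by (simp add: mat_def matrix_matrix_mult_def vec_eq_iff)
  qed
  have c1: "const_poly_mat (mat 1 :: complex^'n^'n) = mat 1"
    by (simp add: const_poly_mat_def mat_def vec_eq_iff one_pCons)
  have PQ: "const_poly_mat P ** const_poly_mat Q = mat 1"
    using assms by (metis c1 const_poly_mat_mult matrix_left_right_inverse)
  have "?X - const_poly_mat (P ** B ** Q)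
      = const_poly_mat P ** (?X - const_poly_mat B) ** const_poly_mat Q"
    by (simp add: const_poly_mat_mult matrix_diff_ldistrib matrix_diff_rdistrib )
       (metis PQ X matrix_mul_assoc matrix_mul_rid)
  then have "det (?X - const_poly_mat (P ** B ** Q))
      = det (const_poly_mat P ** const_poly_mat Q) * det (?X - const_poly_mat B)"
    by (simp add: det_mul)
  moreover have "charpoly M = det (?X - const_poly_mat M)" for M
    by (simp add: charpoly_def const_poly_mat_def)
  ultimately show ?thesis by (simp add: PQ)
qed

lemma proots_charpoly_diag:
  "proots (charpoly (diag_matrix d)) = image_mset (\<lambda>i. d $ i) (mset_set UNIV)"
proof -
  have "charpoly (diag_matrix d) = det (diag_matrix (\<chi> i. [:- (d $ i), 1:]))"
    unfolding charpoly_def by (rule arg_cong[of _ _ det]) (simp add: diag_matrix_def mat_def vec_eq_iff)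
  also have "\<dots> = (\<Prod>i\<in>UNIV. [:- (d $ i), 1:])" by (simp add: det_diag_matrix)
  finally have 1: "charpoly (diag_matrix d) = (\<Prod>i\<in>UNIV. [:- (d $ i), 1:])" .
  have "(\<Sum>i\<in>A. {#d $ i#}) = image_mset (\<lambda>i. d $ i) (mset_set A)" if "finite A" for A
    using that by (induction A) auto
  then show ?thesis by (simp add: 1 proots_prod)
qed

text \<open>In a strictly sorted enumeration the entries before i are exactly the elements below i.
  This matches the indexing by rank in \<open>sigma_sing\<close> with the order of the index
  type.\<close>

lemma sorted_list_of_set_nth_rank:
  "sorted_list_of_set (UNIV :: 'n::{finite,linorder} set) ! card {j. j < i} = i"
proof -
  let ?xs = "sorted_list_of_set (UNIV :: 'n set)"
  have s: "sorted_wrt (<) ?xs" by (rule strict_sorted_list_of_set)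
  have "i \<in> set ?xs" by simp
  then obtain k where k: "k < length ?xs" "?xs ! k = i" by (metis in_set_conv_nth)
  have lt: "?xs ! a < ?xs ! b \<longleftrightarrow> a < b" if "a < length ?xs" "b < length ?xs" for a b
    using that s by (metis linorder_less_linear order_less_asym sorted_wrt_iff_nth_less)
  have "{j. j < i} = (\<lambda>l. ?xs ! l) ` {..<k}"
  proof (intro equalityI subsetI)
    fix j assume "j \<in> {j. j < i}"
    moreover have "j \<in> set ?xs" by simp
    then obtain l where "l < length ?xs" "?xs ! l = j" by (metis in_set_conv_nth)
    ultimately show "j \<in> (\<lambda>l. ?xs ! l) ` {..<k}" using k lt by auto
  qed (use k lt in auto)
  moreover have "inj_on (\<lambda>l. ?xs ! l) {..<k}"
    using k by (auto simp: inj_on_def nth_eq_iff_index_eq)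
  ultimately show ?thesis using k by (simp add: card_image)
qed

text \<open>A^* A is unitarily similar to the diagonal matrix of the squares of n, so the roots of
  its characteristic polynomial are known; an increasing n is already in the sorted order. After
  this, singular values are handled only through decompositions and the definition by roots
  disappears.\<close>

lemma sigma_sing_eqI:
  fixes A U V :: "'n::{finite,linorder} cmat"
  assumes U: "unitary U" and V: "unitary V" and n0: "\<And>i. 0 \<le> n $ i"
    and mono: "\<And>i j. i \<le> j \<Longrightarrow> n $ i \<le> n $ j"
    and A: "A = U ** diag_matrix (\<chi> i. of_real (n $ i)) ** V"
  shows "sigma_sing A = n"
proof -
  let ?D = "diag_matrix (\<chi> i. of_real (n $ i)) :: 'n cmat"
  have cD: "cadjoint ?D = ?D" by (simp add: vec_eq_iff diag_matrix_def)
  have "cadjoint A ** A = cadjoint V ** (?D ** ((cadjoint U ** U) ** ?D)) ** V"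
    by (simp add: A cadjoint_mult cD matrix_mul_assoc)
  also have "\<dots> = cadjoint V ** diag_matrix (\<chi> i. of_real ((n $ i)\<^sup>2)) ** V"
    using U by (simp add: unitary_def diag_matrix_mult power2_eq_square)
  finally have "charpoly (cadjoint A ** A) = charpoly (diag_matrix (\<chi> i. of_real ((n $ i)\<^sup>2)) :: 'n cmat)"
    using charpoly_similar[of V "cadjoint V"] unitary_right[OF V] by simp
  then have "image_mset (\<lambda>c. sqrt (Re c)) (proots (charpoly (cadjoint A ** A)))
     = image_mset (\<lambda>i. sqrt (Re (of_real ((n $ i)\<^sup>2)))) (mset_set UNIV)"
    by (simp add: proots_charpoly_diag multiset.map_comp o_def del: of_real_power)
  also have "\<dots> = image_mset (\<lambda>i. n $ i) (mset_set UNIV)"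
    using n0 by simp
  also have "\<dots> = mset (map (\<lambda>i. n $ i) (sorted_list_of_set UNIV))"
    by (simp flip: sorted_list_of_mset_set)
  finally have "sorted_list_of_multiset (image_mset (\<lambda>c. sqrt (Re c)) (proots (charpoly (cadjoint A ** A))))
     = sort (map (\<lambda>i. n $ i) (sorted_list_of_set UNIV))"
    by (metis sorted_list_of_multiset_mset)
  also have "\<dots> = map (\<lambda>i. n $ i) (sorted_list_of_set UNIV)"
    by (rule sorted_sort_id)
       (auto simp: sorted_map intro!: sorted_wrt_mono_rel[OF _ sorted_sorted_list_of_set] mono)
  finally have *: "sorted_list_of_multiset (image_mset (\<lambda>c. sqrt (Re c)) (proots (charpoly (cadjoint A ** A))))
     = map (\<lambda>i. n $ i) (sorted_list_of_set UNIV)" .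
  have "card {j. j < i} < card (UNIV :: 'n set)" for i :: 'n
    by (intro psubset_card_mono) auto
  then show ?thesis
    unfolding sigma_sing_def * by (simp add: vec_eq_iff sorted_list_of_set_nth_rank)
qed

text \<open>The weights 1 + rank increase along the index order, so the decomposition of
  \<open>svd_weighted\<close> comes out sorted and its diagonal is
  \<open>sigma_sing A\<close>.\<close>

lemma svd_sigma_sing:
  fixes A :: "'n::{finite,linorder} cmat"
  obtains U V :: "'n cmat" where
    "unitary U" "unitary V" "A = U ** diag_matrix (\<chi> i. of_real (sigma_sing A $ i)) ** V"
    "\<And>i. 0 \<le> sigma_sing A $ i" "\<And>i j. i \<le> j \<Longrightarrow> sigma_sing A $ i \<le> sigma_sing A $ j"
proof -
  define d :: "'n \<Rightarrow> real" where "d i = 1 + real (card {j. j < i})" for i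
  have d0: "0 < d i" for i by (simp add: d_def add_pos_nonneg)
  have dmono: "d i < d j" if "i < j" for i j
    unfolding d_def using that by (auto intro!: psubset_card_mono)
  have "inj d" by (metis dmono injI less_irrefl linorder_cases)
  obtain U V :: "'n cmat" and n where U: "unitary U" and V: "unitary V"
    and n0: "\<And>i. 0 \<le> n $ i" and n: "\<And>i j. d i \<le> d j \<Longrightarrow> n $ i \<le> n $ j"
    and A: "A = U ** diag_matrix (\<chi> i. of_real (n $ i)) ** V"
    by (rule svd_weighted[OF d0 \<open>inj d\<close>, where A = A], rule that)
  have mono: "n $ i \<le> n $ j" if "i \<le> j" for i j
    using n[of i j] dmono[of i j] that by (cases "i = j") (auto simp: less_le)
  have "sigma_sing A = n"
    by (rule sigma_sing_eqI[OF U V n0 mono A])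
  then show thesis using that[OF U V] A n0 mono by simp
qed

section \<open>Lebesgue measure and linear maps\<close>

text \<open>The Fubini argument for uniqueness of Haar measure. In the double integral of f(x) g(y),
  shifting y by -x, then x by y, then y by -x yields f(y) g(-x), where the measures have changed
  roles.\<close>

lemma nn_integral_translation_invariant:
  fixes M :: "'a::euclidean_space measure" and f g :: "'a \<Rightarrow> ennreal"
  assumes "sigma_finite_measure M" and sets: "sets M = sets borel"
    and inv: "\<And>a. distr M borel ((+) a) = M"
    and f[measurable]: "f \<in> borel_measurable borel" and g[measurable]: "g \<in> borel_measurable borel"
  shows "(\<integral>\<^sup>+x. f x \<partial>M) * (\<integral>\<^sup>+x. g x \<partial>lborel) = (\<integral>\<^sup>+x. g (- x) \<partial>M) * (\<integral>\<^sup>+x. f x \<partial>lborel)"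
proof -
  interpret M: sigma_finite_measure M by fact
  interpret pair_sigma_finite M lborel ..
  note [measurable_cong] = sets
  have transM: "(\<integral>\<^sup>+x. h (a + x) \<partial>M) = (\<integral>\<^sup>+x. h x \<partial>M)" if [measurable]: "h \<in> borel_measurable borel" for h :: "'a \<Rightarrow> ennreal" and a
  proof -
    have "(\<integral>\<^sup>+x. h x \<partial>M) = (\<integral>\<^sup>+x. h x \<partial>distr M borel ((+) a))" by (simp only: inv)
    also have "\<dots> = (\<integral>\<^sup>+x. h (a + x) \<partial>M)" by (rule nn_integral_distr) simp_all
    finally show ?thesis by simp
  qed
  have transL: "(\<integral>\<^sup>+x. h (a + x) \<partial>lborel) = (\<integral>\<^sup>+x. h x \<partial>lborel)" if [measurable]: "h \<in> borel_measurable borel" for h :: "'a \<Rightarrow> ennreal" and a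
  proof -
    have "(\<integral>\<^sup>+x. h x \<partial>lborel) = (\<integral>\<^sup>+x. h x \<partial>distr lborel borel ((+) a))" by (simp only: lborel_distr_plus)
    also have "\<dots> = (\<integral>\<^sup>+x. h (a + x) \<partial>lborel)" by (rule nn_integral_distr) simp_all
    finally show ?thesis by simp
  qed
  have "(\<integral>\<^sup>+x. f x \<partial>M) * (\<integral>\<^sup>+x. g x \<partial>lborel) = (\<integral>\<^sup>+x. (\<integral>\<^sup>+y. f x * g y \<partial>lborel) \<partial>M)"
    by (simp add: nn_integral_cmult nn_integral_multc)
  also have "\<dots> = (\<integral>\<^sup>+x. (\<integral>\<^sup>+y. f x * g (- x + y) \<partial>lborel) \<partial>M)"
  proof (rule nn_integral_cong)
    fix x show "(\<integral>\<^sup>+y. f x * g y \<partial>lborel) = (\<integral>\<^sup>+y. f x * g (- x + y) \<partial>lborel)"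
      using transL[of "\<lambda>y. f x * g y" "- x"] by simp
  qed
  also have "\<dots> = (\<integral>\<^sup>+y. (\<integral>\<^sup>+x. f x * g (- x + y) \<partial>M) \<partial>lborel)"
    by (rule Fubini'[symmetric]) simp
  also have "\<dots> = (\<integral>\<^sup>+y. (\<integral>\<^sup>+x. f (y + x) * g (- (y + x) + y) \<partial>M) \<partial>lborel)"
  proof (rule nn_integral_cong)
    fix y show "(\<integral>\<^sup>+x. f x * g (- x + y) \<partial>M) = (\<integral>\<^sup>+x. f (y + x) * g (- (y + x) + y) \<partial>M)"
      using transM[of "\<lambda>x. f x * g (- x + y)" y] by simp
  qed
  also have "\<dots> = (\<integral>\<^sup>+y. (\<integral>\<^sup>+x. f (y + x) * g (- x) \<partial>M) \<partial>lborel)"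
    by simp
  also have "\<dots> = (\<integral>\<^sup>+x. (\<integral>\<^sup>+y. f (y + x) * g (- x) \<partial>lborel) \<partial>M)"
    by (rule Fubini') simp
  also have "\<dots> = (\<integral>\<^sup>+x. (\<integral>\<^sup>+y. f y * g (- x) \<partial>lborel) \<partial>M)"
  proof (rule nn_integral_cong)
    fix x show "(\<integral>\<^sup>+y. f (y + x) * g (- x) \<partial>lborel) = (\<integral>\<^sup>+y. f y * g (- x) \<partial>lborel)"
      using transL[of "\<lambda>y. f y * g (- x)" x] by (simp add: add.commute)
  qed
  also have "\<dots> = (\<integral>\<^sup>+x. g (- x) \<partial>M) * (\<integral>\<^sup>+x. f x \<partial>lborel)"
    by (simp add: nn_integral_cmult nn_integral_multc mult.commute)
  finally show ?thesis .
qed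

text \<open>The image of Lebesgue measure is again translation invariant, hence proportional to it,
  and the unit ball, being preserved, shows that the factor is 1.\<close>

lemma lborel_distr_isometry:
  fixes h :: "'a::euclidean_space \<Rightarrow> 'a"
  assumes lin: "linear h" and norm: "\<And>x. norm (h x) = norm x"
  shows "distr lborel borel h = lborel"
proof -
  have orth: "orthogonal_transformation h"
    using assms by (simp add: orthogonal_transformation)
  have h[measurable]: "h \<in> borel_measurable borel"
    by (intro borel_measurable_continuous_onI linear_continuous_on linear_linear[THEN iffD2] lin)
  have cball: "h -` cball 0 r = cball 0 r" for r by (auto simp: norm)
  define M where "M = distr lborel borel h"
  have sets: "sets M = sets borel" by (simp add: M_def)
  have sp: "space M = UNIV" by (simp add: M_def)
  have fin: "emeasure lborel (cball (0::'a) r) \<noteq> top" for r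
    using emeasure_lborel_cball_finite[of "0::'a" r] by simp
  have ball: "emeasure M (cball 0 r) = emeasure lborel (cball 0 r :: 'a set)" for r
    by (simp add: M_def emeasure_distr cball)
  have sf: "sigma_finite_measure M"
  proof
    have "\<Union>(range (\<lambda>n. cball (0::'a) (real n))) = UNIV"
      by (auto simp: real_arch_simple)
    then show "\<exists>A. countable A \<and> A \<subseteq> sets M \<and> \<Union> A = space M \<and> (\<forall>a\<in>A. emeasure M a \<noteq> \<infinity>)"
      by (intro exI[of _ "range (\<lambda>n. cball (0::'a) (real n))"])
         (auto simp: sets ball sp fin)
  qed
  \<comment> \<open>By surjectivity a = h b, and translating by a after \<open>h\<close> is the same
    as translating by b before \<open>h\<close>.\<close>
  have inv: "distr M borel ((+) a) = M" for a
  proof -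
    obtain b where b: "a = h b" using orthogonal_transformation_surj[OF orth] by auto
    have "distr M borel ((+) a) = distr lborel borel (h \<circ> (+) b)"
      unfolding M_def by (subst distr_distr) (auto simp: o_def b linear_add[OF lin])
    also have "\<dots> = distr (distr lborel borel ((+) b)) borel h"
      by (rule distr_distr[symmetric]) auto
    finally show ?thesis by (simp add: lborel_distr_plus M_def)
  qed
  have "M = lborel"
  proof (rule measure_eqI)
    fix A assume "A \<in> sets M"
    then have A[measurable]: "A \<in> sets borel" by (simp add: sets)
    have "emeasure M A * emeasure lborel (cball 0 1 :: 'a set)
        = (\<integral>\<^sup>+x. indicator A x \<partial>M) * (\<integral>\<^sup>+x. indicator (cball 0 1) x \<partial>(lborel :: 'a measure))"
      by (simp add: sets)
    also have "\<dots> = (\<integral>\<^sup>+x. indicator (cball 0 1) (- x) \<partial>M) * (\<integral>\<^sup>+x. indicator A x \<partial>lborel)"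
      by (rule nn_integral_translation_invariant[OF sf sets inv])
         (auto intro!: borel_measurable_indicator borel_closed)
    also have "(\<integral>\<^sup>+x. indicator (cball 0 1) (- x) \<partial>M) = (\<integral>\<^sup>+x. indicator (cball 0 1) x \<partial>M)"
      by (intro nn_integral_cong) (auto simp: indicator_def)
    also have "\<dots> = emeasure lborel (cball 0 1 :: 'a set)"
      using sets by (simp add: ball)
    finally have "emeasure M A * emeasure lborel (cball 0 1 :: 'a set)
        = emeasure lborel (cball 0 1 :: 'a set) * emeasure lborel A" by simp
    moreover have "emeasure lborel (cball 0 1 :: 'a set) \<noteq> 0"
      using unit_ball_vol_pos[of "real DIM('a)"]
      unfolding emeasure_cball[OF zero_le_one] by (simp del: unit_ball_vol_pos)
    moreover have "emeasure lborel (cball 0 1 :: 'a set) \<noteq> \<infinity>"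
      using emeasure_lborel_cball_finite[of "0::'a" 1] by simp
    ultimately show "emeasure M A = emeasure lborel A"
      by (metis ennreal_mult_cancel_left infinity_ennreal_def mult.commute)
  qed (simp add: sets)
  then show ?thesis by (simp add: M_def)
qed

lemma nn_integral_lborel_isometry:
  fixes h :: "'a::euclidean_space \<Rightarrow> 'a"
  assumes lin: "linear h" and norm: "\<And>x. norm (h x) = norm x"
    and [measurable]: "f \<in> borel_measurable borel"
  shows "(\<integral>\<^sup>+x. f (h x) \<partial>lborel) = (\<integral>\<^sup>+x. f x \<partial>lborel)"
proof -
  have [measurable]: "h \<in> borel_measurable borel"
    by (intro borel_measurable_continuous_onI linear_continuous_on linear_linear[THEN iffD2] lin)
  have "(\<integral>\<^sup>+x. f x \<partial>lborel) = (\<integral>\<^sup>+x. f x \<partial>distr lborel borel h)"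
    by (simp only: lborel_distr_isometry[OF lin norm])
  also have "\<dots> = (\<integral>\<^sup>+x. f (h x) \<partial>lborel)" by (rule nn_integral_distr) simp_all
  finally show ?thesis by simp
qed

section \<open>Change of variables under complex linear maps\<close>

lemma linear_matrix_vector_complex: "linear ((*v) (A :: complex^'n^'m))"
proof (rule linearI)
  show "A *v (r *\<^sub>R x) = r *\<^sub>R (A *v x)" for r x
    by (simp add: matrix_vector_mult_def vec_eq_iff scaleR_sum_right)
qed (simp add: matrix_vector_right_distrib)

lemma nn_integral_unitary:
  assumes "unitary U" and "f \<in> borel_measurable borel"
  shows "(\<integral>\<^sup>+x. f (U *v x) \<partial>lborel) = (\<integral>\<^sup>+x. f x \<partial>lborel)"
  using nn_integral_lborel_isometry[OF linear_matrix_vector_complex unitary_norm[OF assms(1)] assms(2)] .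

lemma Basis_vec_prod:
  fixes f :: "'a::euclidean_space^'n \<Rightarrow> 'b::comm_monoid_mult"
  shows "(\<Prod>j\<in>Basis. f j) = (\<Prod>i\<in>UNIV. \<Prod>b\<in>Basis. f (axis i b))"
proof -
  have B: "Basis = (\<lambda>(i, b). axis i b :: 'a^'n) ` (UNIV \<times> Basis)"
    by (auto simp: Basis_vec_def)
  have inj: "inj_on (\<lambda>(i, b). axis i b :: 'a^'n) (UNIV \<times> Basis)"
    by (auto simp: inj_on_def axis_eq_axis nonzero_Basis)
  show ?thesis
    unfolding B prod.reindex[OF inj] by (simp add: prod.cartesian_product split_def)
qed

text \<open>The squares arise because every complex coordinate is two real ones.\<close>

lemma nn_integral_scale_coords:
  fixes f :: "complex^'n \<Rightarrow> ennreal"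
  assumes r: "\<And>i. 0 < r i" and [measurable]: "f \<in> borel_measurable borel"
  shows "(\<integral>\<^sup>+x. f x \<partial>lborel) = ennreal (\<Prod>i\<in>UNIV. (r i)\<^sup>2) * (\<integral>\<^sup>+x. f (\<chi> i. r i *\<^sub>R x $ i) \<partial>lborel)"
proof -
  \<comment> \<open>The affine substitution rule expects the scale as a function of the real basis
    vector; on \<open>axis i b\<close> with \<open>b\<close> of norm 1 this sum evaluates to
    \<open>r i\<close>.\<close>
  define c :: "complex^'n \<Rightarrow> real" where "c j = (\<Sum>i\<in>UNIV. r i * norm (j $ i))" for j
  have c: "c (axis i b) = r i" if "b \<in> Basis" for i b
  proof -
    have "c (axis i b) = (\<Sum>k\<in>UNIV. if k = i then r k else 0)"
      unfolding c_def by (rule sum.cong) (use that in \<open>auto simp: axis_def\<close>)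
    then show ?thesis by simp
  qed
  let ?T = "\<lambda>x. 0 + (\<Sum>j\<in>Basis. (c j * (x \<bullet> j)) *\<^sub>R j) :: complex^'n"
  have T: "?T x = (\<chi> i. r i *\<^sub>R x $ i)" for x
  proof (rule euclidean_eqI)
    fix k :: "complex^'n" assume k: "k \<in> Basis"
    then obtain i b where ib: "k = axis i b" "b \<in> Basis" by (auto simp: Basis_vec_def)
    have "?T x \<bullet> k = c k * (x \<bullet> k)" using k by (simp add: inner_sum_left inner_Basis if_distrib[of "\<lambda>t. _ * t"] sum.delta cong: if_cong)
    also have "\<dots> = (\<chi> i. r i *\<^sub>R x $ i) \<bullet> k" by (simp add: ib c inner_axis)
    finally show "?T x \<bullet> k = (\<chi> i. r i *\<^sub>R x $ i) \<bullet> k" .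
  qed
  have c0: "c j \<noteq> 0" if "j \<in> Basis" for j
    using that r c by (auto simp: Basis_vec_def) (metis less_irrefl)
  have K: "(\<Prod>j\<in>Basis. \<bar>c j\<bar>) = (\<Prod>i\<in>UNIV. (r i)\<^sup>2)"
    unfolding Basis_vec_prod using r by (intro prod.cong refl) (simp add: c Basis_complex_def power2_eq_square less_imp_le)
  have [measurable]: "(\<lambda>x :: complex^'n. \<chi> i. r i *\<^sub>R x $ i) \<in> borel_measurable borel"
    by (intro borel_measurable_continuous_onI continuous_intros)
  have "(\<integral>\<^sup>+x. f x \<partial>lborel) = (\<integral>\<^sup>+x. f x \<partial>density (distr lborel borel (\<lambda>x. \<chi> i. r i *\<^sub>R x $ i)) (\<lambda>_. ennreal (\<Prod>i\<in>UNIV. (r i)\<^sup>2)))"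
    using lborel_affine_euclidean[of c 0, OF c0] unfolding T K by simp
  also have "\<dots> = ennreal (\<Prod>i\<in>UNIV. (r i)\<^sup>2) * (\<integral>\<^sup>+x. f (\<chi> i. r i *\<^sub>R x $ i) \<partial>lborel)"
    by (simp add: nn_integral_density nn_integral_distr nn_integral_cmult)
  finally show ?thesis .
qed

lemma diag_matrix_vec: "diag_matrix d *v x = (\<chi> i. d $ i * (x :: 'a::semiring_1^'n) $ i)"
proof -
  have "(\<Sum>j\<in>UNIV. (if i = j then d $ i else 0) * x $ j) = d $ i * x $ i" for i
  proof -
    have "(\<Sum>j\<in>UNIV. (if i = j then d $ i else 0) * x $ j) = (\<Sum>j\<in>UNIV. if j = i then d $ i * x $ j else 0)"
      by (rule sum.cong) auto
    then show ?thesis by simp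
  qed
  then show ?thesis by (simp add: diag_matrix_def matrix_vector_mult_def vec_eq_iff)
qed

text \<open>A singular value decomposition reduces the claim to unitary maps, which preserve
  Lebesgue measure, and to a positive diagonal scaling. The factor is the real Jacobian |det A|^2 of
  a complex linear map.\<close>

lemma nn_integral_linear_complex:
  fixes A :: "complex^'n^'n"
  assumes det: "det A \<noteq> 0" and [measurable]: "f \<in> borel_measurable borel"
  shows "(\<integral>\<^sup>+x. f x \<partial>lborel) = ennreal ((cmod (det A))\<^sup>2) * (\<integral>\<^sup>+x. f (A *v x) \<partial>lborel)"
proof -
  obtain U V :: "complex^'n^'n" and n :: "real^'n" where U: "unitary U" and V: "unitary V"
    and n0: "\<And>i. 0 \<le> n $ i" and A: "A = U ** diag_matrix (\<chi> i. of_real (n $ i)) ** V"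
    by (rule svd_exists[of A], rule that)
  let ?D = "diag_matrix (\<chi> i. of_real (n $ i)) :: complex^'n^'n"
  have "cmod (det A) = cmod (det ?D)"
    unfolding A using unitary_norm_det[OF U] unitary_norm_det[OF V] by (simp add: det_mul norm_mult)
  also have "\<dots> = (\<Prod>i\<in>UNIV. n $ i)"
    using n0 by (simp add: det_diag_matrix prod_nonneg flip: of_real_prod)
  finally have dA: "cmod (det A) = (\<Prod>i\<in>UNIV. n $ i)" .
  have npos: "0 < n $ i" for i
  proof -
    have "(\<Prod>i\<in>UNIV. n $ i) \<noteq> 0" using dA det by (metis norm_eq_zero)
    then show ?thesis using n0[of i] by (auto simp: less_le prod_zero_iff)
  qed
  have [measurable]: "(\<lambda>x. B *v x) \<in> borel_measurable borel" for B :: "complex^'n^'n"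
    by (intro borel_measurable_continuous_onI linear_continuous_on linear_linear[THEN iffD2] linear_matrix_vector_complex)
  have D: "(\<chi> i. n $ i *\<^sub>R x $ i) = ?D *v x" for x :: "complex^'n"
    unfolding diag_matrix_vec by (simp add: vec_eq_iff) (simp add: scaleR_conv_of_real)
  have "(\<integral>\<^sup>+x. f (A *v x) \<partial>lborel) = (\<integral>\<^sup>+x. f (U *v (?D *v (V *v x))) \<partial>lborel)"
    unfolding A by (simp add: matrix_vector_mul_assoc matrix_mul_assoc)
  also have "\<dots> = (\<integral>\<^sup>+x. f (U *v (?D *v x)) \<partial>lborel)"
    by (rule nn_integral_unitary[OF V, of "\<lambda>x. f (U *v (?D *v x))"]) simp
  finally have 1: "(\<integral>\<^sup>+x. f (A *v x) \<partial>lborel) = (\<integral>\<^sup>+x. f (U *v (?D *v x)) \<partial>lborel)" .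
  have "(\<integral>\<^sup>+x. f x \<partial>lborel) = (\<integral>\<^sup>+x. f (U *v x) \<partial>lborel)"
    by (rule nn_integral_unitary[OF U, symmetric]) simp
  also have "\<dots> = ennreal (\<Prod>i\<in>UNIV. (n $ i)\<^sup>2) * (\<integral>\<^sup>+x. f (U *v (?D *v x)) \<partial>lborel)"
    using nn_integral_scale_coords[of "\<lambda>i. n $ i" "\<lambda>x. f (U *v x)"] npos by (simp add: D)
  finally show ?thesis by (simp add: 1 dA prod_power_distrib)
qed

section \<open>Partial norms and coordinates of a unit vector\<close>

definition norm_sq_on :: "'n set \<Rightarrow> complex^'n \<Rightarrow> real" where
  "norm_sq_on T x = (\<Sum>i\<in>T. (cmod (x $ i))\<^sup>2)"

lemma norm_sq_on_nonneg [simp]: "0 \<le> norm_sq_on T x"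
  by (simp add: norm_sq_on_def sum_nonneg)

lemma measurable_norm_sq_on [measurable]: "norm_sq_on T \<in> borel_measurable borel"
  unfolding norm_sq_on_def by (intro borel_measurable_continuous_onI continuous_intros)

lemma measurable_vec_nth_borel [measurable]: "(\<lambda>x. x $ i) \<in> borel_measurable borel"
  by (intro borel_measurable_continuous_onI continuous_intros)

lemma measure_eqI_atMost:
  fixes M N :: "real measure"
  assumes sets: "sets M = sets borel" "sets N = sets borel"
    and fin: "emeasure M UNIV \<noteq> \<infinity>" and UNIV: "emeasure M UNIV = emeasure N UNIV"
    and eq: "\<And>x. emeasure M {..x} = emeasure N {..x}"
  shows "M = N"
proof (rule measure_eqI_lessThan[OF sets])
  have sp: "space M = UNIV" "space N = UNIV" using sets by (metis sets_eq_imp_space_eq space_borel)+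
  have C: "{x<..} = UNIV - {..x}" for x :: real by auto
  have finx: "emeasure M {..x} \<noteq> \<infinity>" for x
    using fin emeasure_space[of M "{..x}"] by (auto simp: sp top_unique)
  show "emeasure M {x<..} < \<infinity>" for x
    using fin emeasure_space[of M "{x<..}"] by (auto simp: sp top_unique less_top[symmetric])
  show "emeasure M {x<..} = emeasure N {x<..}" for x
  proof -
    have "emeasure M {x<..} = emeasure M UNIV - emeasure M {..x}"
      unfolding C using finx[of x] by (intro emeasure_Diff) (auto simp: sets)
    also have "\<dots> = emeasure N UNIV - emeasure N {..x}" by (simp add: UNIV eq)
    also have "\<dots> = emeasure N {x<..}"
      unfolding C using finx[of x] eq by (intro emeasure_Diff[symmetric]) (auto simp: sets)
    finally show ?thesis .
  qed
qed

lemma nn_integral_power_Icc: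
  assumes "0 < D" "0 \<le> x"
  shows "(\<integral>\<^sup>+v. ennreal (real D * v ^ (D - 1)) * indicator {0..x} v \<partial>lborel) = ennreal (x ^ D)"
proof -
  have "(\<integral>\<^sup>+v. ennreal (real D * v ^ (D - 1)) * indicator {0..x} v \<partial>lborel) = ennreal (x ^ D - 0 ^ D)"
    by (rule nn_integral_FTC_Icc) (use assms in \<open>auto intro!: derivative_eq_intros\<close>)
  then show ?thesis using assms by simp
qed

text \<open>The radial law of the coordinates in \<open>T\<close>. Scaling them by sqrt v multiplies
  Lebesgue measure by v ^ card T (two real dimensions per coordinate) and leaves the weight
  \<open>b\<close> unchanged, so the distribution function of the squared norm is c v ^ card T on
  the unit interval.\<close>

lemma nn_integral_norm_sq_on:
  fixes b :: "complex^'n \<Rightarrow> ennreal" and T :: "'n set"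
  assumes T: "T \<noteq> {}"
    and b[measurable]: "b \<in> borel_measurable borel"
    and inv: "\<And>r x. 0 < r \<Longrightarrow> b (\<chi> i. (if i \<in> T then r else 1) *\<^sub>R x $ i) = b x"
    and c: "c = (\<integral>\<^sup>+x. b x * indicator {..1} (norm_sq_on T x) \<partial>lborel)" "c \<noteq> \<infinity>"
    and f[measurable]: "f \<in> borel_measurable borel"
  shows "(\<integral>\<^sup>+x. b x * indicator {..1} (norm_sq_on T x) * f (norm_sq_on T x) \<partial>lborel)
    = c * (\<integral>\<^sup>+v. ennreal (real (card T) * v ^ (card T - 1)) * indicator {0..1} v * f v \<partial>lborel)"
proof -
  let ?D = "card T"
  have D: "0 < ?D" using T by (simp add: card_gt_0_iff)
  have pos: "(\<integral>\<^sup>+x. b x * indicator {..v} (norm_sq_on T x) \<partial>lborel) = c * ennreal (v ^ ?D)" if v: "0 < v" for v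
  proof -
    define r where "r i = (if i \<in> T then sqrt v else 1)" for i
    have r: "0 < r i" for i using v by (simp add: r_def)
    have "(\<Prod>i\<in>UNIV. (r i)\<^sup>2) = (\<Prod>i\<in>UNIV. if i \<in> T then v else 1)"
      using v by (intro prod.cong) (auto simp: r_def)
    also have "\<dots> = v ^ ?D" by (simp add: prod.If_cases)
    finally have pr: "(\<Prod>i\<in>UNIV. (r i)\<^sup>2) = v ^ ?D" .
    have n: "norm_sq_on T (\<chi> i. r i *\<^sub>R x $ i) = v * norm_sq_on T x" for x :: "complex^'n"
      using v by (simp add: norm_sq_on_def r_def power_mult_distrib sum_distrib_left)
    have bb: "b (\<chi> i. r i *\<^sub>R x $ i) = b x" for x
      using inv[of "sqrt v" x] v by (simp add: r_def)
    have ind: "indicator {..v} (v * t) = (indicator {..1} t :: ennreal)" for t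
      using v by (simp add: indicator_def)
    have "(\<integral>\<^sup>+x. b x * indicator {..v} (norm_sq_on T x) \<partial>lborel) = ennreal (v ^ ?D) * c"
      by (subst nn_integral_scale_coords[of r]) (simp_all add: r pr n bb ind c)
    then show ?thesis by (simp add: mult.commute)
  qed
  \<comment> \<open>The scaling argument needs v > 0. For v \<le> 0 the mass is bounded by the value
    c u ^ card T at every u > 0, which tends to 0; finiteness of \<open>c\<close> enters
    here.\<close>
  have zero: "(\<integral>\<^sup>+x. b x * indicator {..v} (norm_sq_on T x) \<partial>lborel) = 0" if "v \<le> 0" for v
  proof -
    have "(\<integral>\<^sup>+x. b x * indicator {..v} (norm_sq_on T x) \<partial>lborel) \<le> c * ennreal (u ^ ?D)" if "0 < u" for u
      unfolding pos[OF that, symmetric]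
      by (intro nn_integral_mono mult_left_mono) (use \<open>v \<le> 0\<close> that in \<open>auto simp: indicator_def\<close>)
    moreover have "((\<lambda>u. c * ennreal (u ^ ?D)) \<longlongrightarrow> c * ennreal (0 ^ ?D)) (at_right 0)"
      using c(2) by (intro tendsto_intros ennreal_tendsto_cmult) (auto simp: less_top)
    ultimately have "(\<integral>\<^sup>+x. b x * indicator {..v} (norm_sq_on T x) \<partial>lborel) \<le> c * ennreal (0 ^ ?D)"
      by (intro tendsto_lowerbound[where F = "at_right (0::real)"]) (auto simp: eventually_at_right_less eventually_at_filter)
    also have "c * ennreal (0 ^ ?D) = 0" using D by (simp add: zero_power)
    finally show ?thesis by simp
  qed
  define M where "M = distr (density lborel (\<lambda>x. b x * indicator {..1} (norm_sq_on T x))) borel (norm_sq_on T)"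
  define N where "N = density lborel (\<lambda>v. c * (ennreal (real ?D * v ^ (?D - 1)) * indicator {0..1} v))"
  have M: "emeasure M A = (\<integral>\<^sup>+x. b x * indicator {..1} (norm_sq_on T x) * indicator A (norm_sq_on T x) \<partial>lborel)"
    if [measurable]: "A \<in> sets borel" for A
  proof -
    have [measurable]: "norm_sq_on T -` A \<in> sets borel"
      using measurable_sets[OF measurable_norm_sq_on that] by simp
    show ?thesis
      unfolding M_def by (subst emeasure_distr) (auto simp: emeasure_density indicator_vimage intro!: nn_integral_cong split: split_indicator)
  qed
  have N: "emeasure N A = c * (\<integral>\<^sup>+v. ennreal (real ?D * v ^ (?D - 1)) * indicator {0..1} v * indicator A v \<partial>lborel)"
    if [measurable]: "A \<in> sets borel" for A
    unfolding N_def by (subst emeasure_density) (auto simp: nn_integral_cmult mult.assoc)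
  have "M = N"
  proof (rule measure_eqI_atMost)
    have MU: "emeasure M UNIV = c" by (simp add: M c)
    then show "emeasure M UNIV \<noteq> \<infinity>" using c(2) by simp
    have NU: "emeasure N UNIV = c" using nn_integral_power_Icc[OF D, of 1] by (simp add: N)
    show "emeasure M UNIV = emeasure N UNIV" by (simp add: MU NU)
    fix x
    have i1: "b s * indicator {..1} t * indicator {..x} t = b s * indicator {..min 1 x} t" for s and t :: real
      by (auto simp: indicator_def)
    have i2: "e * indicator {0..1} t * indicator {..x} t = e * indicator {0..min 1 x} t" for e :: ennreal and t :: real
      by (auto simp: indicator_def)
    show "emeasure M {..x} = emeasure N {..x}"
    proof (cases "0 < x")
      case True
      then show ?thesis
        by (simp add: M N i1 i2 pos nn_integral_power_Icc[OF D, simplified])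
    next
      case False
      then have "(\<integral>\<^sup>+v. ennreal (real ?D * v ^ (?D - 1)) * indicator {0..min 1 x} v \<partial>lborel) = (\<integral>\<^sup>+v. ennreal (real ?D * v ^ (?D - 1)) * indicator {0..x} v \<partial>lborel)"
        by (simp add: min_def)
      also have "\<dots> \<le> (\<integral>\<^sup>+v. ennreal (real ?D * v ^ (?D - 1)) * indicator {0..0} v \<partial>lborel)"
        by (intro nn_integral_mono mult_left_mono) (use False in \<open>auto simp: indicator_def\<close>)
      also have "\<dots> = 0" using nn_integral_power_Icc[OF D, of 0] D by simp
      finally show ?thesis using False by (simp add: M N i1 i2 zero min_def)
    qed
  qed (simp_all add: M_def N_def)
  have "(\<integral>\<^sup>+x. b x * indicator {..1} (norm_sq_on T x) * f (norm_sq_on T x) \<partial>lborel) = (\<integral>\<^sup>+v. f v \<partial>M)"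
    by (simp add: M_def nn_integral_distr nn_integral_density)
  also have "\<dots> = (\<integral>\<^sup>+v. f v \<partial>N)" by (simp add: \<open>M = N\<close>)
  also have "\<dots> = c * (\<integral>\<^sup>+v. ennreal (real ?D * v ^ (?D - 1)) * indicator {0..1} v * f v \<partial>lborel)"
    by (simp add: N_def nn_integral_density nn_integral_cmult mult.assoc)
  finally show ?thesis .
qed

lemma norm_sq_on_UNIV: "norm_sq_on UNIV x = (norm x)\<^sup>2"
  by (simp add: norm_sq_on_def norm_sq_vec)

lemma norm_sq_on_Un: "A \<inter> B = {} \<Longrightarrow> norm_sq_on (A \<union> B) x = norm_sq_on A x + norm_sq_on B x"
  for A B :: "'n::finite set"
  by (simp add: norm_sq_on_def sum.union_disjoint)

text \<open>Exchanging a separate vector of C^q with the coordinates selected by \<iota> is a linear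
  isometry of the product space. It turns the selected coordinates of a vector into an independent
  variable of integration.\<close>

lemma nn_integral_swap_coords:
  fixes \<iota> :: "'q::finite \<Rightarrow> 'p::finite" and G :: "(complex^'q) \<times> (complex^'p) \<Rightarrow> ennreal"
  assumes inj: "inj \<iota>" and [measurable]: "G \<in> borel_measurable borel"
  shows "(\<integral>\<^sup>+z. G z \<partial>lborel) = (\<integral>\<^sup>+z. G ((\<chi> j. snd z $ \<iota> j),
     (\<chi> i. if i \<in> range \<iota> then fst z $ inv \<iota> i else snd z $ i)) \<partial>lborel)"
proof -
  let ?h = "\<lambda>z :: (complex^'q) \<times> (complex^'p). ((\<chi> j. snd z $ \<iota> j) :: complex^'q,
     (\<chi> i. if i \<in> range \<iota> then fst z $ inv \<iota> i else snd z $ i) :: complex^'p)"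
  have "linear ?h"
    by (rule linearI) (auto simp: vec_eq_iff)
  moreover have "norm (?h z) = norm z" for z
  proof -
    obtain y s where z: "z = (y, s)" by (cases z)
    have U: "UNIV = range \<iota> \<union> - range \<iota>" by auto
    have r: "(\<Sum>i\<in>range \<iota>. f i) = (\<Sum>j\<in>UNIV. f (\<iota> j))" for f :: "'p \<Rightarrow> real"
      using sum.reindex[OF inj, of f] by simp
    have "(norm (snd (?h z)))\<^sup>2 = (norm y)\<^sup>2 + norm_sq_on (- range \<iota>) s"
      unfolding norm_sq_on_UNIV[symmetric]
      by (subst U, subst norm_sq_on_Un) (auto simp: norm_sq_on_def r z inv_f_f[OF inj] intro!: sum.cong)
    moreover have "(norm s)\<^sup>2 = (norm (fst (?h z)))\<^sup>2 + norm_sq_on (- range \<iota>) s"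
      unfolding norm_sq_on_UNIV[symmetric]
      by (subst U, subst norm_sq_on_Un) (auto simp: norm_sq_on_def r z)
    ultimately have "(norm (fst (?h z)))\<^sup>2 + (norm (snd (?h z)))\<^sup>2 = (norm y)\<^sup>2 + (norm s)\<^sup>2"
      by simp
    then show ?thesis by (simp add: z norm_Pair)
  qed
  ultimately show ?thesis
    by (intro nn_integral_lborel_isometry[symmetric]) auto
qed

text \<open>The law of $q$ coordinates of a uniformly distributed unit vector of $\mathbb C^N$ has density
  $(1 - |y|^2)^{N - q - 1}$ on the unit ball.  Replacing the unit vector by $s / |s|$ with $s$ in the unit
  ball, the substitution is reduced to the translation $w = |y|^2 + v$, where $v$ is the squared norm of
  the other coordinates, and the scaling $y \mapsto \sqrt w\, y$.\<close>

lemma nn_integral_sphere_coords: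
  fixes \<iota> :: "'q::finite \<Rightarrow> 'p::finite" and S :: "'p::finite set"
  assumes inj: "inj \<iota>" and disj: "range \<iota> \<inter> S = {}" and T': "T' = - S - range \<iota>" "T' \<noteq> {}"
  shows "\<exists>C. \<forall>f \<in> borel_measurable borel.
     (\<integral>\<^sup>+s. indicator {..1} (norm_sq_on S s) * indicator {0<..1} (norm_sq_on (- S) s) *
        f ((1 / sqrt (norm_sq_on (- S) s)) *\<^sub>R (\<chi> j. s $ \<iota> j)) \<partial>lborel)
     = C * (\<integral>\<^sup>+y. indicator (cball 0 1) y * ennreal ((1 - (norm y)\<^sup>2) ^ (card T' - 1)) * f (y :: complex^'q) \<partial>lborel)"
proof -
  define D where "D = card T'"
  have D: "0 < D" using T' by (simp add: D_def card_gt_0_iff)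
  \<comment> \<open>The mass of an auxiliary variable in the unit ball of C^q. It is introduced so
    that \<open>nn_integral_swap_coords\<close> can exchange it with the selected coordinates, and
    it is divided out at the end. After the exchange it occupies the coordinates in
    \<open>range \<iota>\<close>, which explains the second factor of the weight
    \<open>b\<close>.\<close>
  define B where "B = emeasure lborel (cball (0 :: complex^'q) 1)"
  have B: "B \<noteq> 0" "B \<noteq> \<infinity>"
    using unit_ball_vol_pos[of "real DIM(complex^'q)"] emeasure_lborel_cball_finite[of "0 :: complex^'q" 1]
    unfolding B_def by (simp_all add: emeasure_cball del: unit_ball_vol_pos)
  define b :: "complex^'p \<Rightarrow> ennreal" where
    "b s = indicator {..1} (norm_sq_on S s) * indicator {..1} (norm_sq_on (range \<iota>) s)" for s
  have b[measurable]: "b \<in> borel_measurable borel" unfolding b_def by simp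
  define c where "c = (\<integral>\<^sup>+x. b x * indicator {..1} (norm_sq_on T' x) \<partial>lborel)"
  have split: "(norm s)\<^sup>2 = norm_sq_on S s + (norm_sq_on (range \<iota>) s + norm_sq_on T' s)" for s
  proof -
    have U: "UNIV = S \<union> (range \<iota> \<union> T')" and d: "S \<inter> (range \<iota> \<union> T') = {}" "range \<iota> \<inter> T' = {}"
      using T' disj by auto
    show ?thesis
      unfolding norm_sq_on_UNIV[symmetric] U norm_sq_on_Un[OF d(1)] norm_sq_on_Un[OF d(2)] ..
  qed
  have splitT: "norm_sq_on (- S) s = norm_sq_on (range \<iota>) s + norm_sq_on T' s" for s
  proof -
    have U: "- S = range \<iota> \<union> T'" and d: "range \<iota> \<inter> T' = {}" using T' disj by auto
    show ?thesis unfolding U norm_sq_on_Un[OF d] ..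
  qed
  have rng: "norm_sq_on (range \<iota>) s = (norm (\<chi> j. s $ \<iota> j))\<^sup>2" for s
    using sum.reindex[OF inj, of "\<lambda>i. (cmod (s $ i))\<^sup>2"] by (simp add: norm_sq_on_def norm_sq_vec)
  have "c \<le> (\<integral>\<^sup>+x. indicator (cball (0 :: complex^'p) 2) x \<partial>lborel)"
    unfolding c_def
  proof (intro nn_integral_mono)
    fix x :: "complex^'p"
    show "b x * indicator {..1} (norm_sq_on T' x) \<le> indicator (cball 0 2) x"
    proof (cases "norm_sq_on S x \<le> 1 \<and> norm_sq_on (range \<iota>) x \<le> 1 \<and> norm_sq_on T' x \<le> 1")
      case True
      then have "(norm x)\<^sup>2 \<le> 2\<^sup>2" using split[of x] by simp
      then have "norm x \<le> 2" by (rule power2_le_imp_le) simp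
      then show ?thesis by (simp add: b_def indicator_def)
    qed (auto simp: b_def indicator_def)
  qed
  also have "\<dots> < \<infinity>" by (simp add: emeasure_lborel_cball_finite[unfolded infinity_ennreal_def])
  finally have c_fin: "c \<noteq> \<infinity>" by simp
  \<comment> \<open>The factor w ^ q is the Jacobian of y \<mapsto> sqrt w y on C^q, and w ^ (D - 1)
    comes from w - |sqrt w y|^2 = w (1 - |y|^2).\<close>
  define C' where "C' = c * (\<integral>\<^sup>+w. indicator {0<..1} w * ennreal (real D * w ^ (card (UNIV :: 'q set)) * w ^ (D - 1)) \<partial>lborel)"
  have main: "(\<integral>\<^sup>+s. indicator {..1} (norm_sq_on S s) * indicator {0<..1} (norm_sq_on (- S) s) *
        f ((1 / sqrt (norm_sq_on (- S) s)) *\<^sub>R (\<chi> j. s $ \<iota> j)) \<partial>lborel)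
     = C' / B * (\<integral>\<^sup>+y. indicator (cball 0 1) y * ennreal ((1 - (norm y)\<^sup>2) ^ (D - 1)) * f (y :: complex^'q) \<partial>lborel)"
    (is "?L = _ * ?J") if f[measurable]: "f \<in> borel_measurable borel" for f
  proof -
    define g :: "complex^'q \<Rightarrow> real \<Rightarrow> ennreal" where
      "g y w = indicator {0<..1} w * f ((1 / sqrt w) *\<^sub>R y)" for y w
    have g[measurable]: "(\<lambda>z. g (fst z) (snd z)) \<in> borel_measurable (borel \<Otimes>\<^sub>M borel)"
      unfolding g_def by measurable
    have [measurable]: "(\<lambda>s :: complex^'p. (\<chi> j. s $ \<iota> j) :: complex^'q) \<in> borel_measurable borel"
      by (intro borel_measurable_continuous_onI continuous_intros)
    define K where "K s = indicator {..1} (norm_sq_on S s) * g (\<chi> j. s $ \<iota> j) (norm_sq_on (- S) s)" for s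
    have K[measurable]: "K \<in> borel_measurable borel"
      unfolding K_def g_def by measurable
    have [measurable]: "cball (0 :: complex^'q) 1 \<in> sets borel" by (rule borel_closed) simp
    have "B * ?L = (\<integral>\<^sup>+y. (\<integral>\<^sup>+s. indicator (cball (0 :: complex^'q) 1) y * K s \<partial>lborel) \<partial>lborel)"
    proof -
      have "?L = (\<integral>\<^sup>+s. K s \<partial>lborel)" by (simp add: K_def g_def mult.assoc)
      then show ?thesis by (simp add: nn_integral_cmult nn_integral_multc B_def)
    qed
    also have "\<dots> = (\<integral>\<^sup>+z. indicator (cball (0 :: complex^'q) 1) (fst z) * K (snd z) \<partial>lborel)"
      by (subst lborel_prod[symmetric], subst lborel.nn_integral_fst[symmetric]) simp_all
    also have "\<dots> = (\<integral>\<^sup>+z. b (snd z) * g (fst z) ((norm (fst z))\<^sup>2 + norm_sq_on T' (snd z)) \<partial>lborel)"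
    proof (rule trans[OF nn_integral_swap_coords[OF inj]])
      show "(\<lambda>z :: (complex^'q) \<times> (complex^'p). indicator (cball (0 :: complex^'q) 1) (fst z) * K (snd z)) \<in> borel_measurable borel"
        by (subst borel_prod[symmetric]) measurable
    next
      show "(\<integral>\<^sup>+z. indicator (cball (0 :: complex^'q) 1) (fst (\<chi> j. snd z $ \<iota> j, \<chi> i. if i \<in> range \<iota> then fst z $ inv \<iota> i else snd z $ i))
           * K (snd ((\<chi> j. snd z $ \<iota> j) :: complex^'q, \<chi> i. if i \<in> range \<iota> then fst z $ inv \<iota> i else snd z $ i)) \<partial>lborel)
        = (\<integral>\<^sup>+z. b (snd z) * g (fst z) ((norm (fst z))\<^sup>2 + norm_sq_on T' (snd z)) \<partial>lborel)"
      proof (intro nn_integral_cong)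
      fix z :: "(complex^'q) \<times> (complex^'p)"
      let ?s = "\<chi> i. if i \<in> range \<iota> then fst z $ inv \<iota> i else snd z $ i"
      have "norm_sq_on S ?s = norm_sq_on S (snd z)"
        unfolding norm_sq_on_def using disj by (intro sum.cong) auto
      moreover have "norm_sq_on T' ?s = norm_sq_on T' (snd z)"
        unfolding norm_sq_on_def using T' by (intro sum.cong) auto
      moreover have e: "(\<chi> j. ?s $ \<iota> j) = fst z" by (simp add: vec_eq_iff inv_f_f[OF inj])
      moreover have "norm_sq_on (- S) ?s = (norm (fst z))\<^sup>2 + norm_sq_on T' (snd z)"
        unfolding splitT rng e by (simp only: calculation)
      moreover have "indicator (cball (0 :: complex^'q) 1) (\<chi> j. snd z $ \<iota> j) = (indicator {..1} (norm_sq_on (range \<iota>) (snd z)) :: ennreal)"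
        by (simp add: rng indicator_def power_le_one_iff)
      ultimately show "indicator (cball 0 1) (fst (\<chi> j. snd z $ \<iota> j, ?s)) * K (snd (\<chi> j. snd z $ \<iota> j, ?s))
          = b (snd z) * g (fst z) ((norm (fst z))\<^sup>2 + norm_sq_on T' (snd z))"
        by (simp add: K_def b_def mult_ac)
      qed
    qed
    also have "\<dots> = (\<integral>\<^sup>+y. (\<integral>\<^sup>+s. b s * g y ((norm y)\<^sup>2 + norm_sq_on T' s) \<partial>lborel) \<partial>lborel)"
    proof -
      have "(\<lambda>z. b (snd z) * g (fst z) ((norm (fst z))\<^sup>2 + norm_sq_on T' (snd z))) \<in> borel_measurable (lborel \<Otimes>\<^sub>M lborel)"
        unfolding g_def by measurable
      then show ?thesis
        by (subst lborel_prod[symmetric], subst lborel.nn_integral_fst[symmetric]) simp_all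
    qed
    also have "\<dots> = (\<integral>\<^sup>+y. (\<integral>\<^sup>+w. c * (indicator {0<..1} w * indicator {(norm y)\<^sup>2..} w
         * ennreal (real D * (w - (norm y)\<^sup>2) ^ (D - 1)) * f ((1 / sqrt w) *\<^sub>R y)) \<partial>lborel) \<partial>lborel)"
    proof (intro nn_integral_cong)
      fix y :: "complex^'q"
      have [measurable]: "g y \<in> borel_measurable borel" unfolding g_def by measurable
      let ?n = "(norm y)\<^sup>2"
      have "(\<integral>\<^sup>+s. b s * g y (?n + norm_sq_on T' s) \<partial>lborel)
        = (\<integral>\<^sup>+s. b s * indicator {..1} (norm_sq_on T' s) * g y (?n + norm_sq_on T' s) \<partial>lborel)"
      proof (intro nn_integral_cong)
        fix s
        \<comment> \<open>The cutoff at 1 built into \<open>g\<close> already bounds the squared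
          norm on \<open>T'\<close>, so the indicator expected by the radial law can be
          inserted.\<close>
        have "g y (?n + norm_sq_on T' s) = 0" if "1 < norm_sq_on T' s"
          using that by (simp add: g_def indicator_def) (smt (verit) zero_le_power2)
        then show "b s * g y (?n + norm_sq_on T' s) = b s * indicator {..1} (norm_sq_on T' s) * g y (?n + norm_sq_on T' s)"
          by (auto simp: indicator_def)
      qed
      also have "\<dots> = c * (\<integral>\<^sup>+v. ennreal (real D * v ^ (D - 1)) * indicator {0..1} v * g y (?n + v) \<partial>lborel)"
        unfolding D_def
      proof (rule nn_integral_norm_sq_on[OF T'(2) b _ c_def c_fin, of "\<lambda>v. g y (?n + v)"])
        fix r :: real and x :: "complex^'p" assume "0 < r"
        have "norm_sq_on S (\<chi> i. (if i \<in> T' then r else 1) *\<^sub>R x $ i) = norm_sq_on S x"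
          "norm_sq_on (range \<iota>) (\<chi> i. (if i \<in> T' then r else 1) *\<^sub>R x $ i) = norm_sq_on (range \<iota>) x"
          unfolding norm_sq_on_def using T' by (auto intro!: sum.cong)
        then show "b (\<chi> i. (if i \<in> T' then r else 1) *\<^sub>R x $ i) = b x" by (simp add: b_def)
      qed simp
      also have "(\<integral>\<^sup>+v. ennreal (real D * v ^ (D - 1)) * indicator {0..1} v * g y (?n + v) \<partial>lborel)
         = (\<integral>\<^sup>+w. ennreal (real D * (w - ?n) ^ (D - 1)) * indicator {0..1} (w - ?n) * g y w \<partial>lborel)"
        by (subst nn_integral_real_affine[where c = 1 and t = "- ?n"]) simp_all
      also have "\<dots> = (\<integral>\<^sup>+w. indicator {0<..1} w * indicator {?n..} w
         * ennreal (real D * (w - ?n) ^ (D - 1)) * f ((1 / sqrt w) *\<^sub>R y) \<partial>lborel)"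
      proof (intro nn_integral_cong)
        fix w :: real
        have "0 \<le> ?n" by simp
        then have "w - ?n \<le> 1" if "w \<le> 1" using that by linarith
        then show "ennreal (real D * (w - ?n) ^ (D - 1)) * indicator {0..1} (w - ?n) * g y w = indicator {0<..1} w * indicator {?n..} w
         * ennreal (real D * (w - ?n) ^ (D - 1)) * f ((1 / sqrt w) *\<^sub>R y)"
          by (auto simp: g_def indicator_def mult_ac)
      qed
      finally show "(\<integral>\<^sup>+s. b s * g y (?n + norm_sq_on T' s) \<partial>lborel) = (\<integral>\<^sup>+w. c * (indicator {0<..1} w * indicator {?n..} w
         * ennreal (real D * (w - ?n) ^ (D - 1)) * f ((1 / sqrt w) *\<^sub>R y)) \<partial>lborel)"
        by (simp add: nn_integral_cmult)
    qed
    also have "\<dots> = (\<integral>\<^sup>+w. (\<integral>\<^sup>+y. c * (indicator {0<..1} w * indicator {0..} (w - (norm y)\<^sup>2)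
         * ennreal (real D * (w - (norm y)\<^sup>2) ^ (D - 1)) * f ((1 / sqrt w) *\<^sub>R y)) \<partial>lborel) \<partial>lborel)"
    proof -
      have "indicator {(norm y)\<^sup>2..} w = (indicator {0..} (w - (norm y)\<^sup>2) :: ennreal)" for y :: "complex^'q" and w
        by (simp add: indicator_def)
      then show ?thesis by (simp only:) (rule lborel_pair.Fubini', measurable)
    qed
    also have "\<dots> = (\<integral>\<^sup>+w. c * (indicator {0<..1} w * ennreal (real D * w ^ card (UNIV :: 'q set) * w ^ (D - 1))) * ?J \<partial>lborel)"
    proof (intro nn_integral_cong)
      fix w :: real
      show "(\<integral>\<^sup>+y. c * (indicator {0<..1} w * indicator {0..} (w - (norm y)\<^sup>2)
         * ennreal (real D * (w - (norm y)\<^sup>2) ^ (D - 1)) * f ((1 / sqrt w) *\<^sub>R y)) \<partial>lborel)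
        = c * (indicator {0<..1} w * ennreal (real D * w ^ card (UNIV :: 'q set) * w ^ (D - 1))) * ?J"
      proof (cases "0 < w \<and> w \<le> 1")
        case True
        then have w: "0 < sqrt w" "(sqrt w)\<^sup>2 = w" "0 < w" by auto
        have sc: "(\<chi> i. sqrt w *\<^sub>R y $ i) = sqrt w *\<^sub>R y" for y :: "complex^'q" by (simp add: vec_eq_iff)
        have "(\<integral>\<^sup>+y. indicator {0..} (w - (norm y)\<^sup>2) * ennreal (real D * (w - (norm y)\<^sup>2) ^ (D - 1))
            * f ((1 / sqrt w) *\<^sub>R y) \<partial>lborel)
          = ennreal (w ^ card (UNIV :: 'q set)) * (\<integral>\<^sup>+y. indicator {0..} (w - (norm (sqrt w *\<^sub>R y))\<^sup>2)
            * ennreal (real D * (w - (norm (sqrt w *\<^sub>R y))\<^sup>2) ^ (D - 1)) * f ((1 / sqrt w) *\<^sub>R (sqrt w *\<^sub>R y)) \<partial>lborel)"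
          by (subst nn_integral_scale_coords[of "\<lambda>_. sqrt w"]) (use w in \<open>simp_all add: sc\<close>)
        also have "(\<integral>\<^sup>+y. indicator {0..} (w - (norm (sqrt w *\<^sub>R y))\<^sup>2)
            * ennreal (real D * (w - (norm (sqrt w *\<^sub>R y))\<^sup>2) ^ (D - 1)) * f ((1 / sqrt w) *\<^sub>R (sqrt w *\<^sub>R y)) \<partial>lborel)
          = (\<integral>\<^sup>+y. ennreal (real D * w ^ (D - 1)) * (indicator (cball 0 1) y * ennreal ((1 - (norm y)\<^sup>2) ^ (D - 1)) * f y) \<partial>lborel)"
        proof (intro nn_integral_cong)
          fix y :: "complex^'q"
          have "w - (norm (sqrt w *\<^sub>R y))\<^sup>2 = w * (1 - (norm y)\<^sup>2)"
            using w by (simp add: power_mult_distrib algebra_simps)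
          moreover have "indicator {0..} (w * (1 - (norm y)\<^sup>2)) = (indicator (cball 0 1) y :: ennreal)"
            using w by (simp add: indicator_def zero_le_mult_iff power_le_one_iff abs_square_le_1)
          moreover have "ennreal (real D * (w * (1 - (norm y)\<^sup>2)) ^ (D - 1)) = ennreal (real D * w ^ (D - 1)) * ennreal ((1 - (norm y)\<^sup>2) ^ (D - 1))"
            if "norm y \<le> 1"
            using w that by (simp add: power_mult_distrib mult.assoc ennreal_mult power_le_one_iff abs_square_le_1)
          ultimately show "indicator {0..} (w - (norm (sqrt w *\<^sub>R y))\<^sup>2)
            * ennreal (real D * (w - (norm (sqrt w *\<^sub>R y))\<^sup>2) ^ (D - 1)) * f ((1 / sqrt w) *\<^sub>R (sqrt w *\<^sub>R y))
            = ennreal (real D * w ^ (D - 1)) * (indicator (cball 0 1) y * ennreal ((1 - (norm y)\<^sup>2) ^ (D - 1)) * f y)"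
            using w by (cases "norm y \<le> 1") (simp_all add: mult.assoc)
        qed
        also have "\<dots> = ennreal (real D * w ^ (D - 1)) * ?J"
          by (rule nn_integral_cmult) measurable
        finally have X: "(\<integral>\<^sup>+y. indicator {0..} (w - (norm y)\<^sup>2) * ennreal (real D * (w - (norm y)\<^sup>2) ^ (D - 1))
            * f ((1 / sqrt w) *\<^sub>R y) \<partial>lborel) = ennreal (w ^ card (UNIV :: 'q set)) * (ennreal (real D * w ^ (D - 1)) * ?J)" .
        have i: "indicator {0<..1} w = (1 :: ennreal)" using True by simp
        have "(\<integral>\<^sup>+y. c * (indicator {0<..1} w * indicator {0..} (w - (norm y)\<^sup>2)
         * ennreal (real D * (w - (norm y)\<^sup>2) ^ (D - 1)) * f ((1 / sqrt w) *\<^sub>R y)) \<partial>lborel)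
          = c * (ennreal (w ^ card (UNIV :: 'q set)) * (ennreal (real D * w ^ (D - 1)) * ?J))"
          unfolding i mult_1 X[symmetric] by (rule nn_integral_cmult) measurable
        also have "\<dots> = c * (indicator {0<..1} w * ennreal (real D * w ^ card (UNIV :: 'q set) * w ^ (D - 1))) * ?J"
          unfolding i using w by (simp add: ennreal_mult mult_ac)
        finally show ?thesis .
      qed (auto simp: indicator_def)
    qed
    also have "\<dots> = C' * ?J"
      by (simp add: nn_integral_cmult nn_integral_multc C'_def)
    finally have "B * ?L = C' * ?J" .
    then have "?L * B / B = (C' * ?J) / B" by (simp only: mult.commute)
    moreover have "?L * B / B = ?L" using B by (intro ennreal_mult_divide_eq) auto
    ultimately have "?L = (C' * ?J) / B" by simp
    also have "\<dots> = C' / B * ?J" by (simp only: ennreal_times_divide mult.commute[of C' ?J] mult.commute[of "C' / B" ?J])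
    finally show ?thesis .
  qed
  show ?thesis
    by (intro exI[of _ "C' / B"] ballI) (simp only: main D_def)
qed

section \<open>Corners of unitary matrices\<close>

lemma borel_measurable_vec_lambda:
  fixes f :: "'a \<Rightarrow> 'n::finite \<Rightarrow> 'b::euclidean_space"
  assumes "\<And>i. (\<lambda>x. f x i) \<in> borel_measurable M"
  shows "(\<lambda>x. \<chi> i. f x i) \<in> borel_measurable M"
proof (subst borel_measurable_euclidean_space, intro ballI)
  fix b :: "'b^'n" assume "b \<in> Basis"
  then obtain i c where b: "b = axis i c" by (auto simp: Basis_vec_def)
  show "(\<lambda>x. (\<chi> i. f x i) \<bullet> b) \<in> borel_measurable M"
    unfolding b inner_axis vec_lambda_beta by (intro borel_measurable_inner assms borel_measurable_const)
qed

section \<open>Positive semidefinite matrices and rank-one perturbations\<close>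

lemma closed_pos_semidef: "closed {A :: complex^'n^'n. pos_semidef A}"
  unfolding pos_semidef_def
  by (intro closed_Collect_conj closed_Collect_all closed_Collect_eq closed_Collect_le)
     (auto intro!: continuous_intros simp: matrix_vector_mult_def)

lemma norm_cinner_le: "cmod (cinner x y) \<le> norm x * norm y"
proof -
  have "cmod (cinner x y) \<le> (\<Sum>i\<in>UNIV. \<bar>cmod (x $ i)\<bar> * \<bar>cmod (y $ i)\<bar>)"
    unfolding cinner_def by (rule order_trans[OF norm_sum]) (simp add: norm_mult)
  also have "\<dots> \<le> norm x * norm y"
    unfolding norm_vec_def by (rule L2_set_mult_ineq)
  finally show ?thesis .
qed

text \<open>A unitary matrix taking x to |x| e_k conjugates the update into a diagonal matrix with a
  single entry different from 1.\<close>

lemma det_rank_one_update: "det (rank_one_update a x) = 1 + a * of_real ((norm x)\<^sup>2)"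
proof -
  obtain k :: 'a where True by auto
  let ?e = "of_real (norm x) *s axis k 1 :: complex^'a"
  have "norm x = norm ?e"
  proof -
    have "of_real ((norm ?e)\<^sup>2) = (of_real ((norm x)\<^sup>2) :: complex)"
      unfolding cinner_self[symmetric] cinner_scale_left cinner_scale_right
      by (simp add: cinner_self power2_eq_square)
    then show ?thesis unfolding of_real_eq_iff by (simp add: power2_eq_iff_nonneg)
  qed
  then obtain U where U: "unitary U" and Ux: "U *v x = ?e"
    using unitary_exchange by blast
  define E :: "complex^'a^'a" where "E = diag_matrix (\<chi> j. if j = k then 1 + a * of_real ((norm x)\<^sup>2) else 1)"
  have "U *v (rank_one_update a x *v z) = E *v (U *v z)" for z
  proof -
    have "cinner x z = cinner (U *v x) (U *v z)" by (simp add: unitary_cinner[OF U])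
    also have "\<dots> = of_real (norm x) * (U *v z) $ k"
      by (simp add: Ux cinner_scale_left cinner_axis_left)
    finally have c: "cinner x z = of_real (norm x) * (U *v z) $ k" .
    show ?thesis
      unfolding rank_one_update_vec matrix_vector_right_distrib vector_scalar_commute Ux c E_def diag_matrix_vec
      by (simp add: vec_eq_iff axis_def power2_eq_square algebra_simps)
  qed
  then have "(U ** rank_one_update a x) *v z = (E ** U) *v z" for z
    by (simp add: matrix_vector_mul_assoc)
  then have "U ** rank_one_update a x = E ** U" by (simp add: matrix_eq)
  then have "det U * det (rank_one_update a x) = det E * det U" by (metis det_mul)
  moreover have "det U \<noteq> 0" using unitary_norm_det[OF U] by auto
  ultimately show ?thesis by (simp add: E_def det_diag_one)
qed

lemma pos_semidef_congruence:
  assumes "pos_semidef P"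
  shows "pos_semidef (cadjoint R ** P ** R)"
proof -
  have "cinner u ((cadjoint R ** P ** R) *v u) = cinner (R *v u) (P *v (R *v u))" for u
    by (simp add: cinner_cadjoint matrix_vector_mul_assoc matrix_mul_assoc)
  then show ?thesis
    using assms unfolding pos_semidef_cinner by (simp add: cadjoint_mult matrix_mul_assoc)
qed

lemma pos_semidef_congruence_iff:
  assumes "det R \<noteq> 0"
  shows "pos_semidef (cadjoint R ** P ** R) \<longleftrightarrow> pos_semidef P"
proof
  obtain R' where R': "R ** R' = mat 1" "R' ** R = mat 1"
    using assms invertible_det_nz[of R] by (auto simp: invertible_def)
  assume "pos_semidef (cadjoint R ** P ** R)"
  then have "pos_semidef (cadjoint R' ** (cadjoint R ** P ** R) ** R')"
    by (rule pos_semidef_congruence)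
  moreover have "cadjoint R' ** (cadjoint R ** P ** R) ** R' = cadjoint (R ** R') ** P ** (R ** R')"
    by (simp add: cadjoint_mult matrix_mul_assoc)
  ultimately show "pos_semidef P" by (simp add: R')
qed (rule pos_semidef_congruence)

text \<open>The form at u is |u|^2 - |<x, u>|^2: Cauchy-Schwarz gives one direction, the test vector
  u = x the other.\<close>

lemma pos_semidef_rank_one: "pos_semidef (rank_one_update (- 1) x) \<longleftrightarrow> norm x \<le> 1"
proof -
  have f: "Re (cinner u (rank_one_update (- 1) x *v u)) = (norm u)\<^sup>2 - (cmod (cinner x u))\<^sup>2" for u
  proof -
    have "cinner u x * cinner x u = of_real ((cmod (cinner x u))\<^sup>2)"
      unfolding cinner_commute[of u x] complex_norm_square by (simp add: mult.commute)
    then show ?thesis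
      unfolding rank_one_update_vec cinner_add_right cinner_scale_right
      by (simp add: cinner_self mult.commute)
  qed
  have h: "cadjoint (rank_one_update (- 1) x) = rank_one_update (- 1) x"
    by (simp add: vec_eq_iff rank_one_update_def mat_def mult.commute)
  show ?thesis
  proof
    assume "pos_semidef (rank_one_update (- 1) x)"
    then have "0 \<le> (norm x)\<^sup>2 - (cmod (cinner x x))\<^sup>2"
      unfolding pos_semidef_cinner f by blast
    also have "cmod (cinner x x) = (norm x)\<^sup>2" unfolding cinner_self by (simp add: norm_power)
    finally have "((norm x)\<^sup>2)\<^sup>2 \<le> (norm x)\<^sup>2" by simp
    moreover have "t \<le> 1" if "t\<^sup>2 \<le> t" for t :: real
    proof (rule ccontr)
      assume "\<not> t \<le> 1"
      then have "1 * t < t * t" by (intro mult_strict_right_mono) auto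
      then show False using that by (simp add: power2_eq_square)
    qed
    ultimately have "(norm x)\<^sup>2 \<le> 1" by blast
    then show "norm x \<le> 1" by (simp add: abs_square_le_1)
  next
    assume x: "norm x \<le> 1"
    have "(cmod (cinner x u))\<^sup>2 \<le> (norm u)\<^sup>2" for u
    proof (rule power_mono)
      have "norm x * norm u \<le> 1 * norm u" using x by (intro mult_right_mono) auto
      then show "cmod (cinner x u) \<le> norm u" using norm_cinner_le[of x u] by simp
    qed simp
    then show "pos_semidef (rank_one_update (- 1) x)"
      unfolding pos_semidef_cinner f using h by simp
  qed
qed

text \<open>A triangularization by reflections, as in the Householder QR decomposition. All vectors
  vanish on \<open>S\<close>, so the reflections can be chosen to fix the axes in
  \<open>S\<close>.\<close>

lemma unitary_compress:
  fixes m :: "'i \<Rightarrow> complex^'p::finite" and \<iota> :: "'i \<Rightarrow> 'p"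
  assumes "finite J" and inj: "inj \<iota>" and disj: "range \<iota> \<inter> S = {}"
    and m: "\<And>j a. a \<in> S \<Longrightarrow> m j $ a = 0"
  shows "\<exists>h. unitary h \<and> (\<forall>a\<in>S. h *v axis a 1 = axis a 1) \<and> (\<forall>j\<in>J. \<forall>a. a \<notin> \<iota> ` J \<longrightarrow> (h *v m j) $ a = 0)"
  using assms(1)
proof (induction J rule: finite_induct)
  case empty
  show ?case by (intro exI[of _ "mat 1"]) simp
next
  case (insert k J)
  then obtain h where h: "unitary h" and hS: "\<And>a. a \<in> S \<Longrightarrow> h *v axis a 1 = axis a 1"
    and hJ: "\<And>j a. j \<in> J \<Longrightarrow> a \<notin> \<iota> ` J \<Longrightarrow> (h *v m j) $ a = 0" by auto
  define x where "x = h *v m k"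
  define l where "l = (\<Sum>a\<in>- \<iota> ` J. (cmod (x $ a))\<^sup>2)"
  have l0: "0 \<le> l" by (simp add: l_def sum_nonneg)
  \<comment> \<open>The target keeps the coordinates already in use and collects the remaining norm
    in the single new coordinate \<open>\<iota> k\<close>. Thus x - y is orthogonal to the vectors
    treated before and to the axes in \<open>S\<close>, and the reflection leaves these
    alone.\<close>
  define y where "y = (\<chi> a. if a \<in> \<iota> ` J then x $ a else if a = \<iota> k then of_real (sqrt l) else 0)"
  have k: "\<iota> k \<notin> \<iota> ` J" using insert inj by (auto dest: injD)
  have S: "a \<notin> \<iota> ` J" "a \<noteq> \<iota> k" if "a \<in> S" for a using disj that by auto
  have U: "UNIV = \<iota> ` J \<union> - \<iota> ` J" by auto
  have "norm_sq_on (- \<iota> ` J) y = (\<Sum>a\<in>- \<iota> ` J. if a = \<iota> k then l else 0)"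
    unfolding norm_sq_on_def using l0 by (intro sum.cong) (auto simp: y_def)
  also have "\<dots> = l" using k by simp
  finally have "norm_sq_on (- \<iota> ` J) y = norm_sq_on (- \<iota> ` J) x" by (simp add: l_def norm_sq_on_def)
  moreover have "norm_sq_on (\<iota> ` J) y = norm_sq_on (\<iota> ` J) x"
    unfolding norm_sq_on_def by (intro sum.cong) (auto simp: y_def)
  ultimately have "(norm x)\<^sup>2 = (norm y)\<^sup>2"
    unfolding norm_sq_on_UNIV[symmetric] U by (subst (1 2) norm_sq_on_Un) auto
  then have "norm x = norm y" by (simp add: power2_eq_iff_nonneg)
  then obtain V where V: "unitary V" "V *v x = y"
    and Vz: "\<And>z. cinner (x - y) z = 0 \<Longrightarrow> V *v z = z"
    using unitary_exchange by blast
  have x0: "x $ a = 0" if a: "a \<in> S" for a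
  proof -
    have "x $ a = cinner (h *v axis a 1) (h *v m k)" by (simp add: hS[OF a] cinner_axis_left x_def)
    then show ?thesis by (simp add: unitary_cinner[OF h] cinner_axis_left m[OF a])
  qed
  have "V *v axis a 1 = axis a 1" if a: "a \<in> S" for a
  proof (rule Vz)
    have "cinner (axis a 1) (x - y) = 0"
      using S[OF a] by (simp add: cinner_axis_left x0[OF a] y_def)
    then show "cinner (x - y) (axis a 1) = 0" by (metis cinner_commute complex_cnj_zero)
  qed
  moreover have "V *v (h *v m j) = h *v m j" if j: "j \<in> J" for j
  proof (rule Vz)
    have "cnj ((x - y) $ a) * (h *v m j) $ a = 0" for a
      using hJ[OF j, of a] by (cases "a \<in> \<iota> ` J") (auto simp: y_def)
    then show "cinner (x - y) (h *v m j) = 0" unfolding cinner_def by (simp only: sum.neutral_const)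
  qed
  moreover have "V *v (h *v m k) = y" using V by (simp add: x_def)
  ultimately show ?case
    using unitary_mult[OF V(1) h] hS hJ
    by (intro exI[of _ "V ** h"]) (auto simp: y_def simp flip: matrix_vector_mul_assoc)
qed

section \<open>Row combinations and Gram defects\<close>

definition crow :: "'q \<Rightarrow> complex^('r::finite + 'q::finite)^('r + 'q) \<Rightarrow> complex^'q" where
  "crow i u = (\<chi> j. u $ Inr i $ Inr j)"

text \<open>For the corner rows of a unitary matrix this is the Gram matrix of its last q columns
  with the rows in \<open>S\<close> deleted; for all rows it becomes I - w^* w.\<close>

definition gram_defect :: "'q::finite set \<Rightarrow> ('q \<Rightarrow> complex^'q) \<Rightarrow> complex^'q^'q" where
  "gram_defect S w = mat 1 - (\<chi> i j. \<Sum>l\<in>S. cnj (w l $ i) * w l $ j)"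

definition rank_one_row :: "complex^'q \<Rightarrow> complex^'q^'q" where
  "rank_one_row x = (\<chi> i j. cnj (x $ i) * x $ j)"

lemma gram_defect_insert:
  "k \<notin> S \<Longrightarrow> gram_defect (insert k S) (w(k := x)) = gram_defect S w - rank_one_row x"
  by (simp add: gram_defect_def rank_one_row_def vec_eq_iff algebra_simps cong: sum.cong)
     (auto intro!: sum.cong)

text \<open>For unitary \<open>u\<close> and a nonzero partial norm in the denominator, this is the
  corner part of a unit vector orthogonal to the rows in \<open>S\<close>: a normalized combination
  of the other rows.\<close>

abbreviation unit_row :: "'q::finite set \<Rightarrow> complex^('r::finite + 'q) \<Rightarrow> complex^('r + 'q)^('r + 'q) \<Rightarrow> complex^'q" where
  "unit_row S s u \<equiv> (1 / sqrt (norm_sq_on (- Inr ` S) s)) *\<^sub>R (\<chi> j. \<Sum>b\<in>- Inr ` S. s $ b * u $ b $ Inr j)"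

text \<open>Rotating $s$ by a unitary matrix fixing the coordinates in $S$ moves the columns of the lower
  right block of $u$ with the rows in $S$ removed into the span of the coordinates $\iota$.\<close>

lemma rotate_row_combination:
  fixes u :: "complex^('r::finite + 'q::finite)^('r + 'q)" and \<iota> :: "'q \<Rightarrow> 'r + 'q" and S :: "'q set"
  assumes u: "unitary u" and inj: "inj \<iota>" and disj: "range \<iota> \<inter> Inr ` S = {}"
  obtains R where "cadjoint R ** R = gram_defect S (\<lambda>i. crow i u)"
    and "\<And>a f. a \<in> borel_measurable borel \<Longrightarrow> f \<in> borel_measurable borel \<Longrightarrow>
      (\<integral>\<^sup>+s. a (norm_sq_on (Inr ` S) s, norm_sq_on (- Inr ` S) s) *
          f (unit_row S s u) \<partial>lborel)
     = (\<integral>\<^sup>+s. a (norm_sq_on (Inr ` S) s, norm_sq_on (- Inr ` S) s) *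
          f (transpose R *v ((1 / sqrt (norm_sq_on (- Inr ` S) s)) *\<^sub>R (\<chi> j. s $ \<iota> j))) \<partial>lborel)"
proof -
  let ?S = "Inr ` S :: ('r + 'q) set"
  define m where "m j = (\<chi> b. if b \<in> ?S then 0 else u $ b $ Inr j)" for j
  have m0: "m j $ b = 0" if "b \<in> ?S" for j b using that by (simp add: m_def)
  obtain h where h: "unitary h" and hS: "\<And>a. a \<in> ?S \<Longrightarrow> h *v axis a 1 = axis a 1"
    and hm: "\<And>j a. a \<notin> range \<iota> \<Longrightarrow> (h *v m j) $ a = 0"
    using unitary_compress[where m = m, OF finite[of UNIV] inj disj m0] by (metis (no_types, lifting) UNIV_I)
  \<comment> \<open>The rotated columns, read in the coordinates that carry them. The rotation
    preserves inner products, so R^* R is still the Gram matrix of the truncated columns.\<close>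
  define R :: "complex^'q^'q" where "R = (\<chi> l j. (h *v m j) $ \<iota> l)"
  have sum_rng: "(\<Sum>b\<in>UNIV. f b) = (\<Sum>l\<in>UNIV. f (\<iota> l))" if "\<And>b. b \<notin> range \<iota> \<Longrightarrow> f b = 0" for f :: "'r + 'q \<Rightarrow> complex"
  proof -
    have "(\<Sum>b\<in>UNIV. f b) = (\<Sum>b\<in>range \<iota>. f b)"
      by (rule sum.mono_neutral_right) (use that in auto)
    also have "\<dots> = (\<Sum>l\<in>UNIV. f (\<iota> l))" using sum.reindex[OF inj, of f] by simp
    finally show ?thesis .
  qed
  have "(cadjoint R ** R) $ i $ j = gram_defect S (\<lambda>i. crow i u) $ i $ j" for i j
  proof -
    have "(cadjoint R ** R) $ i $ j = cinner (h *v m i) (h *v m j)"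
      unfolding cinner_def by (subst sum_rng) (auto simp: hm R_def matrix_matrix_mult_def)
    also have "\<dots> = (\<Sum>b\<in>UNIV. if b \<in> ?S then 0 else cnj (u $ b $ Inr i) * u $ b $ Inr j)"
      unfolding unitary_cinner[OF h] unfolding cinner_def m_def by (intro sum.cong) auto
    also have "\<dots> = (\<Sum>b\<in>- ?S. cnj (u $ b $ Inr i) * u $ b $ Inr j)"
      by (rule sum.mono_neutral_cong_right) auto
    also have "\<dots> = (\<Sum>b\<in>UNIV. cnj (u $ b $ Inr i) * u $ b $ Inr j) - (\<Sum>b\<in>?S. cnj (u $ b $ Inr i) * u $ b $ Inr j)"
      by (simp add: Compl_eq_Diff_UNIV sum_diff)
    also have "(\<Sum>b\<in>UNIV. cnj (u $ b $ Inr i) * u $ b $ Inr j) = (cadjoint u ** u) $ Inr i $ Inr j"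
      by (simp add: matrix_matrix_mult_def)
    also have "\<dots> = mat 1 $ i $ j" using u by (simp add: unitary_def mat_def)
    also have "(\<Sum>b\<in>?S. cnj (u $ b $ Inr i) * u $ b $ Inr j) = (\<Sum>l\<in>S. cnj (crow l u $ i) * crow l u $ j)"
      by (subst sum.reindex) (auto simp: crow_def)
    finally show ?thesis by (simp add: gram_defect_def)
  qed
  then have RR: "cadjoint R ** R = gram_defect S (\<lambda>i. crow i u)" by (simp add: vec_eq_iff)
  have th: "unitary (transpose h)" by (rule unitary_transpose[OF h])
  \<comment> \<open>A combination of rows pairs \<open>s\<close> with the columns bilinearly,
    without conjugation, so \<open>s\<close> is rotated by the transpose of \<open>h\<close> instead
    of its adjoint.\<close>
  have dot: "(\<Sum>b\<in>UNIV. (transpose h *v s) $ b * x $ b) = (\<Sum>b\<in>UNIV. s $ b * (h *v x) $ b)" for s x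
  proof -
    have "(\<Sum>b\<in>UNIV. (transpose h *v s) $ b * x $ b) = (\<Sum>b\<in>UNIV. \<Sum>c\<in>UNIV. s $ c * (h $ c $ b * x $ b))"
      by (simp add: transpose_def matrix_vector_mult_def sum_distrib_left sum_distrib_right mult_ac)
    also have "\<dots> = (\<Sum>c\<in>UNIV. \<Sum>b\<in>UNIV. s $ c * (h $ c $ b * x $ b))" by (rule sum.swap)
    finally show ?thesis by (simp add: matrix_vector_mult_def sum_distrib_left)
  qed
  have comp: "(transpose h *v s) $ b = s $ b" if "b \<in> ?S" for s b
  proof -
    have ax: "(\<Sum>c\<in>UNIV. z $ c * axis b 1 $ c) = z $ b" for z :: "complex^('r + 'q)"
    proof -
      have "(\<Sum>c\<in>UNIV. z $ c * axis b 1 $ c) = (\<Sum>c\<in>UNIV. if c = b then z $ c else 0)"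
        unfolding axis_def by (rule sum.cong) auto
      then show ?thesis by simp
    qed
    show ?thesis using dot[of s "axis b 1"] unfolding hS[OF that] ax .
  qed
  have n1: "norm_sq_on ?S (transpose h *v s) = norm_sq_on ?S s" for s
    unfolding norm_sq_on_def by (intro sum.cong refl) (simp only: comp)
  have n2: "norm_sq_on (- ?S) (transpose h *v s) = norm_sq_on (- ?S) s" for s
  proof -
    have s: "norm_sq_on (- Inr ` S) z = (norm z)\<^sup>2 - norm_sq_on ?S z" for z :: "complex^('r + 'q)"
      using norm_sq_on_Un[of ?S "- ?S" z] by (simp add: norm_sq_on_UNIV)
    show ?thesis unfolding s n1 unitary_norm[OF th] ..
  qed
  have L: "(\<chi> j. \<Sum>b\<in>- ?S. (transpose h *v s) $ b * u $ b $ Inr j) = transpose R *v (\<chi> j. s $ \<iota> j)" for s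
  proof -
    have "(\<Sum>b\<in>- ?S. (transpose h *v s) $ b * u $ b $ Inr j) = (\<Sum>l\<in>UNIV. R $ l $ j * s $ \<iota> l)" for j
    proof -
      have "(\<Sum>b\<in>- ?S. (transpose h *v s) $ b * u $ b $ Inr j) = (\<Sum>b\<in>UNIV. (transpose h *v s) $ b * m j $ b)"
        by (rule sum.mono_neutral_cong_left) (auto simp: m_def)
      also have "\<dots> = (\<Sum>b\<in>UNIV. s $ b * (h *v m j) $ b)" by (rule dot)
      also have "\<dots> = (\<Sum>l\<in>UNIV. R $ l $ j * s $ \<iota> l)"
        by (subst sum_rng) (auto simp: hm R_def mult.commute)
      finally show ?thesis .
    qed
    then show ?thesis by (simp add: vec_eq_iff matrix_vector_mult_def transpose_def)
  qed
  show thesis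
  proof (rule that[OF RR])
    fix a :: "real \<times> real \<Rightarrow> ennreal" and f :: "complex^'q \<Rightarrow> ennreal"
    assume [measurable]: "a \<in> borel_measurable borel" "f \<in> borel_measurable borel"
    have [measurable]: "(\<lambda>s :: complex^('r + 'q). (\<chi> j. \<Sum>b\<in>- ?S. s $ b * u $ b $ Inr j) :: complex^'q) \<in> borel_measurable borel"
      by (intro borel_measurable_continuous_onI continuous_intros)
    have [measurable]: "(\<lambda>s :: complex^('r + 'q). (norm_sq_on ?S s, norm_sq_on (- ?S) s)) \<in> borel_measurable borel"
      by (subst borel_prod[symmetric]) measurable
    have "(\<integral>\<^sup>+s. a (norm_sq_on ?S s, norm_sq_on (- ?S) s) *
          f ((1 / sqrt (norm_sq_on (- ?S) s)) *\<^sub>R (\<chi> j. \<Sum>b\<in>- ?S. s $ b * u $ b $ Inr j)) \<partial>lborel)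
      = (\<integral>\<^sup>+s. a (norm_sq_on ?S (transpose h *v s), norm_sq_on (- ?S) (transpose h *v s)) *
          f ((1 / sqrt (norm_sq_on (- ?S) (transpose h *v s))) *\<^sub>R (\<chi> j. \<Sum>b\<in>- ?S. (transpose h *v s) $ b * u $ b $ Inr j)) \<partial>lborel)"
      by (rule nn_integral_unitary[OF th, symmetric]) simp
    also have "\<dots> = (\<integral>\<^sup>+s. a (norm_sq_on ?S s, norm_sq_on (- ?S) s) *
          f (transpose R *v ((1 / sqrt (norm_sq_on (- ?S) s)) *\<^sub>R (\<chi> j. s $ \<iota> j))) \<partial>lborel)"
      unfolding n1 n2 L by (simp add: linear_scale[OF linear_matrix_vector_complex])
    finally show "(\<integral>\<^sup>+s. a (norm_sq_on ?S s, norm_sq_on (- ?S) s) *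
          f ((1 / sqrt (norm_sq_on (- ?S) s)) *\<^sub>R (\<chi> j. \<Sum>b\<in>- ?S. s $ b * u $ b $ Inr j)) \<partial>lborel)
     = (\<integral>\<^sup>+s. a (norm_sq_on ?S s, norm_sq_on (- ?S) s) *
          f (transpose R *v ((1 / sqrt (norm_sq_on (- ?S) s)) *\<^sub>R (\<chi> j. s $ \<iota> j))) \<partial>lborel)" .
  qed
qed

text \<open>The determinant is nonnegative wherever the indicator is nonzero; taking its modulus makes this
  fact unnecessary.\<close>

definition trunc_density :: "nat \<Rightarrow> complex^'q^'q \<Rightarrow> ennreal" where
  "trunc_density e Q = indicator {A. pos_semidef A} Q * ennreal (cmod (det Q) ^ e)"

lemma measurable_trunc_density [measurable]: "trunc_density e \<in> borel_measurable borel"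
proof -
  have [measurable]: "{A :: complex^'a^'a. pos_semidef A} \<in> sets borel"
    by (rule borel_closed[OF closed_pos_semidef])
  have [measurable]: "det \<in> borel_measurable (borel :: (complex^'a^'a) measure)"
    by (intro borel_measurable_continuous_onI continuous_intros)
  show ?thesis unfolding trunc_density_def by measurable
qed

lemma borel_measurable_cnj [measurable]: "cnj \<in> borel_measurable borel"
  by (intro borel_measurable_continuous_onI continuous_intros)

lemma measurable_gram_defect [measurable]:
  "gram_defect S \<in> borel_measurable (Pi\<^sub>M S (\<lambda>_. lborel))"
proof -
  have [measurable]: "(\<lambda>w. w l $ i) \<in> borel_measurable (Pi\<^sub>M S (\<lambda>_. lborel :: (complex^'a) measure))" if "l \<in> S" for l i
  proof -
    have "(\<lambda>w. w l) \<in> borel_measurable (Pi\<^sub>M S (\<lambda>_. lborel :: (complex^'a) measure))"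
      using measurable_component_singleton[OF that, of "\<lambda>_. lborel :: (complex^'a) measure"] by simp
    then show ?thesis by (rule measurable_compose[OF _ measurable_vec_nth_borel])
  qed
  show ?thesis
    unfolding gram_defect_def
    by (intro borel_measurable_diff borel_measurable_const borel_measurable_vec_lambda borel_measurable_sum
        borel_measurable_times measurable_compose[OF _ borel_measurable_cnj]) auto
qed

lemma measurable_rank_one_row [measurable]: "rank_one_row \<in> borel_measurable borel"
  unfolding rank_one_row_def by (intro borel_measurable_continuous_onI continuous_intros)

lemma measurable_crow [measurable]: "crow i \<in> borel_measurable borel"
  unfolding crow_def by (intro borel_measurable_continuous_onI continuous_intros)

lemma rank_one_row_transform:
  "rank_one_row (transpose R *v y) = cadjoint R ** rank_one_row y ** R"
  by (simp add: vec_eq_iff rank_one_row_def matrix_matrix_mult_def matrix_vector_mult_def transpose_def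
      sum_distrib_left sum_distrib_right mult_ac) (intro allI sum.swap)

lemma one_minus_rank_one_row: "mat 1 - rank_one_row y = rank_one_update (- 1) (\<chi> i. cnj (y $ i))"
  by (simp add: vec_eq_iff rank_one_row_def rank_one_update_def)

text \<open>With Q = R^* R the substitution x = R^T y makes Q - x^* x congruent to I - y^* y.
  Positivity becomes |y| \<le> 1 and the determinant splits off \<open>det Q\<close>.\<close>

lemma trunc_density_transform:
  fixes R Q :: "complex^'q^'q"
  assumes Q: "cadjoint R ** R = Q" and det: "det Q \<noteq> 0"
  shows "trunc_density e (Q - rank_one_row (transpose R *v y))
    = ennreal (cmod (det Q) ^ e) * (indicator (cball 0 1) y * ennreal ((1 - (norm y)\<^sup>2) ^ e))"
proof -
  have nc: "norm (\<chi> i. cnj (y $ i)) = norm y" by (simp add: norm_vec_def)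
  have dR: "det R \<noteq> 0" using det by (auto simp: Q[symmetric] det_mul)
  have e: "Q - rank_one_row (transpose R *v y) = cadjoint R ** (mat 1 - rank_one_row y) ** R"
    unfolding rank_one_row_transform by (simp add: matrix_diff_ldistrib matrix_diff_rdistrib Q)
  have d: "det (Q - rank_one_row (transpose R *v y)) = det Q * (1 - of_real ((norm y)\<^sup>2))"
  proof -
    have "det Q = cnj (det R) * det R" by (simp add: Q[symmetric] det_mul)
    then show ?thesis
      unfolding e one_minus_rank_one_row det_mul det_rank_one_update nc by simp
  qed
  have "cmod (det (Q - rank_one_row (transpose R *v y))) = cmod (det Q) * \<bar>1 - (norm y)\<^sup>2\<bar>"
    unfolding d norm_mult by (metis norm_of_real of_real_1 of_real_diff)
  moreover have "pos_semidef (Q - rank_one_row (transpose R *v y)) \<longleftrightarrow> norm y \<le> 1"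
    unfolding e pos_semidef_congruence_iff[OF dR] one_minus_rank_one_row pos_semidef_rank_one nc ..
  ultimately show ?thesis
    by (auto simp: trunc_density_def indicator_def power_mult_distrib ennreal_mult abs_square_le_1)
qed

text \<open>The substitution x = R^T y in the law of q sphere coordinates contributes the Jacobian
  |det R|^2 = |det Q| and the power D - 1 of |det Q| from the density. The total power D is kept on
  the left-hand side, which makes the constant the same for all \<open>u\<close>.\<close>

lemma row_combination_law:
  fixes S :: "'q::finite set"
  assumes q: "CARD('q) \<le> CARD('r::finite)" and k: "k \<notin> S"
  obtains C where "\<And>u f. unitary u \<Longrightarrow> det (gram_defect S (\<lambda>i. crow i u)) \<noteq> 0 \<Longrightarrow> f \<in> borel_measurable borel \<Longrightarrow>
      ennreal (cmod (det (gram_defect S (\<lambda>i. crow i u))) ^ (CARD('r) - card S)) *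
      (\<integral>\<^sup>+s. indicator {..1} (norm_sq_on (Inr ` S) s) * indicator {0<..1} (norm_sq_on (- Inr ` S) s) *
          f (unit_row S s u) \<partial>lborel)
     = C * (\<integral>\<^sup>+x. trunc_density (CARD('r) - card S - 1) (gram_defect S (\<lambda>i. crow i (u :: ('r + 'q) cmat)) - rank_one_row x) * f x \<partial>lborel)"
proof -
  \<comment> \<open>The selected coordinates lie in the \<open>Inl\<close> part, hence away from the
    rows indexed by \<open>S\<close>. Row \<open>k\<close> then remains over, so \<open>T'\<close>
    is nonempty and the exponent CARD('r) - card S is positive.\<close>
  obtain e :: "'q \<Rightarrow> 'r" where e: "inj e"
    using q by (metis card_le_inj finite inj_on_subset top_greatest)
  define \<iota> :: "'q \<Rightarrow> 'r + 'q" where "\<iota> j = Inl (e j)" for j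
  have inj: "inj \<iota>" using e by (auto simp: inj_def \<iota>_def)
  have disj: "range \<iota> \<inter> Inr ` S = {}" by (auto simp: \<iota>_def)
  define T' where "T' = - Inr ` S - range \<iota>"
  have "Inr k \<in> T'" using k by (auto simp: T'_def \<iota>_def)
  then have T': "T' \<noteq> {}" by auto
  have "card T' = card (- Inr ` S :: ('r + 'q) set) - card (range \<iota>)"
    unfolding T'_def using disj by (intro card_Diff_subset) auto
  also have "card (- Inr ` S :: ('r + 'q) set) = CARD('r) + CARD('q) - card S"
    by (simp add: Compl_eq_Diff_UNIV card_Diff_subset card_image)
  also have "card (range \<iota>) = CARD('q)" by (rule card_image[OF inj])
  finally have cT: "card T' = CARD('r) - card S" by simp
  have D: "0 < CARD('r) - card S" using T' cT by (metis card_gt_0_iff finite)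
  obtain C where C: "\<And>f. f \<in> borel_measurable borel \<Longrightarrow>
     (\<integral>\<^sup>+s. indicator {..1} (norm_sq_on (Inr ` S) s) * indicator {0<..1} (norm_sq_on (- Inr ` S) s) *
        f ((1 / sqrt (norm_sq_on (- Inr ` S) s)) *\<^sub>R (\<chi> j. s $ \<iota> j)) \<partial>lborel)
     = C * (\<integral>\<^sup>+y. indicator (cball 0 1) y * ennreal ((1 - (norm y)\<^sup>2) ^ (card T' - 1)) * f (y :: complex^'q) \<partial>lborel)"
    using nn_integral_sphere_coords[OF inj disj T'_def T'] by blast
  show thesis
  proof (rule that)
    fix u :: "('r + 'q) cmat" and f :: "complex^'q \<Rightarrow> ennreal"
    assume u: "unitary u" and det: "det (gram_defect S (\<lambda>i. crow i u)) \<noteq> 0" and f[measurable]: "f \<in> borel_measurable borel"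
    define Q where "Q = gram_defect S (\<lambda>i. crow i u)"
    define n where "n s = norm_sq_on (- Inr ` S) s" for s :: "complex^('r + 'q)"
    let ?D = "CARD('r) - card S"
    obtain R where R0: "cadjoint R ** R = gram_defect S (\<lambda>i. crow i u)"
      and rot0: "\<And>a f. a \<in> borel_measurable borel \<Longrightarrow> f \<in> borel_measurable borel \<Longrightarrow>
      (\<integral>\<^sup>+s. a (norm_sq_on (Inr ` S) s, norm_sq_on (- Inr ` S) s) *
          f (unit_row S s u) \<partial>lborel)
     = (\<integral>\<^sup>+s. a (norm_sq_on (Inr ` S) s, norm_sq_on (- Inr ` S) s) *
          f (transpose R *v ((1 / sqrt (norm_sq_on (- Inr ` S) s)) *\<^sub>R (\<chi> j. s $ \<iota> j))) \<partial>lborel)"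
      by (rule rotate_row_combination[OF u inj disj], rule that)
    note R = R0[folded Q_def] and rot = rot0[folded n_def]
    have [measurable]: "(\<lambda>x. transpose R *v x) \<in> borel_measurable borel"
      by (intro borel_measurable_continuous_onI linear_continuous_on linear_linear[THEN iffD2] linear_matrix_vector_complex)
    have a: "(\<lambda>p :: real \<times> real. indicator {..1} (fst p) * indicator {0<..1} (snd p) :: ennreal) \<in> borel_measurable borel"
      by (subst borel_prod[symmetric]) measurable
    have detQ: "det Q \<noteq> 0" using det by (simp add: Q_def)
    have dR: "(cmod (det (transpose R)))\<^sup>2 = cmod (det Q)"
      by (simp add: R[symmetric] det_mul norm_mult power2_eq_square)
    let ?B = "\<lambda>y :: complex^'q. indicator (cball 0 1) y * ennreal ((1 - (norm y)\<^sup>2) ^ (?D - 1)) :: ennreal"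
    have B[measurable]: "?B \<in> borel_measurable borel"
    proof -
      have [measurable]: "cball (0 :: complex^'q) 1 \<in> sets borel" by (rule borel_closed) simp
      show ?thesis by measurable
    qed
    have I: "(\<integral>\<^sup>+s. indicator {..1} (norm_sq_on (Inr ` S) s) * indicator {0<..1} (n s) *
          f ((1 / sqrt (n s)) *\<^sub>R (\<chi> j. \<Sum>b\<in>- Inr ` S. s $ b * u $ b $ Inr j)) \<partial>lborel)
       = C * (\<integral>\<^sup>+y. ?B y * f (transpose R *v y) \<partial>lborel)"
    proof -
      have "(\<lambda>y. f (transpose R *v y)) \<in> borel_measurable borel" by measurable
      from rot[OF a f] C[OF this] show ?thesis by (simp add: n_def cT)
    qed
    have "(\<integral>\<^sup>+x. trunc_density (?D - 1) (Q - rank_one_row x) * f x \<partial>lborel)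
      = ennreal (cmod (det Q)) * (\<integral>\<^sup>+y. trunc_density (?D - 1) (Q - rank_one_row (transpose R *v y)) * f (transpose R *v y) \<partial>lborel)"
      unfolding dR[symmetric] by (rule nn_integral_linear_complex) (use detQ dR in auto)
    also have "(\<integral>\<^sup>+y. trunc_density (?D - 1) (Q - rank_one_row (transpose R *v y)) * f (transpose R *v y) \<partial>lborel)
      = ennreal (cmod (det Q) ^ (?D - 1)) * (\<integral>\<^sup>+y. ?B y * f (transpose R *v y) \<partial>lborel)"
      unfolding trunc_density_transform[OF R detQ] mult.assoc[of "ennreal (cmod (det Q) ^ (?D - 1))"]
      by (rule nn_integral_cmult) measurable
    finally have "(\<integral>\<^sup>+x. trunc_density (?D - 1) (Q - rank_one_row x) * f x \<partial>lborel)
      = ennreal (cmod (det Q) * cmod (det Q) ^ (?D - 1)) * (\<integral>\<^sup>+y. ?B y * f (transpose R *v y) \<partial>lborel)"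
      by (simp add: ennreal_mult mult.assoc)
    also have "cmod (det Q) * cmod (det Q) ^ (?D - 1) = cmod (det Q) ^ ?D"
      using D by (simp add: power_eq_if)
    finally show "ennreal (cmod (det (gram_defect S (\<lambda>i. crow i u))) ^ (CARD('r) - card S)) *
      (\<integral>\<^sup>+s. indicator {..1} (norm_sq_on (Inr ` S) s) * indicator {0<..1} (norm_sq_on (- Inr ` S) s) *
          f (unit_row S s u) \<partial>lborel)
     = C * (\<integral>\<^sup>+x. trunc_density (CARD('r) - card S - 1) (gram_defect S (\<lambda>i. crow i u) - rank_one_row x) * f x \<partial>lborel)"
      using I by (simp add: Q_def n_def mult.left_commute)
  qed
qed

lemma rank_one_row_form:
  "cinner u (rank_one_row x *v u) = of_real ((cmod (\<Sum>j\<in>UNIV. x $ j * u $ j))\<^sup>2)"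
proof -
  let ?d = "\<Sum>j\<in>UNIV. x $ j * u $ j"
  have "cinner u (rank_one_row x *v u) = cnj ?d * ?d"
    by (simp add: cinner_def rank_one_row_def matrix_vector_mult_def sum_distrib_left sum_distrib_right mult_ac)
  then show ?thesis unfolding complex_norm_square by (simp add: mult.commute)
qed

text \<open>The form of \<open>rank_one_row x\<close> at u is |sum of x_j u_j|^2, so the form of
  \<open>Q\<close> dominates this square and a null vector of \<open>Q\<close> must annihilate
  x.\<close>

lemma pos_semidef_diff_rank_one_row:
  assumes "pos_semidef (Q - rank_one_row x)"
  shows "pos_semidef Q"
    and "Q *v u = 0 \<Longrightarrow> (\<Sum>j\<in>UNIV. x $ j * u $ j) = 0"
proof -
  have rh: "cadjoint (rank_one_row x) = rank_one_row x"
    by (simp add: vec_eq_iff rank_one_row_def mult.commute)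
  have f: "Re (cinner u ((Q - rank_one_row x) *v u)) = Re (cinner u (Q *v u)) - (cmod (\<Sum>j\<in>UNIV. x $ j * u $ j))\<^sup>2" for u
    by (simp add: matrix_vector_mult_diff_rdistrib cinner_diff_right rank_one_row_form)
  have ge: "(cmod (\<Sum>j\<in>UNIV. x $ j * u $ j))\<^sup>2 \<le> Re (cinner u (Q *v u))" for u
    using assms f[of u] unfolding pos_semidef_cinner by (metis diff_ge_0_iff_ge)
  have "cadjoint (Q - rank_one_row x) = Q - rank_one_row x" using assms by (simp add: pos_semidef_cinner)
  moreover have "cadjoint (Q - rank_one_row x) = cadjoint Q - cadjoint (rank_one_row x)"
    by (simp add: vec_eq_iff)
  ultimately have "cadjoint Q = Q" by (simp add: rh)
  then show "pos_semidef Q"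
    unfolding pos_semidef_cinner using order_trans[OF zero_le_power2 ge] by blast
  show "(\<Sum>j\<in>UNIV. x $ j * u $ j) = 0" if "Q *v u = 0"
    using ge[of u] that by (simp add: cinner_def)
qed

text \<open>A kernel vector of the singular \<open>Q\<close> confines x to a real hyperplane. In the
  induction over rows this disposes of the degenerate configurations.\<close>

lemma null_pos_semidef_diff:
  fixes Q :: "complex^'q^'q"
  assumes "det Q = 0"
  shows "{x. pos_semidef (Q - rank_one_row x)} \<in> null_sets lborel"
proof -
  have "\<not> invertible Q" using assms by (simp add: invertible_det_nz)
  then obtain u where u: "u \<noteq> 0" "Q *v u = 0"
    using matrix_left_invertible_ker[of Q] invertible_left_inverse[of Q] by blast
  define c where "c = (\<chi> i. cnj (u $ i))"
  have c0: "c \<noteq> 0" using u(1) by (auto simp: c_def vec_eq_iff)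
  have "{x. pos_semidef (Q - rank_one_row x)} \<subseteq> {x. c \<bullet> x = 0}"
  proof safe
    fix x assume "pos_semidef (Q - rank_one_row x)"
    then have "Re (\<Sum>j\<in>UNIV. x $ j * u $ j) = 0" using pos_semidef_diff_rank_one_row(2) u(2) by fastforce
    moreover have "c \<bullet> x = Re (\<Sum>j\<in>UNIV. x $ j * u $ j)"
      by (simp add: c_def inner_vec_def inner_complex_def mult.commute)
    ultimately show "c \<bullet> x = 0" by simp
  qed
  then have "negligible {x. pos_semidef (Q - rank_one_row x)}"
    using negligible_subset[OF negligible_hyperplane] c0 by blast
  then have "{x. pos_semidef (Q - rank_one_row x)} \<in> null_sets lebesgue"
    by (simp add: negligible_iff_null_sets)
  moreover have "{x. pos_semidef (Q - rank_one_row x)} \<in> sets lborel"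
  proof -
    have "closed ((\<lambda>x. Q - rank_one_row x) -` {A. pos_semidef A})"
      unfolding rank_one_row_def by (intro closed_vimage closed_pos_semidef continuous_intros)
    then show ?thesis by (simp add: vimage_def)
  qed
  ultimately show ?thesis by (simp add: null_sets_completion_iff)
qed

section \<open>Exchange of a row and the induction over rows\<close>

lemma SU_transpose: "A \<in> SU \<Longrightarrow> transpose A \<in> SU"
  by (simp add: SU_iff unitary_transpose)

text \<open>The rows of \<open>g\<close> for S and k are prescribed as the axes in S and the
  normalized restriction of \<open>s\<close> to the complement of S. They are orthonormal and fewer
  than p, so \<open>SU_gram\<close> completes them with determinant 1; it prescribes columns, whence
  the transpose.\<close>

lemma row_exchange:
  fixes S :: "'q::finite set" and s :: "complex^('r::finite + 'q)"
  assumes k: "k \<notin> S" and s: "0 < norm_sq_on (- Inr ` S) s"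
  shows "\<exists>g\<in>SU. \<forall>u. (\<forall>i\<in>S. crow i (g ** u) = crow i u) \<and>
     crow k (g ** u) = unit_row S s u"
proof -
  let ?n = "norm_sq_on (- Inr ` S) s"
  define t :: "complex^('r + 'q)" where "t = (\<chi> b. if b \<in> Inr ` S then 0 else (1 / sqrt ?n) *\<^sub>R s $ b)"
  define y where "y i = (if i = k then t else axis (Inr i) 1)" for i
  have "(norm t)\<^sup>2 = (\<Sum>b\<in>- Inr ` S. (cmod (t $ b))\<^sup>2)"
    unfolding norm_sq_vec by (rule sum.mono_neutral_right) (auto simp: t_def)
  also have "\<dots> = (\<Sum>b\<in>- Inr ` S. (cmod (s $ b))\<^sup>2 / ?n)"
    using s by (intro sum.cong) (auto simp: t_def power_divide)
  also have "\<dots> = 1" using s by (simp add: norm_sq_on_def flip: sum_divide_distrib)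
  finally have nt: "(norm t)\<^sup>2 = 1" .
  have ax: "cinner (axis a 1) (axis b 1) = (if a = b then 1 else 0)" for a b :: "'r + 'q"
    unfolding cinner_axis_left by (simp add: axis_def)
  have t0: "cinner (axis (Inr i) 1) t = 0" if "i \<in> S" for i
    using that by (simp add: cinner_axis_left t_def)
  then have t0': "cinner t (axis (Inr i) 1) = 0" if "i \<in> S" for i
    using that by (metis cinner_commute complex_cnj_zero)
  have tt: "cinner t t = 1" by (simp add: cinner_self nt del: of_real_power)
  have gram: "cinner (axis (Inr i) 1 :: complex^('r + 'q)) (axis (Inr j) 1) = cinner (y i) (y j)"
    if "i \<in> insert k S" "j \<in> insert k S" for i j
    using that k by (auto simp: y_def ax t0 t0' tt)
  have "card (insert k S) \<le> CARD('q)" by (intro card_mono) auto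
  then have card: "card (insert k S) < CARD('r + 'q)"
  proof -
    have "CARD('r + 'q) = CARD('r) + CARD('q)" "0 < CARD('r)" by simp_all
    then show ?thesis using \<open>card (insert k S) \<le> CARD('q)\<close> by linarith
  qed
  obtain U :: "('r + 'q) cmat" where U: "U \<in> SU" "\<And>i. i \<in> insert k S \<Longrightarrow> U *v axis (Inr i) 1 = y i"
    using SU_gram[of "insert k S" "\<lambda>i. axis (Inr i) 1" y, OF finite card gram] by blast
  define g where "g = transpose U"
  have g: "g \<in> SU" using U(1) by (simp add: g_def SU_transpose)
  have row: "g $ Inr i $ b = y i $ b" if "i \<in> insert k S" for i b
    using U(2)[OF that] by (simp add: g_def transpose_def matrix_vector_axis vec_eq_iff)
  have crow: "crow i (g ** u) = (\<chi> j. \<Sum>b\<in>UNIV. y i $ b * u $ b $ Inr j)" if "i \<in> insert k S" for i u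
    by (simp add: crow_def matrix_matrix_mult_def row[OF that])
  show ?thesis
  proof (intro bexI[OF _ g] allI conjI ballI)
    fix u :: "('r + 'q) cmat" and i assume i: "i \<in> S"
    have "(\<Sum>b\<in>UNIV. y i $ b * u $ b $ Inr j) = u $ Inr i $ Inr j" for j
    proof -
      have "(\<Sum>b\<in>UNIV. y i $ b * u $ b $ Inr j) = (\<Sum>b\<in>UNIV. if b = Inr i then u $ b $ Inr j else 0)"
        using i k by (intro sum.cong) (auto simp: y_def axis_def)
      then show ?thesis by simp
    qed
    then show "crow i (g ** u) = crow i u" using i by (simp add: crow) (simp add: crow_def)
  next
    fix u :: "('r + 'q) cmat"
    have "(\<Sum>b\<in>UNIV. y k $ b * u $ b $ Inr j) = (\<Sum>b\<in>- Inr ` S. (1 / sqrt ?n) *\<^sub>R (s $ b * u $ b $ Inr j))" for j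
      unfolding y_def by (rule sum.mono_neutral_cong_right) (auto simp: t_def)
    then show "crow k (g ** u) = (1 / sqrt ?n) *\<^sub>R (\<chi> j. \<Sum>b\<in>- Inr ` S. s $ b * u $ b $ Inr j)"
      by (simp add: crow vec_eq_iff scaleR_sum_right)
  qed
qed

lemma measurable_crows [measurable]:
  "(\<lambda>u. \<lambda>i\<in>S. crow i u) \<in> measurable borel (Pi\<^sub>M S (\<lambda>_. lborel))"
  by (rule measurable_restrict) simp

lemma gram_defect_restrict: "gram_defect S (\<lambda>i\<in>S. f i) = gram_defect S f"
  by (simp add: gram_defect_def cong: sum.cong)

text \<open>In the induction step, row $k$ may be replaced by any unit vector $s$ in the span of the rows outside
  $S$, by left invariance, and then averaged over $s$.  The coordinates of $s$ in $S$ play no role.\<close>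

lemma rows_law:
  fixes \<mu> :: "(complex^('r::finite + 'q::finite)^('r + 'q)) measure" and S :: "'q set"
  assumes q: "CARD('q) \<le> CARD('r)" and sets: "sets \<mu> = sets borel" and prob: "emeasure \<mu> UNIV = 1"
    and SU: "AE u in \<mu>. u \<in> SU" and inv: "\<And>g. g \<in> SU \<Longrightarrow> distr \<mu> borel ((**) g) = \<mu>"
  shows "\<exists>C. \<forall>F\<in>borel_measurable (Pi\<^sub>M S (\<lambda>_. lborel)). (\<integral>\<^sup>+u. F (\<lambda>i\<in>S. crow i u) \<partial>\<mu>)
     = C * (\<integral>\<^sup>+w. trunc_density (CARD('r) - card S) (gram_defect S w) * F w \<partial>Pi\<^sub>M S (\<lambda>_. lborel))"
  using finite[of S]
proof (induction S rule: finite_induct)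
  case empty
  have "gram_defect {} w = mat 1" for w :: "'q \<Rightarrow> complex^'q"
    by (simp add: gram_defect_def vec_eq_iff)
  moreover have "pos_semidef (mat 1 :: complex^'q^'q)"
    by (simp add: pos_semidef_cinner cinner_self)
  ultimately have "trunc_density e (gram_defect {} w) = 1" for e and w :: "'q \<Rightarrow> complex^'q"
    by (simp add: trunc_density_def)
  moreover have "space \<mu> = UNIV" using sets by (metis sets_eq_imp_space_eq space_borel)
  ultimately show ?case
    using prob by (intro exI[of _ 1] ballI) (simp add: PiM_empty nn_integral_count_space_finite restrict_def)
next
  case (insert k S)
  then obtain C where C: "\<And>F. F \<in> borel_measurable (Pi\<^sub>M S (\<lambda>_. lborel)) \<Longrightarrow>
     (\<integral>\<^sup>+u. F (\<lambda>i\<in>S. crow i u) \<partial>\<mu>)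
     = C * (\<integral>\<^sup>+w. trunc_density (CARD('r) - card S) (gram_defect S w) * F w \<partial>Pi\<^sub>M S (\<lambda>_. lborel))"
    by blast
  have k: "k \<notin> S" by fact
  note [measurable_cong] = sets
  have space: "space \<mu> = UNIV" using sets by (metis sets_eq_imp_space_eq space_borel)
  interpret \<mu>: finite_measure \<mu> by (rule finite_measureI) (simp add: space prob)
  interpret L: product_sigma_finite "\<lambda>_ :: 'q. lborel :: (complex^'q) measure" ..
  interpret P: pair_sigma_finite "lborel :: (complex^('r + 'q)) measure" \<mu> ..
  define D where "D = CARD('r) - card S"
  have "card S < card (UNIV :: 'q set)" using k by (intro psubset_card_mono) auto
  then have D: "0 < D" using q by (simp add: D_def)
  obtain c where c0: "\<And>u f. unitary u \<Longrightarrow> det (gram_defect S (\<lambda>i. crow i u)) \<noteq> 0 \<Longrightarrow> f \<in> borel_measurable borel \<Longrightarrow>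
      ennreal (cmod (det (gram_defect S (\<lambda>i. crow i u))) ^ (CARD('r) - card S)) *
      (\<integral>\<^sup>+s. indicator {..1} (norm_sq_on (Inr ` S) s) * indicator {0<..1} (norm_sq_on (- Inr ` S) s) *
          f (unit_row S s u) \<partial>lborel)
     = c * (\<integral>\<^sup>+x. trunc_density (CARD('r) - card S - 1) (gram_defect S (\<lambda>i. crow i (u :: ('r + 'q) cmat)) - rank_one_row x) * f x \<partial>lborel)"
    by (rule row_combination_law[OF q k], rule that)
  note c = c0[folded D_def]
  define a :: "complex^('r + 'q) \<Rightarrow> ennreal" where
    "a s = indicator {..1} (norm_sq_on (Inr ` S) s) * indicator {0<..1} (norm_sq_on (- Inr ` S) s)" for s
  have [measurable]: "a \<in> borel_measurable borel" unfolding a_def by measurable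
  define row :: "complex^('r + 'q) \<Rightarrow> ('r + 'q) cmat \<Rightarrow> complex^'q" where
    "row s u = unit_row S s u" for s u
  have [measurable]: "(\<lambda>p. row (fst p) (snd p)) \<in> borel_measurable (borel \<Otimes>\<^sub>M borel)"
  proof -
    have [measurable]: "(\<lambda>p :: (complex^('r + 'q)) \<times> (('r + 'q) cmat).
        (\<chi> j. \<Sum>b\<in>- Inr ` S. fst p $ b * snd p $ b $ Inr j) :: complex^'q) \<in> borel_measurable (borel \<Otimes>\<^sub>M borel)"
      unfolding borel_prod by (intro borel_measurable_continuous_onI continuous_intros)
    show ?thesis unfolding row_def by measurable
  qed
  define G where "G = (\<integral>\<^sup>+s. a s \<partial>lborel)"
  have G: "G \<noteq> 0" "G \<noteq> \<infinity>"
  proof -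
    have spl: "(norm s)\<^sup>2 = norm_sq_on (Inr ` S) s + norm_sq_on (- Inr ` S) s" for s :: "complex^('r + 'q)"
      using norm_sq_on_Un[of "Inr ` S" "- Inr ` S" s] by (simp add: norm_sq_on_UNIV)
    have "G \<le> (\<integral>\<^sup>+s. indicator (cball (0 :: complex^('r + 'q)) 2) s \<partial>lborel)"
      unfolding G_def
    proof (intro nn_integral_mono)
      fix s :: "complex^('r + 'q)"
      show "a s \<le> indicator (cball 0 2) s"
      proof (cases "norm_sq_on (Inr ` S) s \<le> 1 \<and> norm_sq_on (- Inr ` S) s \<le> 1")
        case True
        then have "(norm s)\<^sup>2 \<le> 2\<^sup>2" using spl[of s] by simp
        then have "norm s \<le> 2" by (rule power2_le_imp_le) simp
        then show ?thesis by (simp add: a_def indicator_def)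
      qed (auto simp: a_def indicator_def)
    qed
    also have "\<dots> < \<infinity>" by (simp add: emeasure_lborel_cball_finite[unfolded infinity_ennreal_def])
    finally show "G \<noteq> \<infinity>" by simp
    \<comment> \<open>On the ball of radius 1/4 around e_k / 2 the k-th coordinate stays away from 0
      and the norm stays below 1. Since k is outside S, the weight is 1 there, which gives positive
      mass.\<close>
    let ?c = "(1 / 2) *\<^sub>R axis (Inr k) 1 :: complex^('r + 'q)"
    have "0 < emeasure lborel (ball ?c (1 / 4))"
      using unit_ball_vol_pos[of "real DIM(complex^('r + 'q))"] by (simp add: emeasure_ball ennreal_zero_less_mult_iff del: unit_ball_vol_pos)
    also have "\<dots> = (\<integral>\<^sup>+s. indicator (ball ?c (1 / 4)) s \<partial>lborel)" by simp
    also have "\<dots> \<le> G"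
      unfolding G_def
    proof (intro nn_integral_mono)
      fix s :: "complex^('r + 'q)"
      show "indicator (ball ?c (1 / 4)) s \<le> a s"
      proof (cases "s \<in> ball ?c (1 / 4)")
        case True
        then have d: "norm (?c - s) < 1 / 4" by (simp add: dist_norm)
        have "norm ?c = 1 / 2" by simp
        then have "norm s \<le> 1" using d norm_triangle_ineq2[of s ?c] by (simp add: norm_minus_commute)
        then have s1: "(norm s)\<^sup>2 \<le> 1" by (simp add: abs_square_le_1)
        have "cmod ((?c - s) $ Inr k) < 1 / 4"
          using d Finite_Cartesian_Product.norm_nth_le[of "?c - s" "Inr k"] by linarith
        then have "s $ Inr k \<noteq> 0" by (auto simp: axis_def)
        then have "0 < norm_sq_on (- Inr ` S) s"
          unfolding norm_sq_on_def using k by (intro sum_pos2[of _ "Inr k"]) auto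
        moreover have "norm_sq_on (Inr ` S) s \<le> 1" "norm_sq_on (- Inr ` S) s \<le> 1"
          using s1 spl[of s] norm_sq_on_nonneg[of "Inr ` S" s] norm_sq_on_nonneg[of "- Inr ` S" s]
          by linarith+
        ultimately show ?thesis by (simp add: a_def indicator_def)
      qed simp
    qed
    finally show "G \<noteq> 0" by simp
  qed
  show ?case
  proof (intro exI[of _ "C * c / G"] ballI)
    fix F :: "('q \<Rightarrow> complex^'q) \<Rightarrow> ennreal"
    assume F[measurable]: "F \<in> borel_measurable (Pi\<^sub>M (insert k S) (\<lambda>_. lborel))"
    define E where "E = (\<integral>\<^sup>+u. F (\<lambda>i\<in>insert k S. crow i u) \<partial>\<mu>)"
    define W where "W u = (\<lambda>i\<in>S. crow i u)" for u :: "('r + 'q) cmat"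
    have [measurable]: "W \<in> measurable borel (Pi\<^sub>M S (\<lambda>_. lborel))" unfolding W_def by measurable
    have [measurable]: "(\<lambda>p. F ((fst p)(k := snd p))) \<in> borel_measurable (Pi\<^sub>M S (\<lambda>_. lborel) \<Otimes>\<^sub>M lborel)"
      by (rule measurable_compose[OF _ F]) (rule measurable_fun_upd[where J = S], auto)
    have upd: "(\<lambda>i\<in>insert k S. f i) = (\<lambda>i\<in>S. f i)(k := f k)" for f :: "'q \<Rightarrow> complex^'q"
      by (auto simp: fun_eq_iff)
    have mI[measurable]: "(\<lambda>p. a (fst p) * F ((W (snd p))(k := row (fst p) (snd p)))) \<in> borel_measurable (lborel \<Otimes>\<^sub>M \<mu>)"
      by measurable
    have avg: "a s * E = (\<integral>\<^sup>+u. a s * F ((W u)(k := row s u)) \<partial>\<mu>)" for s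
    proof (cases "0 < norm_sq_on (- Inr ` S) s")
      case True
      obtain g where g: "g \<in> SU" "\<And>u i. i \<in> S \<Longrightarrow> crow i (g ** u) = crow i u" "\<And>u. crow k (g ** u) = row s u"
        using row_exchange[OF k True] unfolding row_def by blast
      have [measurable]: "(**) g \<in> borel_measurable borel"
        by (intro borel_measurable_continuous_onI continuous_intros)
      have "E = (\<integral>\<^sup>+u. F (\<lambda>i\<in>insert k S. crow i u) \<partial>distr \<mu> borel ((**) g))"
        unfolding inv[OF g(1)] E_def ..
      also have "\<dots> = (\<integral>\<^sup>+u. F (\<lambda>i\<in>insert k S. crow i (g ** u)) \<partial>\<mu>)"
        by (rule nn_integral_distr) measurable
      also have "\<dots> = (\<integral>\<^sup>+u. F ((W u)(k := row s u)) \<partial>\<mu>)"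
        unfolding upd W_def g(3) by (simp add: g(2) cong: restrict_cong)
      finally have "E = (\<integral>\<^sup>+u. F ((W u)(k := row s u)) \<partial>\<mu>)" .
      moreover have "(\<lambda>u. F ((W u)(k := row s u))) \<in> borel_measurable \<mu>"
      proof -
        have [measurable]: "row s \<in> borel_measurable borel"
          unfolding row_def by (intro borel_measurable_continuous_onI continuous_intros)
        show ?thesis by measurable
      qed
      ultimately show ?thesis by (simp add: nn_integral_cmult)
    next
      case False
      then have "a s = 0" by (simp add: a_def indicator_def)
      then show ?thesis by simp
    qed
    have "E * G = (\<integral>\<^sup>+s. (\<integral>\<^sup>+u. a s * F ((W u)(k := row s u)) \<partial>\<mu>) \<partial>lborel)"
    proof -
      have "(\<integral>\<^sup>+s. a s * E \<partial>lborel) = G * E" unfolding G_def by (rule nn_integral_multc) simp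
      then show ?thesis unfolding avg by (simp only: mult.commute)
    qed
    also have "\<dots> = (\<integral>\<^sup>+u. (\<integral>\<^sup>+s. a s * F ((W u)(k := row s u)) \<partial>lborel) \<partial>\<mu>)"
      by (rule P.Fubini'[symmetric]) (use mI in \<open>simp add: split_def\<close>)
    finally have EG: "E * G = (\<integral>\<^sup>+u. (\<integral>\<^sup>+s. a s * F ((W u)(k := row s u)) \<partial>lborel) \<partial>\<mu>)" .
    define J where "J w = (\<integral>\<^sup>+x. trunc_density (D - 1) (gram_defect S w - rank_one_row x) * F (w(k := x)) \<partial>lborel)" for w
    have mJ0[measurable]: "(\<lambda>p. trunc_density (D - 1) (gram_defect S (fst p) - rank_one_row (snd p)) * F ((fst p)(k := snd p)))
        \<in> borel_measurable (Pi\<^sub>M S (\<lambda>_. lborel) \<Otimes>\<^sub>M lborel)"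
      by measurable
    have [measurable]: "J \<in> borel_measurable (Pi\<^sub>M S (\<lambda>_. lborel))"
      unfolding J_def by (rule lborel.borel_measurable_nn_integral) (use mJ0 in \<open>simp add: split_def\<close>)
    have [measurable]: "(det :: complex^'q^'q \<Rightarrow> complex) \<in> borel_measurable borel"
      by (intro borel_measurable_continuous_onI continuous_intros)
    define dt where "dt w = cmod (det (gram_defect S w))" for w
    have [measurable]: "dt \<in> borel_measurable (Pi\<^sub>M S (\<lambda>_. lborel))" unfolding dt_def by measurable
    have dW: "dt (W u) = cmod (det (gram_defect S (\<lambda>i. crow i u)))" for u
      by (simp add: dt_def W_def gram_defect_restrict)
    \<comment> \<open>The average over s with the preceding rows held fixed, obtained by solving
      \<open>row_combination_law\<close> for it. Where \<open>dt w\<close> = 0, division by zero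
      makes the value 0; by the induction hypothesis this concerns a null set only, since the law of
      the preceding rows has a positive power of \<open>dt\<close> as a factor.\<close>
    define \<Phi> where "\<Phi> w = ennreal (1 / dt w ^ D) * (c * J w)" for w
    have [measurable]: "\<Phi> \<in> borel_measurable (Pi\<^sub>M S (\<lambda>_. lborel))" unfolding \<Phi>_def by measurable
    have "(\<integral>\<^sup>+u. indicator {w. dt w = 0} (W u) \<partial>\<mu>)
      = C * (\<integral>\<^sup>+w. trunc_density D (gram_defect S w) * indicator {w. dt w = 0} w \<partial>Pi\<^sub>M S (\<lambda>_. lborel))"
    proof -
      have "(\<lambda>w. indicator {0} (dt w) :: ennreal) \<in> borel_measurable (Pi\<^sub>M S (\<lambda>_. lborel))" by measurable
      then have "(\<lambda>w. indicator {w. dt w = 0} w :: ennreal) \<in> borel_measurable (Pi\<^sub>M S (\<lambda>_. lborel))"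
        by (simp add: indicator_def)
      from C[OF this] show ?thesis by (simp add: W_def D_def)
    qed
    also have "(\<integral>\<^sup>+w. trunc_density D (gram_defect S w) * indicator {w. dt w = 0} w \<partial>Pi\<^sub>M S (\<lambda>_. lborel)) = (\<integral>\<^sup>+w. 0 \<partial>Pi\<^sub>M S (\<lambda>_. lborel :: (complex^'q) measure))"
      using D by (intro nn_integral_cong) (auto simp: trunc_density_def dt_def indicator_def)
    finally have "(\<integral>\<^sup>+u. indicator {w. dt w = 0} (W u) \<partial>\<mu>) = 0" by simp
    moreover have "(\<lambda>u. indicator {w. dt w = 0} (W u) :: ennreal) \<in> borel_measurable \<mu>"
    proof -
      have "(\<lambda>u. indicator {0} (dt (W u)) :: ennreal) \<in> borel_measurable \<mu>" by measurable
      then show ?thesis by (simp add: indicator_def)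
    qed
    ultimately have "AE u in \<mu>. (indicator {w. dt w = 0} (W u) :: ennreal) = 0"
      by (simp add: nn_integral_0_iff_AE)
    then have "AE u in \<mu>. (\<integral>\<^sup>+s. a s * F ((W u)(k := row s u)) \<partial>lborel) = \<Phi> (W u)"
      using SU
    proof (eventually_elim)
      fix u assume u: "u \<in> SU" and "(indicator {w. dt w = 0} (W u) :: ennreal) = 0"
      then have nz: "dt (W u) \<noteq> 0" by (auto simp: indicator_def split: if_splits)
      have mF: "(\<lambda>x. F ((W u)(k := x))) \<in> borel_measurable borel"
      proof -
        have "W u \<in> space (Pi\<^sub>M S (\<lambda>_. lborel))" by (simp add: W_def space_PiM)
        then have "(\<lambda>x. (W u, x)) \<in> measurable borel (Pi\<^sub>M S (\<lambda>_. lborel) \<Otimes>\<^sub>M lborel)" by measurable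
        from measurable_compose[OF this \<open>(\<lambda>p. F ((fst p)(k := snd p))) \<in> borel_measurable (Pi\<^sub>M S (\<lambda>_. lborel) \<Otimes>\<^sub>M lborel)\<close>]
        show ?thesis by simp
      qed
      have "ennreal (dt (W u) ^ D) * (\<integral>\<^sup>+s. a s * F ((W u)(k := row s u)) \<partial>lborel) = c * J (W u)"
        unfolding dW J_def a_def row_def
        using c[OF _ _ mF, of u] u nz by (simp add: SU_iff dW) (simp add: W_def gram_defect_restrict)
      then have "ennreal (1 / dt (W u) ^ D) * (ennreal (dt (W u) ^ D) * (\<integral>\<^sup>+s. a s * F ((W u)(k := row s u)) \<partial>lborel)) = \<Phi> (W u)"
        by (simp add: \<Phi>_def)
      moreover have "ennreal (1 / dt (W u) ^ D) * ennreal (dt (W u) ^ D) = 1"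
      proof -
        have "0 \<le> dt (W u)" by (simp add: dt_def)
        then show ?thesis using nz by (simp flip: ennreal_mult)
      qed
      ultimately show "(\<integral>\<^sup>+s. a s * F ((W u)(k := row s u)) \<partial>lborel) = \<Phi> (W u)"
        by (simp flip: mult.assoc)
    qed
    then have "E * G = (\<integral>\<^sup>+u. \<Phi> (W u) \<partial>\<mu>)"
      unfolding EG by (rule nn_integral_cong_AE)
    also have "\<dots> = C * (\<integral>\<^sup>+w. trunc_density D (gram_defect S w) * \<Phi> w \<partial>Pi\<^sub>M S (\<lambda>_. lborel))"
      unfolding W_def D_def by (rule C) measurable
    also have "(\<integral>\<^sup>+w. trunc_density D (gram_defect S w) * \<Phi> w \<partial>Pi\<^sub>M S (\<lambda>_. lborel)) = (\<integral>\<^sup>+w. c * J w \<partial>Pi\<^sub>M S (\<lambda>_. lborel))"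
    proof (intro nn_integral_cong)
      fix w
      let ?Q = "gram_defect S w"
      show "trunc_density D ?Q * \<Phi> w = c * J w"
      \<comment> \<open>The power of the determinant in the law of the preceding rows cancels the
        denominator of \<Phi>. Where this fails both sides vanish: for singular \<open>?Q\<close> by
        \<open>null_pos_semidef_diff\<close>, and otherwise because \<open>?Q\<close> would be
        positive semidefinite if \<open>?Q - rank_one_row x\<close> were.\<close>
      proof (cases "pos_semidef ?Q \<and> det ?Q \<noteq> 0")
        case True
        then have "ennreal (dt w ^ D) * ennreal (1 / dt w ^ D) = 1"
          by (simp add: dt_def flip: ennreal_mult)
        then show ?thesis using True
          by (simp add: trunc_density_def \<Phi>_def flip: mult.assoc dt_def)
      next
        case False
        have "J w = 0"
        proof (cases "det ?Q = 0")
          case True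
          have "AE x in lborel. \<not> pos_semidef (?Q - rank_one_row x)"
            using AE_not_in[OF null_pos_semidef_diff[OF True]] by simp
          then have "J w = (\<integral>\<^sup>+x. 0 \<partial>(lborel :: (complex^'q) measure))"
            unfolding J_def by (intro nn_integral_cong_AE) (auto simp: trunc_density_def)
          then show ?thesis by simp
        next
          case nz: False
          then have "\<not> pos_semidef (?Q - rank_one_row x)" for x
            using False pos_semidef_diff_rank_one_row(1) by blast
          then show ?thesis by (simp add: J_def trunc_density_def)
        qed
        moreover have "trunc_density D ?Q = 0"
          using False D by (auto simp: trunc_density_def)
        ultimately show ?thesis by simp
      qed
    qed
    also have "\<dots> = c * (\<integral>\<^sup>+w. J w \<partial>Pi\<^sub>M S (\<lambda>_. lborel))"
      by (rule nn_integral_cmult) measurable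
    also have "(\<integral>\<^sup>+w. J w \<partial>Pi\<^sub>M S (\<lambda>_. lborel))
      = (\<integral>\<^sup>+w. trunc_density (CARD('r) - card (insert k S)) (gram_defect (insert k S) w) * F w \<partial>Pi\<^sub>M (insert k S) (\<lambda>_. lborel))"
    proof (subst L.product_nn_integral_insert[OF insert.hyps])
      have "card (insert k S) = Suc (card S)" using insert.hyps by simp
      then show "(\<integral>\<^sup>+w. J w \<partial>Pi\<^sub>M S (\<lambda>_. lborel)) = (\<integral>\<^sup>+w. (\<integral>\<^sup>+x. trunc_density (CARD('r) - card (insert k S)) (gram_defect (insert k S) (w(k := x))) * F (w(k := x)) \<partial>lborel) \<partial>Pi\<^sub>M S (\<lambda>_. lborel))"
        by (simp add: J_def gram_defect_insert[OF k] D_def)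
    qed measurable
    finally have "E * G = C * (c * (\<integral>\<^sup>+w. trunc_density (CARD('r) - card (insert k S)) (gram_defect (insert k S) w) * F w \<partial>Pi\<^sub>M (insert k S) (\<lambda>_. lborel)))" (is "_ = C * (c * ?R)") .
    then have "E * G / G = C * c * ?R / G" by (simp add: mult.assoc)
    moreover have "E * G / G = E" using G by (intro ennreal_mult_divide_eq) auto
    ultimately have "E = ?R * (C * c) / G" by (simp add: mult.commute)
    also have "\<dots> = ?R * (C * c / G)" by (rule ennreal_times_divide[symmetric])
    finally show "(\<integral>\<^sup>+u. F (\<lambda>i\<in>insert k S. crow i u) \<partial>\<mu>) = C * c / G * ?R"
      unfolding E_def by (simp only: mult.commute[of "C * c / G"])
  qed
qed

section \<open>The matrix ball and the double cosets\<close>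

lemma sum_UNIV_sum:
  fixes f :: "'a::finite + 'b::finite \<Rightarrow> 'c::comm_monoid_add"
  shows "(\<Sum>i\<in>UNIV. f i) = (\<Sum>a\<in>UNIV. f (Inl a)) + (\<Sum>b\<in>UNIV. f (Inr b))"
  unfolding UNIV_Plus_UNIV[symmetric] by (subst sum.Plus) simp_all

section \<open>Blocks, block-diagonal matrices and their determinants\<close>

definition corner :: "complex^('m::finite + 'q::finite)^('m + 'q) \<Rightarrow> complex^'q^'q" where
  "corner u = (\<chi> i j. u $ Inr i $ Inr j)"

definition upper :: "complex^('m::finite + 'q::finite)^('m + 'q) \<Rightarrow> complex^'m^'m" where
  "upper u = (\<chi> i j. u $ Inl i $ Inl j)"

lemma corner_block_diag [simp]: "corner (block_diag A B) = B"
  by (simp add: corner_def block_diag_def vec_eq_iff)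

lemma upper_block_diag [simp]: "upper (block_diag A B) = A"
  by (simp add: upper_def block_diag_def vec_eq_iff)

lemma block_diag_nth [simp]:
  "block_diag A B $ Inl a $ Inl b = A $ a $ b" "block_diag A B $ Inl a $ Inr d = 0"
  "block_diag A B $ Inr c $ Inl b = 0" "block_diag A B $ Inr c $ Inr d = B $ c $ d"
  by (simp_all add: block_diag_def)

lemma vec_eq_sum_iff:
  fixes A B :: "'a^('m::finite + 'q::finite)^('m + 'q)"
  shows "A = B \<longleftrightarrow> (\<forall>a b. A $ Inl a $ Inl b = B $ Inl a $ Inl b) \<and> (\<forall>a b. A $ Inl a $ Inr b = B $ Inl a $ Inr b)
    \<and> (\<forall>a b. A $ Inr a $ Inl b = B $ Inr a $ Inl b) \<and> (\<forall>a b. A $ Inr a $ Inr b = B $ Inr a $ Inr b)"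
  unfolding vec_eq_iff by (metis sum.exhaust)

lemma block_diag_mult:
  fixes A C :: "complex^'m^'m" and B D :: "complex^'q^'q"
  shows "block_diag A B ** block_diag C D = block_diag (A ** C) (B ** D)"
  by (simp add: vec_eq_sum_iff matrix_matrix_mult_def sum_UNIV_sum)

lemma block_diag_mat_1: "block_diag (mat 1) (mat 1) = (mat 1 :: complex^('m::finite + 'q::finite)^('m + 'q))"
  by (simp add: vec_eq_sum_iff mat_def)

lemma cadjoint_block_diag: "cadjoint (block_diag A B) = block_diag (cadjoint A) (cadjoint B)"
  by (simp add: vec_eq_sum_iff)

lemma unitary_block_diag: "unitary A \<Longrightarrow> unitary B \<Longrightarrow> unitary (block_diag A B)"
  by (simp add: unitary_def cadjoint_block_diag block_diag_mult block_diag_mat_1)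

text \<open>Padding with zeros turns the block-diagonal extension of a rank-one update into a
  rank-one update of the same norm, and such updates generate the unitary group. This avoids
  expanding the determinant over permutations.\<close>

lemma det_block_diag_left:
  "unitary A \<Longrightarrow> det (block_diag A (mat 1) :: complex^('m::finite + 'q::finite)^('m + 'q)) = det A"
proof (induction A rule: unitary_rank_one_induct)
  case one
  then show ?case by (simp add: block_diag_mat_1)
next
  case (rank_one a w)
  define w' :: "complex^('m + 'q)" where "w' = (\<chi> i. case i of Inl b \<Rightarrow> w $ b | Inr _ \<Rightarrow> 0)"
  have "(norm w')\<^sup>2 = (norm w)\<^sup>2" by (simp add: norm_sq_vec sum_UNIV_sum w'_def)
  moreover have "block_diag (rank_one_update a w) (mat 1) = rank_one_update a w'"
    by (simp add: vec_eq_sum_iff rank_one_update_def w'_def mat_def)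
  ultimately show ?case by (simp add: det_rank_one_update)
next
  case (mult A B)
  have "block_diag (A ** B) (mat 1 :: complex^'q^'q) = block_diag A (mat 1) ** block_diag B (mat 1)"
    by (simp add: block_diag_mult)
  then show ?case using mult by (simp add: det_mul)
qed

lemma det_block_diag_right:
  "unitary A \<Longrightarrow> det (block_diag (mat 1) A :: complex^('m::finite + 'q::finite)^('m + 'q)) = det A"
proof (induction A rule: unitary_rank_one_induct)
  case one
  then show ?case by (simp add: block_diag_mat_1)
next
  case (rank_one a w)
  define w' :: "complex^('m + 'q)" where "w' = (\<chi> i. case i of Inr b \<Rightarrow> w $ b | Inl _ \<Rightarrow> 0)"
  have "(norm w')\<^sup>2 = (norm w)\<^sup>2" by (simp add: norm_sq_vec sum_UNIV_sum w'_def)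
  moreover have "block_diag (mat 1) (rank_one_update a w) = rank_one_update a w'"
    by (simp add: vec_eq_sum_iff rank_one_update_def w'_def mat_def)
  ultimately show ?case by (simp add: det_rank_one_update)
next
  case (mult A B)
  have "block_diag (mat 1 :: complex^'m^'m) (A ** B) = block_diag (mat 1) A ** block_diag (mat 1) B"
    by (simp add: block_diag_mult)
  then show ?case using mult by (simp add: det_mul)
qed

lemma SU_block_diag: "A \<in> SU \<Longrightarrow> B \<in> SU \<Longrightarrow> block_diag A B \<in> SU"
proof -
  assume A: "A \<in> SU" and B: "B \<in> SU"
  have "det (block_diag A (mat 1) ** block_diag (mat 1) B) = 1"
    using A B by (simp add: det_mul det_block_diag_left det_block_diag_right SU_iff)
  then show ?thesis using A B by (simp add: SU_iff unitary_block_diag block_diag_mult)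
qed

lemma K1_subset_SU: "K1 \<subseteq> SU"
  by (auto simp: K1_def SU_block_diag)

section \<open>Corners of special unitary matrices and the matrix ball\<close>

lemma pos_semidef_gram: "pos_semidef (cadjoint Y ** Y)"
proof -
  have "cinner u ((cadjoint Y ** Y) *v u) = cinner (Y *v u) (Y *v u)" for u
    by (simp add: cinner_cadjoint matrix_vector_mul_assoc)
  then show ?thesis by (simp add: pos_semidef_cinner cadjoint_mult cinner_self)
qed

text \<open>Orthonormality of the last columns gives I - w^* w = Y^* Y, where Y is their part above
  the corner.\<close>

lemma corner_in_B_ball:
  assumes "unitary u"
  shows "corner u \<in> B_ball"
proof -
  define Y where "Y = (\<chi> a j. u $ Inl a $ Inr j)"
  have "(mat 1 - cadjoint (corner u) ** corner u) $ i $ j = (cadjoint Y ** Y) $ i $ j" for i j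
  proof -
    have "(cadjoint u ** u) $ Inr i $ Inr j = mat 1 $ i $ j"
      using assms by (simp add: unitary_def mat_def)
    then show ?thesis
      by (simp add: matrix_matrix_mult_def sum_UNIV_sum Y_def corner_def algebra_simps)
  qed
  then have "mat 1 - cadjoint (corner u) ** corner u = cadjoint Y ** Y" by (simp add: vec_eq_iff)
  then show ?thesis by (simp add: B_ball_def pos_semidef_gram)
qed

lemma contraction_svd:
  assumes w: "w \<in> B_ball" and U: "unitary U" and V: "unitary V"
    and ww: "w = U ** diag_matrix (\<chi> i. of_real (n $ i)) ** V"
  shows "mat 1 - cadjoint w ** w = cadjoint V ** diag_matrix (\<chi> i. of_real (1 - (n $ i)\<^sup>2)) ** V"
    and "(n $ i)\<^sup>2 \<le> 1"
proof -
  let ?D = "diag_matrix (\<chi> i. of_real (n $ i)) :: complex^'a^'a"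
  let ?E = "diag_matrix (\<chi> i. of_real (1 - (n $ i)\<^sup>2)) :: complex^'a^'a"
  have cD: "cadjoint ?D = ?D" by (simp add: vec_eq_iff diag_matrix_def)
  have "cadjoint w ** w = cadjoint V ** (?D ** ((cadjoint U ** U) ** ?D)) ** V"
    by (simp add: ww cadjoint_mult cD matrix_mul_assoc)
  also have "\<dots> = cadjoint V ** diag_matrix (\<chi> i. of_real ((n $ i)\<^sup>2)) ** V"
    using U by (simp add: unitary_def diag_matrix_mult power2_eq_square)
  finally have "mat 1 - cadjoint w ** w = cadjoint V ** (mat 1 - diag_matrix (\<chi> i. of_real ((n $ i)\<^sup>2))) ** V"
    using V by (simp add: matrix_diff_ldistrib matrix_diff_rdistrib unitary_def)
  also have "mat 1 - diag_matrix (\<chi> i. of_real ((n $ i)\<^sup>2)) = ?E"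
    by (simp add: vec_eq_iff diag_matrix_def mat_def)
  finally show *: "mat 1 - cadjoint w ** w = cadjoint V ** ?E ** V" .
  have "pos_semidef (cadjoint V ** ?E ** V)" using w unfolding B_ball_def mem_Collect_eq * .
  moreover have "det V \<noteq> 0" using unitary_norm_det[OF V] by auto
  ultimately have "pos_semidef ?E" by (simp add: pos_semidef_congruence_iff)
  then have "0 \<le> Re (cinner (axis i 1) (?E *v axis i 1))" unfolding pos_semidef_cinner by blast
  also have "cinner (axis i 1) (?E *v axis i 1) = of_real (1 - (n $ i)\<^sup>2)"
    unfolding cinner_axis_left diag_matrix_vec by (simp add: axis_def)
  finally show "(n $ i)\<^sup>2 \<le> 1" by simp
qed

text \<open>In terms of singular values the determinant is the product of the numbers 1 - n_i^2
  \<ge> 0. This reconciles the complex determinant of the product formula with the modulus in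
  \<open>trunc_density\<close>.\<close>

lemma det_B_ball:
  assumes "w \<in> B_ball"
  shows "det (mat 1 - cadjoint w ** w) = of_real (cmod (det (mat 1 - cadjoint w ** w)))"
proof -
  obtain U V n where U: "unitary U" and V: "unitary V"
    and ww: "w = U ** diag_matrix (\<chi> i. of_real (n $ i)) ** V"
    by (rule svd_exists[of w])
  note c = contraction_svd[OF assms U V ww]
  have "cnj (det V) * det V = 1" using V unfolding unitary_def by (metis det_I det_cadjoint det_mul)
  then have "det (mat 1 - cadjoint w ** w) = (\<Prod>i\<in>UNIV. of_real (1 - (n $ i)\<^sup>2))"
    unfolding c(1) det_mul det_diag_matrix by (simp add: mult_ac)
  also have "\<dots> = of_real (\<Prod>i\<in>UNIV. 1 - (n $ i)\<^sup>2)" by simp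
  finally have d: "det (mat 1 - cadjoint w ** w) = of_real (\<Prod>i\<in>UNIV. 1 - (n $ i)\<^sup>2)" .
  have "0 \<le> (\<Prod>i\<in>UNIV. 1 - (n $ i)\<^sup>2)" using c(2) by (intro prod_nonneg) auto
  then show ?thesis unfolding d norm_of_real by simp
qed

text \<open>A contraction is dilated to a special unitary matrix: with R^* R = I - w^* w, the matrix
  R placed in q of the rows above w makes the columns orthonormal, and \<open>SU_gram\<close>
  completes them.\<close>

lemma B_ball_eq_corner:
  assumes q: "CARD('q::finite) \<le> CARD('m::finite)"
  shows "(B_ball :: (complex^'q^'q) set) = corner ` (SU :: (('m + 'q) cmat) set)"
proof (intro equalityI subsetI)
  fix w :: "complex^'q^'q" assume w: "w \<in> B_ball"
  obtain U V n where U: "unitary U" and V: "unitary V"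
    and ww: "w = U ** diag_matrix (\<chi> i. of_real (n $ i)) ** V"
    by (rule svd_exists[of w])
  note c = contraction_svd[OF w U V ww]
  obtain e :: "'q \<Rightarrow> 'm" where e: "inj e"
    using q by (metis card_le_inj finite inj_on_subset top_greatest)
  define R where "R = diag_matrix (\<chi> i. of_real (sqrt (1 - (n $ i)\<^sup>2))) ** V"
  define x :: "'q \<Rightarrow> complex^('m + 'q)" where
    "x j = (\<chi> a. case a of Inl b \<Rightarrow> if b \<in> range e then R $ inv e b $ j else 0 | Inr i \<Rightarrow> w $ i $ j)" for j
  have cD: "cadjoint (diag_matrix (\<chi> i. of_real (sqrt (1 - (n $ i)\<^sup>2)))) = (diag_matrix (\<chi> i. of_real (sqrt (1 - (n $ i)\<^sup>2))) :: complex^'q^'q)"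
    by (simp add: vec_eq_iff diag_matrix_def)
  have "cadjoint R ** R = cadjoint V ** (diag_matrix (\<chi> i. of_real (sqrt (1 - (n $ i)\<^sup>2))) ** diag_matrix (\<chi> i. of_real (sqrt (1 - (n $ i)\<^sup>2)))) ** V"
    unfolding R_def cadjoint_mult cD by (simp add: matrix_mul_assoc)
  also have "\<dots> = mat 1 - cadjoint w ** w"
    unfolding c(1) diag_matrix_mult using c(2) by (simp flip: of_real_mult)
  finally have RR: "cadjoint R ** R + cadjoint w ** w = mat 1" by simp
  have gram: "cinner (axis (Inr i) 1 :: complex^('m + 'q)) (axis (Inr j) 1) = cinner (x i) (x j)" for i j
  proof -
    have "(\<Sum>b\<in>UNIV. cnj (if b \<in> range e then R $ inv e b $ i else 0) * (if b \<in> range e then R $ inv e b $ j else 0))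
      = (\<Sum>b\<in>range e. cnj (R $ inv e b $ i) * R $ inv e b $ j)"
      by (rule sum.mono_neutral_cong_right) auto
    also have "\<dots> = (\<Sum>l\<in>UNIV. cnj (R $ l $ i) * R $ l $ j)"
      by (subst sum.reindex[OF e]) (simp add: inv_f_f[OF e])
    finally have "cinner (x i) (x j) = (cadjoint R ** R + cadjoint w ** w) $ i $ j"
      unfolding cinner_def sum_UNIV_sum by (simp add: x_def matrix_matrix_mult_def)
    then show ?thesis unfolding RR cinner_axis_left by (simp add: axis_def mat_def)
  qed
  have "CARD('m + 'q) = CARD('m) + CARD('q)" "0 < CARD('m)" by simp_all
  then have "CARD('q) < CARD('m + 'q)" by linarith
  then obtain u :: "('m + 'q) cmat" where u: "u \<in> SU" "\<And>j. u *v axis (Inr j) 1 = x j"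
    using SU_gram[of UNIV "\<lambda>i. axis (Inr i) 1" x] gram by auto
  have "u $ Inr i $ Inr j = w $ i $ j" for i j
    using arg_cong[OF u(2)[of j], of "\<lambda>z. z $ Inr i"] by (simp add: matrix_vector_axis x_def)
  then have "w = corner u" by (simp add: corner_def vec_eq_iff)
  then show "w \<in> corner ` (SU :: (('m + 'q) cmat) set)" using u by blast
qed (auto simp: SU_iff corner_in_B_ball)

text \<open>Equal corners give equal Gram matrices of the column parts above them, so some u in
  SU(m) matches these parts; q < m is what permits determinant 1. After this the matrices agree in
  their last q columns and differ by a right factor in the upper block.\<close>

lemma SU_corner_eq_imp:
  fixes g g' :: "complex^('m::finite + 'q::finite)^('m + 'q)"
  assumes q: "CARD('q) < CARD('m)" and g: "g \<in> SU" and g': "g' \<in> SU" and eq: "corner g = corner g'"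
  shows "\<exists>u\<in>SU. \<exists>v\<in>SU. g' = block_diag u (mat 1) ** g ** block_diag v (mat 1)"
proof -
  define x where "x h j = (\<chi> a. h $ Inl a $ Inr j)" for h :: "('m + 'q) cmat" and j
  have gr: "cinner (x h i) (x h j) = mat 1 $ i $ j - (cadjoint (corner h) ** corner h) $ i $ j" if "h \<in> SU" for h i j
  proof -
    have "(cadjoint h ** h) $ Inr i $ Inr j = mat 1 $ i $ j"
      using that by (simp add: SU_iff unitary_def mat_def)
    then show ?thesis
      by (simp add: matrix_matrix_mult_def sum_UNIV_sum x_def corner_def cinner_def algebra_simps)
  qed
  have gram: "cinner (x g i) (x g j) = cinner (x g' i) (x g' j)" for i j
    by (simp add: gr[OF g] gr[OF g'] eq)
  obtain u where u: "u \<in> SU" "\<And>j. u *v x g j = x g' j"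
    using SU_gram[of UNIV "x g" "x g'"] q gram by auto
  define g1 where "g1 = block_diag u (mat 1) ** g"
  have g1: "g1 \<in> SU" unfolding g1_def by (intro SU_mult SU_block_diag u g SU_mat_1)
  have col: "g1 *v axis (Inr j) 1 = g' *v axis (Inr j) 1" for j
  proof -
    have "g1 $ Inl a $ Inr j = g' $ Inl a $ Inr j" for a
      using arg_cong[OF u(2)[of j], of "\<lambda>z. z $ a"]
      by (simp add: g1_def matrix_matrix_mult_def matrix_vector_mult_def sum_UNIV_sum x_def)
    moreover have "g1 $ Inr i $ Inr j = g' $ Inr i $ Inr j" for i
    proof -
      have "g1 $ Inr i $ Inr j = ((mat 1 :: complex^'q^'q) ** corner g) $ i $ j"
        unfolding g1_def by (simp add: matrix_matrix_mult_def sum_UNIV_sum corner_def)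
      also have "\<dots> = corner g' $ i $ j" by (simp add: eq)
      finally show ?thesis by (simp add: corner_def)
    qed
    ultimately have "g1 $ i $ Inr j = g' $ i $ Inr j" for i by (cases i) simp_all
    then show ?thesis unfolding matrix_vector_axis by (simp add: vec_eq_iff)
  qed
  \<comment> \<open>\<open>h\<close> fixes the last q axes, and being unitary so does its adjoint;
    hence both its last columns and its last rows are trivial.\<close>
  define h where "h = cadjoint g1 ** g'"
  have h: "h \<in> SU" unfolding h_def by (intro SU_mult SU_cadjoint g1 g')
  have uh: "unitary h" using h by (simp add: SU_iff)
  have hcol: "h *v axis (Inr j) 1 = axis (Inr j) 1" for j
  proof -
    have "h *v axis (Inr j) 1 = (cadjoint g1 ** g1) *v axis (Inr j) 1"
      unfolding h_def by (simp add: col flip: matrix_vector_mul_assoc)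
    then show ?thesis using g1 by (simp add: SU_iff unitary_def)
  qed
  have hrow: "cadjoint h *v axis (Inr j) 1 = axis (Inr j) 1" for j
  proof -
    have "cadjoint h *v axis (Inr j) 1 = (cadjoint h ** h) *v axis (Inr j) 1"
      by (simp add: hcol flip: matrix_vector_mul_assoc)
    then show ?thesis using uh by (simp add: unitary_def)
  qed
  have e1: "h $ a $ Inr j = (if a = Inr j then 1 else 0)" for a j
    using arg_cong[OF hcol[of j], of "\<lambda>z. z $ a"] unfolding matrix_vector_axis by (simp add: axis_def)
  have e2: "h $ Inr j $ a = (if a = Inr j then 1 else 0)" for a j
  proof -
    have "cnj (h $ Inr j $ a) = (if a = Inr j then 1 else 0)"
      using arg_cong[OF hrow[of j], of "\<lambda>z. z $ a"] unfolding matrix_vector_axis by (simp add: axis_def)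
    then show ?thesis by (metis complex_cnj_cnj complex_cnj_one complex_cnj_zero)
  qed
  have hb: "h = block_diag (upper h) (mat 1)"
    by (simp add: vec_eq_sum_iff e1 e2 upper_def mat_def)
  have "block_diag (cadjoint (upper h) ** upper h) (mat 1) = (mat 1 :: ('m + 'q) cmat)"
    using uh unfolding unitary_def by (subst (asm) (1 2) hb) (simp add: cadjoint_block_diag block_diag_mult)
  then have "upper (block_diag (cadjoint (upper h) ** upper h) (mat 1 :: complex^'q^'q)) = upper (mat 1 :: ('m + 'q) cmat)"
    by simp
  then have "cadjoint (upper h) ** upper h = mat 1"
    by (simp flip: block_diag_mat_1)
  then have U: "unitary (upper h)" by (simp add: unitary_def)
  have "det (upper h) = 1" using h hb det_block_diag_left[OF U] by (metis SU_iff)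
  then have "upper h \<in> SU" using U by (simp add: SU_iff)
  moreover have "g' = block_diag u (mat 1) ** g ** block_diag (upper h) (mat 1)"
  proof -
    have "g1 ** h = (g1 ** cadjoint g1) ** g'" by (simp add: h_def matrix_mul_assoc)
    then have "g1 ** h = g'" using g1 by (simp add: SU_iff unitary_right)
    then show ?thesis using hb by (simp add: g1_def)
  qed
  ultimately show ?thesis using u by blast
qed

section \<open>The representatives \<open>b_mat\<close>\<close>

lemma sum_delta_mult:
  "(\<Sum>c\<in>UNIV. (if a = c then f c else 0) * g c) = f a * (g a :: 'b::comm_semiring_1)" for a :: "'a::finite"
proof -
  have "(\<Sum>c\<in>UNIV. (if a = c then f c else 0) * g c) = (\<Sum>c\<in>UNIV. if c = a then f c * g c else 0)"
    by (rule sum.cong) auto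
  then show ?thesis by simp
qed

lemma diag_matrix_mult_left: "(diag_matrix d ** A) $ i $ j = d $ i * (A :: complex^'m^'n) $ i $ j"
  by (simp add: diag_matrix_def matrix_matrix_mult_def sum_delta_mult)

lemma diag_matrix_mult_right: "(A ** diag_matrix d) $ i $ j = (A :: complex^'n^'m) $ i $ j * d $ j"
proof -
  have "(\<Sum>c\<in>UNIV. A $ i $ c * (if c = j then d $ c else 0)) = (\<Sum>c\<in>UNIV. if c = j then A $ i $ c * d $ c else 0)"
    by (rule sum.cong) auto
  then show ?thesis by (simp add: diag_matrix_def matrix_matrix_mult_def)
qed

lemma b_mat_nth:
  fixes t :: "real^'q::{finite,linorder}"
  shows "b_mat t z $ Inl (Inl a) $ Inl (Inl b) = (if a = b then 1 else 0)"
    "b_mat t z $ Inl (Inl a) $ Inl (Inr i) = 0" "b_mat t z $ Inl (Inl a) $ Inr i = 0"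
    "b_mat t z $ Inl (Inr i) $ Inl (Inl a) = 0" "b_mat t z $ Inr i $ Inl (Inl a) = 0"
    "b_mat t z $ Inl (Inr i) $ Inl (Inr j) = (if i = j then (if i = Min UNIV then inverse z else 1) * of_real (cos (t $ i)) else 0)"
    "b_mat t z $ Inl (Inr i) $ Inr j = (if i = j then - of_real (sin (t $ i)) else 0)"
    "b_mat t z $ Inr i $ Inl (Inr j) = (if i = j then of_real (sin (t $ i)) else 0)"
    "b_mat t z $ Inr i $ Inr j = (if i = j then (if i = Min UNIV then z else 1) * of_real (cos (t $ i)) else 0)"
  by (simp_all add: b_mat_def mat_def h_mat_def cos_mat_def sin_mat_def diag_matrix_mult) (simp_all add: diag_matrix_def)

lemma b_mat_add:
  fixes s t :: "real^'q::{finite,linorder}"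
  shows "b_mat s 1 ** b_mat t 1 = (b_mat (s + t) 1 :: complex^(('r::finite + 'q) + 'q)^(('r + 'q) + 'q))"
  by (simp add: vec_eq_iff split_sum_all matrix_matrix_mult_def sum_UNIV_sum b_mat_nth sum_delta_mult
      cos_add sin_add)

lemma b_mat_zero:
  "b_mat 0 1 = (mat 1 :: complex^(('r::finite + 'q::{finite,linorder}) + 'q)^(('r + 'q) + 'q))"
  by (simp add: vec_eq_iff split_sum_all b_mat_nth mat_def)

text \<open>The determinant is real of modulus 1, so its square is 1. Halving the angle makes it a
  square itself, hence equal to 1.\<close>

lemma SU_b_mat_one:
  fixes t :: "real^'q::{finite,linorder}"
  shows "(b_mat t 1 :: complex^(('r::finite + 'q) + 'q)^(('r + 'q) + 'q)) \<in> SU"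
proof -
  let ?b = "\<lambda>t. b_mat t 1 :: (('r + 'q) + 'q) cmat"
  have adj: "cadjoint (?b t) = ?b (- t)" for t
    by (simp add: vec_eq_iff split_sum_all b_mat_nth)
  have uni: "unitary (?b t)" for t
    by (simp add: unitary_def adj b_mat_add b_mat_zero)
  have "cadjoint (?b t) = transpose (?b t)" for t
    by (simp add: vec_eq_iff split_sum_all b_mat_nth transpose_def)
  then have "cnj (det (?b t)) = det (?b t)" for t by (metis det_cadjoint det_transpose)
  moreover have "cnj (det (?b t)) * det (?b t) = 1" for t
    using uni[of t] unfolding unitary_def by (metis det_I det_cadjoint det_mul)
  ultimately have sq: "det (?b t) * det (?b t) = 1" for t by metis
  have "t = (1/2) *\<^sub>R t + (1/2) *\<^sub>R t" by (simp add: scaleR_left_distrib[symmetric])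
  then have "det (?b t) = det (?b ((1/2) *\<^sub>R t)) * det (?b ((1/2) *\<^sub>R t))" by (metis b_mat_add det_mul)
  then have "det (?b t) = 1" using sq by simp
  then show ?thesis using uni by (simp add: SU_iff)
qed

text \<open>The phase is produced by scaling one row by z and one column by 1/z; at the crossing
  entry, which is a sine, the two cancel, and so do the determinants.\<close>

lemma SU_b_mat:
  fixes t :: "real^'q::{finite,linorder}"
  assumes z: "cmod z = 1"
  shows "(b_mat t z :: complex^(('r::finite + 'q) + 'q)^(('r + 'q) + 'q)) \<in> SU"
proof -
  let ?k = "Min UNIV :: 'q"
  define A :: "(('r + 'q) + 'q) cmat" where "A = diag_matrix (\<chi> j. if j = Inr ?k then z else 1)"
  define B :: "(('r + 'q) + 'q) cmat" where "B = diag_matrix (\<chi> j. if j = Inl (Inr ?k) then inverse z else 1)"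
  have z0: "z \<noteq> 0" using z by auto
  have "b_mat t z = A ** b_mat t 1 ** B"
    unfolding vec_eq_iff A_def B_def diag_matrix_mult_right diag_matrix_mult_left
    using z0 by (simp add: split_sum_all b_mat_nth)
  moreover have "unitary A" "unitary B"
    unfolding A_def B_def using z by (auto intro!: unitary_diag simp: norm_inverse)
  moreover have "det A * det B = 1" using z0 unfolding A_def B_def det_diag_one by simp
  ultimately show ?thesis
    using SU_b_mat_one[of t, where 'r = 'r] by (simp add: SU_iff unitary_mult det_mul)
qed

lemma corner_b_mat:
  fixes t :: "real^'q::{finite,linorder}"
  shows "corner (b_mat t z :: complex^(('r::finite + 'q) + 'q)^(('r + 'q) + 'q)) = h_mat z ** cos_mat t"
  by (simp add: corner_def vec_eq_iff b_mat_nth h_mat_def cos_mat_def diag_matrix_mult) (simp add: diag_matrix_def)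

lemma corner_block_diag_mult:
  "corner (block_diag A B ** g ** block_diag C D) = B ** corner g ** (D :: complex^'q^'q)"
proof -
  have "(block_diag A B ** g) $ Inr i $ j = (\<Sum>c\<in>UNIV. B $ i $ c * g $ Inr c $ j)" for i j
    by (simp add: matrix_matrix_mult_def sum_UNIV_sum)
  then show ?thesis
    by (simp add: corner_def vec_eq_iff matrix_matrix_mult_def[of "block_diag A B ** g"] sum_UNIV_sum)
       (simp add: matrix_matrix_mult_def)
qed

lemma h_mat_mult: "h_mat a ** h_mat b = h_mat (a * b)"
  unfolding h_mat_def diag_matrix_mult by (rule arg_cong[of _ _ diag_matrix]) (simp add: vec_eq_iff)

lemma h_mat_one: "h_mat 1 = mat 1"
  by (simp add: h_mat_def diag_matrix_def mat_def vec_eq_iff)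

lemma unitary_h_mat: "cmod z = 1 \<Longrightarrow> unitary (h_mat z)"
  unfolding h_mat_def by (rule unitary_diag) simp

lemma det_h_mat: "det (h_mat z) = z"
  unfolding h_mat_def by (rule det_diag_one)

lemma corner_b_mat_product:
  fixes t t' :: "real^'q::{finite,linorder}" and u :: "complex^('r::finite + 'q)^('r + 'q)"
  shows "corner (b_mat t z ** block_diag u v ** b_mat t' z')
    = - (sin_mat t ** corner u ** sin_mat t') + h_mat z ** (cos_mat t ** v ** cos_mat t') ** h_mat z'"
proof -
  have l: "(b_mat t z ** block_diag u v) $ Inr i $ Inl (Inl c) = of_real (sin (t $ i)) * u $ Inr i $ Inl c"
    "(b_mat t z ** block_diag u v) $ Inr i $ Inl (Inr j) = of_real (sin (t $ i)) * u $ Inr i $ Inr j"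
    "(b_mat t z ** block_diag u v) $ Inr i $ Inr j = (if i = Min UNIV then z else 1) * of_real (cos (t $ i)) * v $ i $ j"
    for i j c
    by (simp_all add: matrix_matrix_mult_def sum_UNIV_sum b_mat_nth sum_delta_mult)
  have d: "(\<Sum>c\<in>UNIV. a c * (if c = j then f c else 0)) = a j * (f j :: complex)" for a f and j :: 'q
  proof -
    have "(\<Sum>c\<in>UNIV. a c * (if c = j then f c else 0)) = (\<Sum>c\<in>UNIV. if c = j then a c * f c else 0)"
      by (rule sum.cong) auto
    then show ?thesis by simp
  qed
  show ?thesis
    unfolding vec_eq_iff
  proof (intro allI)
    fix i j
    have "corner (b_mat t z ** block_diag u v ** b_mat t' z') $ i $ j
      = (\<Sum>c\<in>UNIV. (b_mat t z ** block_diag u v) $ Inr i $ c * b_mat t' z' $ c $ Inr j)"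
      by (simp add: corner_def matrix_matrix_mult_def[of "b_mat t z ** block_diag u v"])
    also have "\<dots> = of_real (sin (t $ i)) * u $ Inr i $ Inr j * - of_real (sin (t' $ j))
       + (if i = Min UNIV then z else 1) * of_real (cos (t $ i)) * v $ i $ j * ((if j = Min UNIV then z' else 1) * of_real (cos (t' $ j)))"
      unfolding sum_UNIV_sum l b_mat_nth d by simp
    finally show "corner (b_mat t z ** block_diag u v ** b_mat t' z') $ i $ j
      = (- (sin_mat t ** corner u ** sin_mat t') + h_mat z ** (cos_mat t ** v ** cos_mat t') ** h_mat z') $ i $ j"
      unfolding sin_mat_def cos_mat_def h_mat_def vector_add_component vector_uminus_component
        diag_matrix_mult_right diag_matrix_mult_left
      by (simp add: corner_def)
  qed
qed

section \<open>Phases, the polar form and the double cosets\<close>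

lemma norm_arg_phase: "cmod (arg_phase z) = 1"
  by (simp add: arg_phase_def norm_divide)

lemma arg_phase_mult:
  assumes "cmod a = 1" "z \<noteq> 0"
  shows "arg_phase (a * z) = a * arg_phase z"
  using assms by (auto simp: arg_phase_def norm_mult)

text \<open>The determinant is \<open>det U * det V\<close> times the nonnegative product of the
  singular values. If it vanishes, the smallest singular value does, and this one sits at
  \<open>Min UNIV\<close>, where a cone point carries its phase.\<close>

lemma det_sigma_sing:
  fixes M :: "'q::{finite,linorder} cmat"
  assumes U: "unitary U" and V: "unitary V" and M: "M = U ** diag_matrix (\<chi> i. of_real (sigma_sing M $ i)) ** V"
    and pos: "\<And>i. 0 \<le> sigma_sing M $ i" and mono: "\<And>i j. i \<le> j \<Longrightarrow> sigma_sing M $ i \<le> sigma_sing M $ j"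
  shows "det M \<noteq> 0 \<Longrightarrow> arg_phase (det M) = det U * det V"
    and "det M = 0 \<Longrightarrow> sigma_sing M $ Min UNIV = 0"
proof -
  have d: "det M = det U * det V * of_real (\<Prod>i\<in>UNIV. sigma_sing M $ i)"
    by (subst M) (simp add: det_mul det_diag_matrix)
  have uv: "cmod (det U * det V) = 1"
    using unitary_norm_det[OF U] unitary_norm_det[OF V] by (simp add: norm_mult)
  show "arg_phase (det M) = det U * det V" if "det M \<noteq> 0"
  proof -
    have p: "0 \<le> (\<Prod>i\<in>UNIV. sigma_sing M $ i)" using pos by (intro prod_nonneg) auto
    have "(\<Prod>i\<in>UNIV. sigma_sing M $ i) \<noteq> 0" using that by (auto simp: d)
    then have "arg_phase (of_real (\<Prod>i\<in>UNIV. sigma_sing M $ i)) = 1"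
      using p by (simp add: arg_phase_def del: of_real_prod)
    moreover have "arg_phase (det M) = det U * det V * arg_phase (of_real (\<Prod>i\<in>UNIV. sigma_sing M $ i))"
      unfolding d by (rule arg_phase_mult[OF uv]) (use that in \<open>auto simp: d\<close>)
    ultimately show ?thesis by simp
  qed
  show "sigma_sing M $ Min UNIV = 0" if "det M = 0"
  proof -
    have "(\<Prod>i\<in>UNIV. sigma_sing M $ i) = 0" using that uv by (auto simp: d)
    then obtain i where "sigma_sing M $ i = 0" by (auto simp: prod_zero_iff)
    then show ?thesis using pos[of "Min UNIV"] mono[of "Min UNIV" i] by simp
  qed
qed

text \<open>The determinants of the two unitary factors are moved into \<open>h_mat\<close>, which
  commutes with the diagonal. The collected phase is that of \<open>det M\<close>; for singular M it
  multiplies a zero entry, so any phase may be inserted.\<close>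

lemma polar_form:
  fixes M :: "'q::{finite,linorder} cmat"
  shows "\<exists>U\<in>SU. \<exists>V\<in>SU. M = U ** (h_mat (arg_phase (det M)) ** diag_matrix (\<chi> i. of_real (sigma_sing M $ i))) ** V"
proof -
  let ?D = "diag_matrix (\<chi> i. of_real (sigma_sing M $ i)) :: 'q cmat"
  obtain U V where U: "unitary U" and V: "unitary V" and M: "M = U ** ?D ** V"
    and pos: "\<And>i. 0 \<le> sigma_sing M $ i" and mono: "\<And>i j. i \<le> j \<Longrightarrow> sigma_sing M $ i \<le> sigma_sing M $ j"
    by (rule svd_sigma_sing[of M], rule that)
  define a where "a = det U"
  define b where "b = det V"
  have a: "cmod a = 1" "cnj a * a = 1" and b: "cmod b = 1" "cnj b * b = 1"
    using unitary_norm_det[OF U] unitary_norm_det[OF V] complex_norm_square[of a] complex_norm_square[of b]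
    by (auto simp: a_def b_def mult.commute)
  define U1 where "U1 = U ** h_mat (cnj a)"
  define V1 where "V1 = h_mat (cnj b) ** V"
  have "U1 \<in> SU" using U a by (simp add: SU_iff U1_def unitary_mult unitary_h_mat det_mul det_h_mat mult.commute flip: a_def)
  moreover have "V1 \<in> SU" using V b by (simp add: SU_iff V1_def unitary_mult unitary_h_mat det_mul det_h_mat flip: b_def)
  moreover have "M = U1 ** (h_mat (arg_phase (det M)) ** ?D) ** V1"
  proof -
    have comm: "h_mat c ** ?D = ?D ** h_mat c" for c
      unfolding h_mat_def diag_matrix_mult by (rule arg_cong[of _ _ diag_matrix]) (simp add: vec_eq_iff mult.commute)
    have e: "h_mat (a * b) ** ?D = h_mat (arg_phase (det M)) ** ?D"
    proof (cases "det M = 0")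
      case True
      then have "sigma_sing M $ Min UNIV = 0" using det_sigma_sing(2)[OF U V M pos mono] by simp
      then show ?thesis
        unfolding h_mat_def diag_matrix_mult by (intro arg_cong[of _ _ diag_matrix]) (auto simp: vec_eq_iff)
    next
      case False
      then show ?thesis by (simp add: det_sigma_sing(1)[OF U V M pos mono] a_def b_def)
    qed
    have "U1 ** (h_mat (arg_phase (det M)) ** ?D) ** V1 = U1 ** (h_mat (a * b) ** ?D) ** V1" by (simp only: e)
    also have "\<dots> = U ** (h_mat (cnj a) ** (h_mat a ** (h_mat b ** ?D) ** h_mat (cnj b))) ** V"
      by (simp add: U1_def V1_def matrix_mul_assoc flip: h_mat_mult)
    also have "h_mat b ** ?D = ?D ** h_mat b" by (rule comm)
    also have "h_mat (cnj a) ** (h_mat a ** (?D ** h_mat b) ** h_mat (cnj b))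
       = (h_mat (cnj a) ** h_mat a) ** ?D ** (h_mat b ** h_mat (cnj b))"
      by (simp add: matrix_mul_assoc)
    also have "\<dots> = ?D" using a b by (simp add: h_mat_mult h_mat_one mult.commute[of b])
    finally show ?thesis using M by simp
  qed
  ultimately show ?thesis by blast
qed

lemma arccos_sigma_sing:
  fixes M :: "'q::{finite,linorder} cmat"
  assumes M: "M \<in> B_ball"
  obtains t where "t \<in> A_chamber" "cos_vec t = sigma_sing M"
proof -
  obtain U V :: "'q cmat" where U: "unitary U" and V: "unitary V" and MM: "M = U ** diag_matrix (\<chi> i. of_real (sigma_sing M $ i)) ** V"
    and pos: "\<And>i. 0 \<le> sigma_sing M $ i" and mono: "\<And>i j. i \<le> j \<Longrightarrow> sigma_sing M $ i \<le> sigma_sing M $ j"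
    by (rule svd_sigma_sing[of M], rule that)
  have le: "sigma_sing M $ i \<le> 1" for i
  proof -
    have "(sigma_sing M $ i)\<^sup>2 \<le> 1" by (rule contraction_svd(2)[OF M U V MM])
    then have "\<bar>sigma_sing M $ i\<bar> \<le> 1" by (simp add: abs_square_le_1)
    then show ?thesis by linarith
  qed
  have r': "- 1 \<le> sigma_sing M $ i" for i using pos[of i] by linarith
  show thesis
  proof (rule that)
    show "(\<chi> i. arccos (sigma_sing M $ i)) \<in> A_chamber"
      unfolding A_chamber_def
      using arccos_lbound[OF r' le] arccos_le_pi2[OF pos le] arccos_le_arccos[OF r' mono le] by simp
    show "cos_vec (\<chi> i. arccos (sigma_sing M $ i)) = sigma_sing M"
      by (simp add: cos_vec_def vec_eq_iff r' le)
  qed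
qed

text \<open>The polar form exhibits the corner of g as the corner of diag(1, U) b diag(1, V) for a
  representative b. By \<open>SU_corner_eq_imp\<close> the corner determines the matrix up to SU(p)
  on both sides, so g lies in the double coset of b.\<close>

lemma biinvariant_eq_corner:
  fixes g :: "complex^(('r::finite + 'q::{finite,linorder}) + 'q)^(('r + 'q) + 'q)"
  assumes inv: "\<And>g k k'. g \<in> SU \<Longrightarrow> k \<in> K1 \<Longrightarrow> k' \<in> K1 \<Longrightarrow> \<phi> (k ** g ** k') = \<phi> g"
    and g: "g \<in> SU"
  shows "\<phi> g = \<phi> (b_rep (cone_pt (sigma_sing (corner g)) (arg_phase (det (corner g)))))"
proof -
  let ?M = "corner g" and ?z = "arg_phase (det (corner g))"
  have "?M \<in> B_ball" using g by (simp add: SU_iff corner_in_B_ball)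
  then obtain t where t: "t \<in> A_chamber" "cos_vec t = sigma_sing ?M" by (rule arccos_sigma_sing)
  have ct: "cos_mat t = diag_matrix (\<chi> i. of_real (sigma_sing ?M $ i))"
    using t(2) by (simp add: cos_mat_def cos_vec_def vec_eq_iff)
  obtain U V where UV: "U \<in> SU" "V \<in> SU" and M: "?M = U ** (h_mat ?z ** cos_mat t) ** V"
    using polar_form[of ?M] unfolding ct by blast
  define b where "b = (b_mat t ?z :: (('r + 'q) + 'q) cmat)"
  have b: "b \<in> SU" unfolding b_def by (rule SU_b_mat[OF norm_arg_phase])
  define g1 where "g1 = block_diag (mat 1) U ** b ** block_diag (mat 1) V"
  have k: "block_diag (mat 1) U \<in> K1" "block_diag (mat 1) V \<in> K1" using UV SU_mat_1 by (auto simp: K1_def)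
  have g1: "g1 \<in> SU" unfolding g1_def using k K1_subset_SU by (intro SU_mult b) auto
  have "corner g1 = ?M" unfolding g1_def corner_block_diag_mult b_def corner_b_mat by (rule M[symmetric])
  moreover have "CARD('q) < CARD('r + 'q)" by simp
  ultimately obtain u v where uv: "u \<in> SU" "v \<in> SU" "g = block_diag u (mat 1) ** g1 ** block_diag v (mat 1)"
    using SU_corner_eq_imp[OF _ g1 g] by blast
  have "block_diag u (mat 1) \<in> K1" "block_diag v (mat 1) \<in> K1" using uv SU_mat_1 by (auto simp: K1_def)
  then have "\<phi> g = \<phi> g1" unfolding uv(3) by (rule inv[OF g1])
  also have "\<dots> = \<phi> b" unfolding g1_def by (rule inv[OF b k])
  also have "b = b_rep (cone_pt (cos_vec t) ?z)"
    unfolding b_def by (rule b_rep_cone_pt[OF t(1) norm_arg_phase, symmetric])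
  finally show ?thesis by (simp add: t(2))
qed

text \<open>Singular values are unchanged and the determinant is multiplied by
  \<open>z * z'\<close>. If it is zero, \<open>arg_phase\<close> does not see this factor, but the
  coordinate it would affect vanishes.\<close>

lemma cone_pt_twist:
  fixes M :: "'q::{finite,linorder} cmat"
  assumes z: "cmod z = 1" and z': "cmod z' = 1"
  shows "cone_pt (sigma_sing (h_mat z ** M ** h_mat z')) (arg_phase (det (h_mat z ** M ** h_mat z')))
    = cone_pt (sigma_sing M) (z * z' * arg_phase (det M))"
proof -
  obtain U V where U: "unitary U" and V: "unitary V" and MM: "M = U ** diag_matrix (\<chi> i. of_real (sigma_sing M $ i)) ** V"
    and pos: "\<And>i. 0 \<le> sigma_sing M $ i" and mono: "\<And>i j. i \<le> j \<Longrightarrow> sigma_sing M $ i \<le> sigma_sing M $ j"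
    by (rule svd_sigma_sing[of M], rule that)
  have s: "sigma_sing (h_mat z ** M ** h_mat z') = sigma_sing M"
  proof (rule sigma_sing_eqI[OF _ _ pos mono])
    show "unitary (h_mat z ** U)" "unitary (V ** h_mat z')"
      using U V z z' by (simp_all add: unitary_mult unitary_h_mat)
    show "h_mat z ** M ** h_mat z' = h_mat z ** U ** diag_matrix (\<chi> i. of_real (sigma_sing M $ i)) ** (V ** h_mat z')"
      using arg_cong[OF MM, of "\<lambda>M. h_mat z ** M ** h_mat z'"] by (simp add: matrix_mul_assoc)
  qed
  have d: "det (h_mat z ** M ** h_mat z') = z * z' * det M" by (simp add: det_mul det_h_mat mult_ac)
  show ?thesis
  proof (cases "det M = 0")
    case True
    then have "sigma_sing M $ Min UNIV = 0" using det_sigma_sing(2)[OF U V MM pos mono] by simp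
    then show ?thesis unfolding s by (simp add: cone_pt_def vec_eq_iff)
  next
    case False
    then show ?thesis unfolding s d using z z' by (simp add: arg_phase_mult norm_mult)
  qed
qed

section \<open>Haar measures\<close>

text \<open>Identifies the product of Lebesgue measures over the rows, in which
  \<open>rows_law\<close> is phrased, with Lebesgue measure on matrices.\<close>

lemma distr_PiM_vec_lambda:
  "distr (Pi\<^sub>M (UNIV :: 'n::finite set) (\<lambda>_. lborel :: 'a::euclidean_space measure)) borel (\<lambda>f. \<chi> i. f i) = lborel"
proof (rule lborel_eqI[symmetric])
  interpret product_sigma_finite "\<lambda>_ :: 'n. lborel :: 'a measure" ..
  have m: "(\<lambda>f. \<chi> i. f i) \<in> borel_measurable (Pi\<^sub>M (UNIV :: 'n set) (\<lambda>_. lborel :: 'a measure))"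
    by (intro borel_measurable_vec_lambda) (use measurable_component_singleton[of _ UNIV "\<lambda>_. lborel :: 'a measure"] in simp)
  fix l u :: "'a^'n"
  assume le: "\<And>b. b \<in> Basis \<Longrightarrow> l \<bullet> b \<le> u \<bullet> b"
  have le': "(l $ i) \<bullet> b \<le> (u $ i) \<bullet> b" if "b \<in> Basis" for i b
    using le[of "axis i b"] that by (simp add: inner_axis axis_in_Basis_iff)
  have "(\<lambda>f. \<chi> i. f i) -` box l u \<inter> space (Pi\<^sub>M (UNIV :: 'n set) (\<lambda>_. lborel :: 'a measure)) = Pi\<^sub>E UNIV (\<lambda>i. box (l $ i) (u $ i))"
    by (auto simp: space_PiM box_def Basis_vec_def inner_axis)
  then have "emeasure (distr (Pi\<^sub>M UNIV (\<lambda>_. lborel)) borel (\<lambda>f. \<chi> i. f i)) (box l u)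
    = (\<Prod>i\<in>UNIV. emeasure lborel (box (l $ i) (u $ i)))"
    using m by (simp add: emeasure_distr emeasure_PiM)
  also have "\<dots> = (\<Prod>i\<in>UNIV. ennreal (\<Prod>b\<in>Basis. (u - l) \<bullet> axis i b))"
    using le' by (intro prod.cong refl) (simp add: inner_axis)
  also have "\<dots> = ennreal (\<Prod>i\<in>UNIV. \<Prod>b\<in>Basis. (u - l) \<bullet> axis i b)"
    using le' by (intro prod_ennreal prod_nonneg) (simp add: inner_axis inner_diff_left)
  also have "\<dots> = ennreal (\<Prod>b\<in>Basis. (u - l) \<bullet> b)" by (simp add: Basis_vec_prod)
  finally show "emeasure (distr (Pi\<^sub>M UNIV (\<lambda>_. lborel)) borel (\<lambda>f. \<chi> i. f i)) (box l u) = ennreal (\<Prod>b\<in>Basis. (u - l) \<bullet> b)" .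
qed simp

lemma measurable_ball_defect [measurable]:
  "(\<lambda>w :: complex^'q^'q. mat 1 - cadjoint w ** w) \<in> borel_measurable borel"
  by (intro borel_measurable_continuous_onI continuous_intros)

lemma measurable_corner [measurable]: "corner \<in> borel_measurable borel"
  unfolding corner_def by (intro borel_measurable_continuous_onI continuous_intros)

lemma measurable_upper [measurable]: "upper \<in> borel_measurable borel"
  unfolding upper_def by (intro borel_measurable_continuous_onI continuous_intros)

lemma corner_law:
  fixes \<mu> :: "(complex^('r::finite + 'q::finite)^('r + 'q)) measure"
  assumes q: "CARD('q) \<le> CARD('r)" and sets: "sets \<mu> = sets borel" and prob: "emeasure \<mu> UNIV = 1"
    and SU: "AE u in \<mu>. u \<in> SU" and inv: "\<And>g. g \<in> SU \<Longrightarrow> distr \<mu> borel ((**) g) = \<mu>"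
  shows "\<exists>C. distr \<mu> borel corner
    = density lborel (\<lambda>w. C * trunc_density (CARD('r) - CARD('q)) (mat 1 - cadjoint w ** w))"
proof -
  let ?P = "Pi\<^sub>M (UNIV :: 'q set) (\<lambda>_. lborel :: (complex^'q) measure)"
  note [measurable_cong] = sets
  obtain C where C: "\<And>F. F \<in> borel_measurable ?P \<Longrightarrow> (\<integral>\<^sup>+u. F (\<lambda>i\<in>UNIV. crow i u) \<partial>\<mu>)
     = C * (\<integral>\<^sup>+w. trunc_density (CARD('r) - CARD('q)) (gram_defect UNIV w) * F w \<partial>?P)"
    using rows_law[OF q sets prob SU inv, of UNIV] by blast
  have [measurable]: "(\<lambda>f. \<chi> i. f i) \<in> borel_measurable ?P"
    by (intro borel_measurable_vec_lambda) (use measurable_component_singleton[of _ UNIV "\<lambda>_. lborel :: (complex^'q) measure"] in simp)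
  have gd: "gram_defect UNIV f = mat 1 - cadjoint (\<chi> i. f i) ** (\<chi> i. f i)" for f :: "'q \<Rightarrow> complex^'q"
    by (simp add: gram_defect_def vec_eq_iff matrix_matrix_mult_def)
  show ?thesis
  proof (intro exI[of _ C] measure_eqI)
    fix A :: "(complex^'q^'q) set" assume "A \<in> sets (distr \<mu> borel corner)"
    then have [measurable]: "A \<in> sets borel" by simp
    have "emeasure (distr \<mu> borel corner) A = (\<integral>\<^sup>+u. indicator A (corner u) \<partial>\<mu>)"
    proof -
      have "(\<integral>\<^sup>+x. indicator A x \<partial>distr \<mu> borel corner) = (\<integral>\<^sup>+u. indicator A (corner u) \<partial>\<mu>)"
        by (rule nn_integral_distr) measurable
      then show ?thesis by simp
    qed
    also have "\<dots> = (\<integral>\<^sup>+u. indicator A (\<chi> i. (\<lambda>i\<in>UNIV. crow i u) i) \<partial>\<mu>)"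
      by (simp add: corner_def crow_def)
    also have "\<dots> = C * (\<integral>\<^sup>+w. trunc_density (CARD('r) - CARD('q)) (gram_defect UNIV w) * indicator A (\<chi> i. w i) \<partial>?P)"
      by (rule C) measurable
    also have "(\<integral>\<^sup>+w. trunc_density (CARD('r) - CARD('q)) (gram_defect UNIV w) * indicator A (\<chi> i. w i) \<partial>?P)
      = (\<integral>\<^sup>+w. trunc_density (CARD('r) - CARD('q)) (mat 1 - cadjoint w ** w) * indicator A w \<partial>distr ?P borel (\<lambda>f. \<chi> i. f i))"
      unfolding gd by (subst nn_integral_distr) simp_all
    also have "C * \<dots> = emeasure (density lborel (\<lambda>w. C * trunc_density (CARD('r) - CARD('q)) (mat 1 - cadjoint w ** w))) A"
      unfolding distr_PiM_vec_lambda by (simp add: emeasure_density nn_integral_cmult mult.assoc)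
    finally show "emeasure (distr \<mu> borel corner) A
      = emeasure (density lborel (\<lambda>w. C * trunc_density (CARD('r) - CARD('q)) (mat 1 - cadjoint w ** w))) A" .
  qed simp
qed

lemma compact_K1: "compact (K1 :: (complex^('m::finite + 'n::finite)^('m + 'n)) set)"
proof -
  have K: "K1 = (\<lambda>p. block_diag (fst p) (snd p) :: complex^('m + 'n)^('m + 'n)) ` (SU \<times> SU)"
    by (auto simp: K1_def image_def)
  have cont: "continuous_on (SU \<times> SU) (\<lambda>p. block_diag (fst p) (snd p) :: complex^('m + 'n)^('m + 'n))"
    unfolding block_diag_def
  proof (intro continuous_on_vec_lambda)
    fix i j :: "'m + 'n"
    show "continuous_on (SU \<times> SU) (\<lambda>p. case (i, j) of (Inl a, Inl b) \<Rightarrow> fst p $ a $ b | (Inr a, Inr b) \<Rightarrow> snd p $ a $ b | _ \<Rightarrow> (0 :: complex))"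
      by (cases i; cases j) (auto intro!: continuous_intros)
  qed
  show ?thesis
    unfolding K by (rule compact_continuous_image[OF cont compact_Times[OF compact_SU compact_SU]])
qed

lemma measurable_matrix_mult_left [measurable]:
  "(\<lambda>x. g ** x) \<in> borel_measurable (borel :: (complex^'n^'n) measure)"
  by (intro borel_measurable_continuous_onI continuous_intros)

text \<open>Pushing the measure forward along the inclusion of H puts it on all Borel sets of the
  matrix space, where measurability of the matrix operations is available; H then reappears as a set
  of full measure.\<close>

lemma normalized_haar_borel:
  fixes H :: "(complex^'n^'n) set"
  assumes haar: "normalized_haar H \<mu>" and H: "compact H" and mult: "\<forall>g\<in>H. \<forall>x\<in>H. g ** x \<in> H"
  defines "\<mu>' \<equiv> distr \<mu> borel (\<lambda>x. x)"
  shows "space \<mu> = H" "(\<lambda>x. x) \<in> measurable \<mu> borel" "sets \<mu>' = sets borel" "emeasure \<mu>' UNIV = 1" "AE x in \<mu>'. x \<in> H"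
    "g \<in> H \<Longrightarrow> distr \<mu>' borel ((**) g) = \<mu>'"
proof -
  have sets: "sets \<mu> = sets (restrict_space borel H)" and prob: "emeasure \<mu> H = 1"
    and inv: "\<And>g. g \<in> H \<Longrightarrow> distr \<mu> \<mu> ((**) g) = \<mu>"
    using haar by (auto simp: normalized_haar_def)
  have Hb: "H \<in> sets borel" using H by (simp add: borel_compact)
  show space: "space \<mu> = H" using sets_eq_imp_space_eq[OF sets] by (simp add: space_restrict_space)
  show id: "(\<lambda>x. x) \<in> measurable \<mu> borel"
    unfolding measurable_cong_sets[OF sets refl] by (rule measurable_restrict_space1) simp
  show "sets \<mu>' = sets borel" by (simp add: \<mu>'_def)
  show "emeasure \<mu>' UNIV = 1" using id by (simp add: \<mu>'_def emeasure_distr space prob)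
  show "AE x in \<mu>'. x \<in> H"
    unfolding \<mu>'_def using Hb by (subst AE_distr_iff[OF id]) (auto simp: space[symmetric])
  show "distr \<mu>' borel ((**) g) = \<mu>'" if g: "g \<in> H"
  proof -
    have m: "(**) g \<in> measurable \<mu> \<mu>"
      unfolding measurable_cong_sets[OF sets sets]
      by (intro measurable_restrict_space2 measurable_restrict_space1) (use g mult in \<open>auto simp: space_restrict_space\<close>)
    have "distr \<mu>' borel ((**) g) = distr \<mu> borel ((\<lambda>x. x) \<circ> (**) g)"
      unfolding \<mu>'_def using id by (subst distr_distr) (auto simp: o_def)
    also have "\<dots> = distr (distr \<mu> \<mu> ((**) g)) borel (\<lambda>x. x)"
      by (rule distr_distr[OF id m, symmetric])
    finally show ?thesis by (simp add: inv[OF g] \<mu>'_def)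
  qed
qed

text \<open>Left invariance implies invariance under inversion, by Fubini for $\int\!\int F(x^{-1} y)\,dx\,dy$.\<close>

lemma left_haar_right_invariant:
  fixes \<nu> :: "(complex^'n^'n) measure"
  assumes sets: "sets \<nu> = sets borel" and prob: "emeasure \<nu> UNIV = 1" and AE: "AE x in \<nu>. x \<in> SU"
    and inv: "\<And>g. g \<in> SU \<Longrightarrow> distr \<nu> borel ((**) g) = \<nu>"
    and F[measurable]: "F \<in> borel_measurable borel" and v: "v \<in> SU"
  shows "(\<integral>\<^sup>+x. F (x ** v) \<partial>\<nu>) = (\<integral>\<^sup>+x. F x \<partial>\<nu>)"
proof -
  note [measurable_cong] = sets
  have sp: "space \<nu> = UNIV" using sets by (metis sets_eq_imp_space_eq space_borel)
  interpret \<nu>: finite_measure \<nu> by (rule finite_measureI) (simp add: sp prob)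
  interpret P: pair_sigma_finite \<nu> \<nu> ..
  have left: "(\<integral>\<^sup>+x. f (g ** x) \<partial>\<nu>) = (\<integral>\<^sup>+x. f x \<partial>\<nu>)" if g: "g \<in> SU" and [measurable]: "f \<in> borel_measurable borel"
    for f :: "complex^'n^'n \<Rightarrow> ennreal" and g
  proof -
    have "(\<integral>\<^sup>+x. f x \<partial>\<nu>) = (\<integral>\<^sup>+x. f x \<partial>distr \<nu> borel ((**) g))" by (simp only: inv[OF g])
    also have "\<dots> = (\<integral>\<^sup>+x. f (g ** x) \<partial>\<nu>)" by (rule nn_integral_distr) simp_all
    finally show ?thesis by simp
  qed
  have cancel: "cadjoint (y ** x) ** y = cadjoint x" if "y \<in> SU" for x y :: "complex^'n^'n"
    using that by (simp add: cadjoint_mult SU_iff unitary_def flip: matrix_mul_assoc)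
  have m2: "(\<lambda>x :: complex^'n^'n. cadjoint x ** y) \<in> borel_measurable borel" for y
    by (intro borel_measurable_continuous_onI continuous_intros)
  have m3: "(\<lambda>x :: complex^'n^'n. x ** y) \<in> borel_measurable borel" for y
    by (intro borel_measurable_continuous_onI continuous_intros)
  \<comment> \<open>On SU the adjoint is the inverse, so the left translation x \<mapsto> y x turns
    x^(-1) y into x^(-1).\<close>
  have shift: "(\<integral>\<^sup>+x. f (cadjoint x ** y) \<partial>\<nu>) = (\<integral>\<^sup>+x. f (cadjoint x) \<partial>\<nu>)"
    if y: "y \<in> SU" and f[measurable]: "f \<in> borel_measurable borel" for f :: "complex^'n^'n \<Rightarrow> ennreal" and y
    using left[OF y, of "\<lambda>x. f (cadjoint x ** y)"] measurable_compose[OF m2 f, of y]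
    by (simp add: cancel[OF y])
  have inversion: "(\<integral>\<^sup>+x. f (cadjoint x) \<partial>\<nu>) = (\<integral>\<^sup>+x. f x \<partial>\<nu>)"
    if f[measurable]: "f \<in> borel_measurable borel" for f :: "complex^'n^'n \<Rightarrow> ennreal"
  proof -
    have [measurable]: "(\<lambda>p :: (complex^'n^'n) \<times> (complex^'n^'n). cadjoint (fst p) ** snd p) \<in> borel_measurable (borel \<Otimes>\<^sub>M borel)"
      unfolding borel_prod by (intro borel_measurable_continuous_onI continuous_intros)
    have "(\<lambda>p. f (cadjoint (fst p) ** snd p)) \<in> borel_measurable (\<nu> \<Otimes>\<^sub>M \<nu>)" by measurable
    then have "(\<integral>\<^sup>+y. (\<integral>\<^sup>+x. f (cadjoint x ** y) \<partial>\<nu>) \<partial>\<nu>) = (\<integral>\<^sup>+x. (\<integral>\<^sup>+y. f (cadjoint x ** y) \<partial>\<nu>) \<partial>\<nu>)"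
      by (intro P.Fubini') (simp add: split_def)
    moreover have "(\<integral>\<^sup>+y. (\<integral>\<^sup>+x. f (cadjoint x ** y) \<partial>\<nu>) \<partial>\<nu>) = (\<integral>\<^sup>+y. (\<integral>\<^sup>+x. f (cadjoint x) \<partial>\<nu>) \<partial>\<nu>)"
      by (rule nn_integral_cong_AE) (use AE in \<open>eventually_elim, simp add: shift\<close>)
    moreover have "(\<integral>\<^sup>+x. (\<integral>\<^sup>+y. f (cadjoint x ** y) \<partial>\<nu>) \<partial>\<nu>) = (\<integral>\<^sup>+x. (\<integral>\<^sup>+y. f y \<partial>\<nu>) \<partial>\<nu>)"
      by (rule nn_integral_cong_AE) (use AE in \<open>eventually_elim, simp add: left SU_cadjoint\<close>)
    ultimately show ?thesis by (simp add: sp prob)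
  qed
  have "(\<integral>\<^sup>+x. F (x ** v) \<partial>\<nu>) = (\<integral>\<^sup>+x. F (cadjoint x ** v) \<partial>\<nu>)"
    by (rule inversion[of "\<lambda>x. F (x ** v)", symmetric]) (rule measurable_compose[OF m3 F])
  also have "\<dots> = (\<integral>\<^sup>+x. F x \<partial>\<nu>)" by (simp add: shift[OF v] inversion)
  finally show ?thesis .
qed

text \<open>Independence of the blocks. Left translation by diag(1, v) leaves the upper block alone
  and multiplies the lower one by v; averaging over v with \<nu> and absorbing the old lower block
  by right invariance makes the lower block an independent \<nu>-distributed variable.\<close>

lemma haar_K1_marginals:
  fixes \<mu> :: "(complex^('r::finite + 'q::finite)^('r + 'q)) measure" and \<nu> :: "(complex^'q^'q) measure"
  assumes \<mu>: "sets \<mu> = sets borel" "emeasure \<mu> UNIV = 1" "AE k in \<mu>. k \<in> K1" "\<And>g. g \<in> K1 \<Longrightarrow> distr \<mu> borel ((**) g) = \<mu>"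
    and \<nu>: "sets \<nu> = sets borel" "emeasure \<nu> UNIV = 1" "AE x in \<nu>. x \<in> SU" "\<And>g. g \<in> SU \<Longrightarrow> distr \<nu> borel ((**) g) = \<nu>"
    and f[measurable]: "f \<in> borel_measurable borel"
  shows "distr \<mu> (borel \<Otimes>\<^sub>M borel) (\<lambda>k. (f (upper k), corner k)) = distr \<mu> borel (\<lambda>k. f (upper k)) \<Otimes>\<^sub>M \<nu>"
proof -
  note [measurable_cong] = \<mu>(1) \<nu>(1)
  have sp: "space \<mu> = UNIV" "space \<nu> = UNIV" using \<mu>(1) \<nu>(1) by (metis sets_eq_imp_space_eq space_borel)+
  interpret \<mu>: finite_measure \<mu> by (rule finite_measureI) (simp add: sp \<mu>)
  interpret \<nu>: finite_measure \<nu> by (rule finite_measureI) (simp add: sp \<nu>)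
  interpret P: pair_sigma_finite \<nu> \<mu> ..
  show ?thesis
  proof (rule measure_eqI)
    have s: "sets (distr \<mu> borel (\<lambda>k. f (upper k)) \<Otimes>\<^sub>M \<nu>) = sets (borel \<Otimes>\<^sub>M borel)"
      by (intro sets_pair_measure_cong) (simp_all add: \<nu>)
    then show "sets (distr \<mu> (borel \<Otimes>\<^sub>M borel) (\<lambda>k. (f (upper k), corner k))) = sets (distr \<mu> borel (\<lambda>k. f (upper k)) \<Otimes>\<^sub>M \<nu>)"
      by simp
    fix A assume "A \<in> sets (distr \<mu> (borel \<Otimes>\<^sub>M borel) (\<lambda>k. (f (upper k), corner k)))"
    then have A[measurable]: "A \<in> sets (borel \<Otimes>\<^sub>M borel)" by simp
    let ?I = "\<lambda>w v. indicator A (w, v) :: ennreal"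
    define E where "E = (\<integral>\<^sup>+k. ?I (f (upper k)) (corner k) \<partial>\<mu>)"
    have rot: "E = (\<integral>\<^sup>+k. ?I (f (upper k)) (v ** corner k) \<partial>\<mu>)" if v: "v \<in> SU" for v
    proof -
      define b where "b = block_diag (mat 1 :: complex^'r^'r) v"
      have b: "b \<in> K1" using v SU_mat_1 by (auto simp: K1_def b_def)
      have "upper (b ** k) = upper k" for k
      proof -
        have "upper (b ** k) = (mat 1 :: complex^'r^'r) ** upper k"
          by (simp add: upper_def b_def vec_eq_iff sum_UNIV_sum matrix_matrix_mult_def)
        then show ?thesis by simp
      qed
      moreover have "corner (b ** k) = v ** corner k" for k
        by (simp add: corner_def b_def vec_eq_iff sum_UNIV_sum matrix_matrix_mult_def)
      moreover have "E = (\<integral>\<^sup>+k. ?I (f (upper k)) (corner k) \<partial>distr \<mu> borel ((**) b))"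
        unfolding E_def by (simp only: \<mu>(4)[OF b])
      moreover have "\<dots> = (\<integral>\<^sup>+k. ?I (f (upper (b ** k))) (corner (b ** k)) \<partial>\<mu>)"
        by (rule nn_integral_distr) measurable
      ultimately show ?thesis by simp
    qed
    have [measurable]: "(\<lambda>p :: (complex^'q^'q) \<times> (('r + 'q) cmat). fst p ** corner (snd p)) \<in> borel_measurable (borel \<Otimes>\<^sub>M borel)"
      unfolding borel_prod corner_def by (intro borel_measurable_continuous_onI continuous_intros)
    have mI: "(\<lambda>p. ?I (f (upper (snd p))) (fst p ** corner (snd p))) \<in> borel_measurable (\<nu> \<Otimes>\<^sub>M \<mu>)" by measurable
    have "E = (\<integral>\<^sup>+v. E \<partial>\<nu>)" by (simp add: sp \<nu>)
    also have "\<dots> = (\<integral>\<^sup>+v. (\<integral>\<^sup>+k. ?I (f (upper k)) (v ** corner k) \<partial>\<mu>) \<partial>\<nu>)"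
    proof (rule nn_integral_cong_AE)
      show "AE v in \<nu>. E = (\<integral>\<^sup>+k. ?I (f (upper k)) (v ** corner k) \<partial>\<mu>)"
        using \<nu>(3) by eventually_elim (rule rot)
    qed
    also have "\<dots> = (\<integral>\<^sup>+k. (\<integral>\<^sup>+v. ?I (f (upper k)) (v ** corner k) \<partial>\<nu>) \<partial>\<mu>)"
      by (rule P.Fubini'[symmetric]) (use mI in \<open>simp add: split_def\<close>)
    also have "\<dots> = (\<integral>\<^sup>+k. (\<integral>\<^sup>+v. ?I (f (upper k)) v \<partial>\<nu>) \<partial>\<mu>)"
    proof (rule nn_integral_cong_AE, use \<mu>(3) in eventually_elim)
      fix k :: "('r + 'q) cmat" assume "k \<in> K1"
      then have "corner k \<in> SU" by (auto simp: K1_def)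
      moreover have "(\<lambda>v. ?I (f (upper k)) v) \<in> borel_measurable borel" by measurable
      ultimately show "(\<integral>\<^sup>+v. ?I (f (upper k)) (v ** corner k) \<partial>\<nu>) = (\<integral>\<^sup>+v. ?I (f (upper k)) v \<partial>\<nu>)"
        by (intro left_haar_right_invariant[OF \<nu>])
    qed
    also have "\<dots> = (\<integral>\<^sup>+w. (\<integral>\<^sup>+v. ?I w v \<partial>\<nu>) \<partial>distr \<mu> borel (\<lambda>k. f (upper k)))"
      by (rule nn_integral_distr[symmetric]) measurable
    also have "\<dots> = emeasure (distr \<mu> borel (\<lambda>k. f (upper k)) \<Otimes>\<^sub>M \<nu>) A"
      using A by (subst \<nu>.emeasure_pair_measure) (simp_all add: s)
    finally have "E = emeasure (distr \<mu> borel (\<lambda>k. f (upper k)) \<Otimes>\<^sub>M \<nu>) A" .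
    moreover have "emeasure (distr \<mu> (borel \<Otimes>\<^sub>M borel) (\<lambda>k. (f (upper k), corner k))) A = E"
    proof -
      have "(\<integral>\<^sup>+x. indicator A x \<partial>distr \<mu> (borel \<Otimes>\<^sub>M borel) (\<lambda>k. (f (upper k), corner k))) = E"
        unfolding E_def by (rule nn_integral_distr) measurable
      then show ?thesis by simp
    qed
    ultimately show "emeasure (distr \<mu> (borel \<Otimes>\<^sub>M borel) (\<lambda>k. (f (upper k), corner k))) A
       = emeasure (distr \<mu> borel (\<lambda>k. f (upper k)) \<Otimes>\<^sub>M \<nu>) A" by simp
  qed
qed

section \<open>The product formula\<close>

text \<open>\<open>corner\<close> maps a compact space continuously onto the ball and is therefore a
  quotient map: the preimage of a closed set under \<open>F\<close> is the image of a compact set.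
  Continuity of \<open>F\<close> is thus obtained without continuity of \<open>sigma_sing\<close> or
  of the phase.\<close>

lemma continuous_on_B_ball_factor:
  fixes \<phi> :: "complex^('m::finite + 'q::finite)^('m + 'q) \<Rightarrow> 'a::topological_space"
  assumes q: "CARD('q) \<le> CARD('m)" and cont: "continuous_on SU \<phi>"
    and F: "\<And>g. g \<in> SU \<Longrightarrow> \<phi> g = F (corner g)"
  shows "continuous_on B_ball F"
proof -
  have c: "continuous_on S corner" for S :: "(('m + 'q) cmat) set"
    unfolding corner_def by (intro continuous_intros)
  have B: "B_ball = corner ` (SU :: (('m + 'q) cmat) set)" by (rule B_ball_eq_corner[OF q])
  have closed: "closed (B_ball :: (complex^'q^'q) set)"
    unfolding B by (intro compact_imp_closed compact_continuous_image c compact_SU)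
  show ?thesis
    unfolding continuous_on_closed_vimage[OF closed]
  proof (intro allI impI)
    fix C :: "'a set" assume C: "closed C"
    have "closed (SU \<inter> \<phi> -` C)"
      by (rule continuous_closed_preimage[OF cont compact_imp_closed[OF compact_SU] C])
    then have "compact (SU \<inter> (SU \<inter> \<phi> -` C))" by (intro compact_Int_closed compact_SU)
    then have "compact (corner ` (SU \<inter> (SU \<inter> \<phi> -` C)))" by (intro compact_continuous_image c)
    moreover have "corner ` (SU \<inter> (SU \<inter> \<phi> -` C)) = F -` C \<inter> B_ball"
      unfolding B using F by auto
    ultimately show "closed (F -` C \<inter> B_ball)" by (simp add: compact_imp_closed)
  qed
qed

text \<open>The real-valued form of \<open>trunc_density\<close> at I - w^* w, for use in Bochner
  integrals.\<close>

definition trunc_weight :: "nat \<Rightarrow> complex^'q^'q \<Rightarrow> real" where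
  "trunc_weight e w = indicator B_ball w * cmod (det (mat 1 - cadjoint w ** w)) ^ e"

lemma trunc_density_weight: "trunc_density e (mat 1 - cadjoint w ** w) = ennreal (trunc_weight e w)"
  by (simp add: trunc_density_def trunc_weight_def B_ball_def indicator_def)

lemma isometry_h_mat:
  fixes w :: "'q::{finite,linorder} cmat"
  assumes "cmod z = 1" "cmod z' = 1"
  shows "norm (h_mat z ** w ** h_mat z') = norm w"
proof -
  have "cmod ((h_mat z ** w ** h_mat z') $ i $ j) = cmod (w $ i $ j)" for i j
    using assms unfolding h_mat_def diag_matrix_mult_right diag_matrix_mult_left by (simp add: norm_mult)
  then have "norm ((h_mat z ** w ** h_mat z') $ i) = norm (w $ i)" for i
    unfolding norm_vec_def[of "_ $ i"] by simp
  then show ?thesis unfolding norm_vec_def[of w] norm_vec_def[of "h_mat z ** w ** h_mat z'"] by simp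
qed

lemma trunc_weight_h_mat:
  fixes w :: "'q::{finite,linorder} cmat"
  assumes "cmod z = 1" "cmod z' = 1"
  shows "trunc_weight e (h_mat z ** w ** h_mat z') = trunc_weight e w"
proof -
  let ?h = "h_mat z :: 'q cmat"
  let ?h' = "h_mat z' :: 'q cmat"
  have u: "unitary ?h" "unitary ?h'" using assms by (simp_all add: unitary_h_mat)
  have "cadjoint (?h ** w ** ?h') ** (?h ** w ** ?h') = cadjoint ?h' ** cadjoint w ** (cadjoint ?h ** ?h) ** w ** ?h'"
    by (simp add: cadjoint_mult matrix_mul_assoc)
  also have "\<dots> = cadjoint ?h' ** (cadjoint w ** w) ** ?h'" using u by (simp add: unitary_def matrix_mul_assoc)
  finally have e: "mat 1 - cadjoint (?h ** w ** ?h') ** (?h ** w ** ?h') = cadjoint ?h' ** (mat 1 - cadjoint w ** w) ** ?h'"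
    using u by (simp add: matrix_diff_ldistrib matrix_diff_rdistrib unitary_def)
  have d: "det ?h' \<noteq> 0" using assms by (auto simp: det_h_mat)
  have "?h ** w ** ?h' \<in> B_ball \<longleftrightarrow> w \<in> B_ball"
    unfolding B_ball_def mem_Collect_eq e by (rule pos_semidef_congruence_iff[OF d])
  moreover have "cmod (det (mat 1 - cadjoint (?h ** w ** ?h') ** (?h ** w ** ?h'))) = cmod (det (mat 1 - cadjoint w ** w))"
    unfolding e det_mul det_cadjoint using assms by (simp add: norm_mult det_h_mat)
  ultimately show ?thesis by (simp add: trunc_weight_def indicator_def)
qed

theorem theorem3p2:
  fixes \<phi> :: "complex^(('r::finite + 'q::{finite,linorder}) + 'q)^(('r + 'q) + 'q) \<Rightarrow> complex"
    and \<mu> :: "(complex^(('r + 'q) + 'q)^(('r + 'q) + 'q)) measure"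
    and \<nu> :: "(complex^'q::{finite,linorder}^'q::{finite,linorder}) measure"
    and t t' :: "real^'q::{finite,linorder}"
    and z z' :: complex
  assumes "2 * CARD('q) \<le> CARD('r + 'q)"
    and "normalized_haar K1 \<mu>"
    and "normalized_haar SU \<nu>"
    and "spherical_function SU K1 \<mu> \<phi>"
    and "t \<in> A_chamber" and "t' \<in> A_chamber"
    and "cmod z = 1" and "cmod z' = 1"
  shows "\<phi> (b_rep (cone_pt (cos_vec t) z)) * \<phi> (b_rep (cone_pt (cos_vec t') z')) =
    (1 / kappa TYPE('q) CARD('r + 'q)) *
      (LINT w:B_ball|lborel. LINT v|\<nu>.
         (let M = - (sin_mat t ** w ** sin_mat t') + cos_mat t ** v ** cos_mat t'
          in \<phi> (b_rep (cone_pt (sigma_sing M) (z * z' * arg_phase (det M)))))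
         * det (mat 1 - cadjoint w ** w) ^ (CARD('r + 'q) - 2 * CARD('q)))"
proof -
  have cont: "continuous_on SU \<phi>"
    and biinv: "\<And>g k k'. g \<in> SU \<Longrightarrow> k \<in> K1 \<Longrightarrow> k' \<in> K1 \<Longrightarrow> \<phi> (k ** g ** k') = \<phi> g"
    and prod: "\<And>g h. g \<in> SU \<Longrightarrow> h \<in> SU \<Longrightarrow> \<phi> g * \<phi> h = (LINT k|\<mu>. \<phi> (g ** k ** h))"
    using assms(4) by (auto simp: spherical_function_def)
  have q: "CARD('q) \<le> CARD('r)" and q': "CARD('q) \<le> CARD('r + 'q)" using assms(1) by simp_all
  define e where "e = CARD('r) - CARD('q)"
  have e: "CARD('r + 'q) - 2 * CARD('q) = e" by (simp add: e_def)
  define F where "F M = \<phi> (b_rep (cone_pt (sigma_sing M) (arg_phase (det M))))" for M :: "'q cmat"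
  have F: "\<phi> g = F (corner g)" if "g \<in> SU" for g
    unfolding F_def by (rule biinvariant_eq_corner[OF biinv that])
  \<comment> \<open>\<open>F\<close> is tied to \<phi> only on the ball, where matrices are corners
    of elements of SU. The cutoff yields a bounded Borel function on all matrices.\<close>
  define F0 where "F0 M = indicator B_ball M *\<^sub>R F M" for M
  have B: "(B_ball :: ('q cmat) set) = corner ` (SU :: (('r + 'q) cmat) set)"
    by (rule B_ball_eq_corner[OF q])
  have B': "(B_ball :: ('q cmat) set) = corner ` (SU :: ((('r + 'q) + 'q) cmat) set)"
    by (rule B_ball_eq_corner[OF q'])
  have B_sets: "(B_ball :: ('q cmat) set) \<in> sets borel"
  proof -
    have "compact (B_ball :: ('q cmat) set)"
      unfolding B by (intro compact_continuous_image compact_SU) (simp add: corner_def continuous_intros)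
    then show ?thesis by (simp add: borel_compact)
  qed
  have mF0[measurable]: "F0 \<in> borel_measurable borel"
    unfolding F0_def
    by (rule borel_measurable_continuous_on_indicator[OF B_sets continuous_on_B_ball_factor[OF q' cont F]])
  have "bounded (\<phi> ` SU)" by (intro compact_imp_bounded compact_continuous_image cont compact_SU)
  then obtain b0 where b0: "\<And>g. g \<in> SU \<Longrightarrow> cmod (\<phi> g) \<le> b0" by (auto simp: bounded_iff)
  then have F0_bound: "cmod (F0 M) \<le> max b0 0" for M
  proof (cases "M \<in> B_ball")
    case True
    then obtain g :: "(('r + 'q) + 'q) cmat" where "g \<in> SU" "M = corner g" unfolding B' by blast
    then have "F M = \<phi> g" using F by simp
    then show ?thesis using True b0[OF \<open>g \<in> SU\<close>] by (simp add: F0_def)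
  qed (simp add: F0_def)
  define \<mu>' where "\<mu>' = distr \<mu> borel (\<lambda>x. x)"
  define \<nu>' where "\<nu>' = distr \<nu> borel (\<lambda>x. x)"
  have K1_mult: "\<forall>g\<in>K1. \<forall>x\<in>K1. g ** x \<in> (K1 :: ((('r + 'q) + 'q) cmat) set)"
    unfolding K1_def by clarsimp (metis SU_mult block_diag_mult)
  have SU_mult': "\<forall>g\<in>SU. \<forall>x\<in>SU. g ** x \<in> (SU :: ('q cmat) set)"
    using SU_mult by blast
  note haar\<mu> = normalized_haar_borel[OF assms(2) compact_K1 K1_mult, folded \<mu>'_def]
  note haar\<nu> = normalized_haar_borel[OF assms(3) compact_SU SU_mult', folded \<nu>'_def]
  note [measurable_cong] = haar\<mu>(3) haar\<nu>(3)
  have sp: "space \<mu>' = UNIV" "space \<nu>' = UNIV" by (simp_all add: \<mu>'_def \<nu>'_def)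
  have int\<nu>: "(LINT v|\<nu>'. f v) = (LINT v|\<nu>. f v)" if "f \<in> borel_measurable borel" for f :: "'q cmat \<Rightarrow> complex"
    unfolding \<nu>'_def by (rule integral_distr[OF haar\<nu>(2) that])
  define \<rho> where "\<rho> = distr \<mu>' borel (\<lambda>k. corner (upper k))"
  obtain C where C: "\<rho> = density lborel (\<lambda>w. C * ennreal (trunc_weight e w))"
  proof -
    \<comment> \<open>The upper block of a Haar distributed element of K_1 again has a left
      invariant law, now on SU(p), so \<open>corner_law\<close> applies to it.\<close>
    let ?\<mu>1 = "distr \<mu>' borel upper :: (('r + 'q) cmat) measure"
    have "\<exists>C. distr ?\<mu>1 borel corner = density lborel (\<lambda>w. C * trunc_density (CARD('r) - CARD('q)) (mat 1 - cadjoint w ** w))"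
    proof (rule corner_law[OF q])
      show "sets ?\<mu>1 = sets borel" by simp
      show "emeasure ?\<mu>1 UNIV = 1" using haar\<mu>(4) by (simp add: emeasure_distr sp)
      have SUb: "(SU :: (('r + 'q) cmat) set) \<in> sets borel" by (rule borel_compact[OF compact_SU])
      have "{u \<in> space borel. u \<in> (SU :: (('r + 'q) cmat) set)} \<in> sets borel" using SUb by simp
      moreover have "AE k in \<mu>'. upper k \<in> SU"
        using haar\<mu>(5) by eventually_elim (auto simp: K1_def)
      ultimately show "AE u in ?\<mu>1. u \<in> SU" by (subst AE_distr_iff) simp_all
      fix g :: "('r + 'q) cmat" assume g: "g \<in> SU"
      define G where "G = block_diag g (mat 1 :: 'q cmat)"
      have G: "G \<in> K1" using g SU_mat_1 by (auto simp: G_def K1_def)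
      have up: "upper (G ** k) = g ** upper k" for k
        by (simp add: upper_def G_def vec_eq_iff sum_UNIV_sum matrix_matrix_mult_def)
      have "distr ?\<mu>1 borel ((**) g) = distr \<mu>' borel (upper \<circ> (**) G)"
        by (subst distr_distr) (auto simp: o_def up)
      also have "\<dots> = distr (distr \<mu>' borel ((**) G)) borel upper"
        by (rule distr_distr[symmetric]) measurable
      finally show "distr ?\<mu>1 borel ((**) g) = ?\<mu>1" by (simp only: haar\<mu>(6)[OF G])
    qed
    moreover have "distr ?\<mu>1 borel corner = \<rho>"
      unfolding \<rho>_def by (subst distr_distr) (auto simp: o_def)
    ultimately show thesis using that by (auto simp: trunc_density_weight e_def)
  qed
  have mw[measurable]: "trunc_weight e \<in> borel_measurable (borel :: ('q cmat) measure)"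
  proof -
    have "(\<lambda>w. det (mat 1 - cadjoint w ** w)) \<in> borel_measurable (borel :: ('q cmat) measure)"
      by (intro borel_measurable_continuous_onI continuous_intros)
    then show ?thesis unfolding trunc_weight_def using B_sets by measurable
  qed
  have w0: "0 \<le> trunc_weight e w" for w :: "'q cmat" by (simp add: trunc_weight_def)
  have \<rho>1: "emeasure \<rho> UNIV = 1" using haar\<mu>(4) by (simp add: \<rho>_def emeasure_distr sp)
  have "1 = C * (\<integral>\<^sup>+w. ennreal (trunc_weight e (w :: 'q cmat)) \<partial>lborel)"
    unfolding \<rho>1[symmetric] C by (simp add: emeasure_density nn_integral_cmult)
  \<comment> \<open>An infinite constant would make the product 0 or infinite, never the total mass
    1.\<close>
  then have "C \<noteq> \<infinity>" by (auto simp: ennreal_top_mult split: if_splits)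
  then obtain c where c: "C = ennreal c" "0 \<le> c" by (cases C) auto
  define \<delta> where "\<delta> w = c * trunc_weight e w" for w :: "'q cmat"
  have [measurable]: "\<delta> \<in> borel_measurable borel" unfolding \<delta>_def by measurable
  have \<delta>0: "0 \<le> \<delta> w" for w using w0 c by (simp add: \<delta>_def)
  have \<rho>: "\<rho> = density lborel (\<lambda>w. ennreal (\<delta> w))"
    unfolding C \<delta>_def c(1) using c(2) w0 by (simp add: ennreal_mult)
  have int\<rho>: "(LINT w|\<rho>. f w) = of_real c * (LINT w|lborel. trunc_weight e w *\<^sub>R f w)"
    if [measurable]: "f \<in> borel_measurable borel" for f :: "'q cmat \<Rightarrow> complex"
  proof -
    have "(LINT w|\<rho>. f w) = (LINT w|lborel. \<delta> w *\<^sub>R f w)"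
      unfolding \<rho> by (rule integral_density) (use \<delta>0 in auto)
    also have "\<dots> = (LINT w|lborel. of_real c * (trunc_weight e w *\<^sub>R f w))"
      by (simp add: \<delta>_def scaleR_conv_of_real mult.assoc)
    also have "\<dots> = of_real c * (LINT w|lborel. trunc_weight e w *\<^sub>R f w)"
      by (rule integral_mult_right_zero)
    finally show ?thesis .
  qed
  have sets\<rho>: "sets \<rho> = sets borel" by (simp add: \<rho>_def)
  note [measurable_cong] = sets\<rho>
  have sp\<rho>: "space \<rho> = UNIV" by (simp add: \<rho>_def)
  interpret \<rho>: finite_measure \<rho> by (rule finite_measureI) (simp add: sp\<rho> \<rho>1)
  interpret \<nu>': finite_measure \<nu>' by (rule finite_measureI) (simp add: sp haar\<nu>)
  interpret P: pair_sigma_finite \<rho> \<nu>' ..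
  \<comment> \<open>Integrating the constant 1 against the probability measure \<rho> identifies the
    constant left open by the row induction.\<close>
  have kap: "of_real c * kappa TYPE('q) CARD('r + 'q) = 1"
  proof -
    have "kappa TYPE('q) CARD('r + 'q) = (LINT w|lborel. trunc_weight e (w :: 'q cmat) *\<^sub>R (1 :: complex))"
      unfolding kappa_def set_lebesgue_integral_def e
    proof (rule Bochner_Integration.integral_cong[OF refl])
      fix w :: "'q cmat"
      show "indicator B_ball w *\<^sub>R det (mat 1 - cadjoint w ** w) ^ e = trunc_weight e w *\<^sub>R 1"
        using det_B_ball[of w] by (cases "w \<in> B_ball") (simp_all add: trunc_weight_def scaleR_conv_of_real)
    qed
    then have "of_real c * kappa TYPE('q) CARD('r + 'q) = (LINT w|\<rho>. 1)"
      by (simp only: int\<rho>[of "\<lambda>_. 1", OF borel_measurable_const])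
    also have "\<dots> = of_real (measure \<rho> UNIV)" by (simp add: sp\<rho> scaleR_conv_of_real)
    also have "measure \<rho> UNIV = 1" by (simp add: measure_def \<rho>1)
    finally show ?thesis by simp
  qed
  define M where "M w v = - (sin_mat t ** w ** sin_mat t') + cos_mat t ** v ** cos_mat t'" for w v :: "'q cmat"
  define N where "N w v = - (sin_mat t ** w ** sin_mat t') + h_mat z ** (cos_mat t ** v ** cos_mat t') ** h_mat z'" for w v :: "'q cmat"
  define \<tau> where "\<tau> w = h_mat z ** w ** h_mat z'" for w :: "'q cmat"
  \<comment> \<open>The phase matrices and the sine matrices are diagonal and commute, so twisting w
    pulls both phases out of the whole block.\<close>
  have N\<tau>: "N (\<tau> w) v = \<tau> (M w v)" for w v
    unfolding N_def M_def \<tau>_def vec_eq_iff h_mat_def sin_mat_def cos_mat_def diag_matrix_mult_left diag_matrix_mult_right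
      vector_add_component vector_uminus_component
    by (simp add: algebra_simps)
  define b where "b = (b_mat t z :: (('r + 'q) + 'q) cmat)"
  define b' where "b' = (b_mat t' z' :: (('r + 'q) + 'q) cmat)"
  have b: "b \<in> SU" and b': "b' \<in> SU" unfolding b_def b'_def using assms(7,8) by (simp_all add: SU_b_mat)
  have corner_N: "corner (b ** block_diag u v ** b') = N (corner u) v" for u v
    unfolding b_def b'_def N_def by (rule corner_b_mat_product)
  \<comment> \<open>By surjectivity of \<open>corner\<close>, w is the corner of some u in SU(p),
    and then \<open>N w v\<close> is the corner of a product in G.\<close>
  have N_B: "N w v \<in> B_ball" if w: "w \<in> B_ball" and v: "v \<in> SU" for w v
  proof -
    obtain u :: "('r + 'q) cmat" where u: "u \<in> SU" "w = corner u" using w unfolding B by blast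
    have "b ** block_diag u v ** b' \<in> SU" by (intro SU_mult b b' SU_block_diag u v)
    then show ?thesis unfolding u(2) corner_N[symmetric] by (simp add: SU_iff corner_in_B_ball)
  qed
  have mN[measurable]: "(\<lambda>p. N (fst p) (snd p)) \<in> borel_measurable (borel \<Otimes>\<^sub>M borel)"
    unfolding borel_prod N_def by (intro borel_measurable_continuous_onI continuous_intros)
  define I where "I w = (LINT v|\<nu>'. F0 (N w v))" for w
  have mFN[measurable]: "(\<lambda>p. F0 (N (fst p) (snd p))) \<in> borel_measurable (borel \<Otimes>\<^sub>M borel)" by measurable
  have pair: "(\<lambda>k :: (('r + 'q) + 'q) cmat. (corner (upper k), corner k)) \<in> measurable borel (borel \<Otimes>\<^sub>M borel)"
    by measurable
  have mk: "(\<lambda>k :: (('r + 'q) + 'q) cmat. F0 (N (corner (upper k)) (corner k))) \<in> borel_measurable borel"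
    using measurable_compose[OF pair mFN] by simp
  have mI[measurable]: "I \<in> borel_measurable borel"
    unfolding I_def using mFN by (intro \<nu>'.borel_measurable_lebesgue_integral) (simp add: split_def)
  have "\<phi> b * \<phi> b' = (LINT k|\<mu>. \<phi> (b ** k ** b'))" by (rule prod[OF b b'])
  also have "\<dots> = (LINT k|\<mu>. F0 (N (corner (upper k)) (corner k)))"
  proof (rule Bochner_Integration.integral_cong[OF refl])
    fix k assume "k \<in> space \<mu>"
    then obtain u v where k: "k = block_diag u v" and u: "u \<in> SU" and v: "v \<in> SU"
      unfolding haar\<mu>(1) by (auto simp: K1_def)
    have "b ** k ** b' \<in> SU" unfolding k by (intro SU_mult b b' SU_block_diag u v)
    then have "\<phi> (b ** k ** b') = F (N (corner u) v)" unfolding k using F corner_N by metis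
    moreover have "N (corner u) v \<in> B_ball" using u v by (intro N_B) (simp_all add: SU_iff corner_in_B_ball)
    ultimately show "\<phi> (b ** k ** b') = F0 (N (corner (upper k)) (corner k))" by (simp add: F0_def k)
  qed
  also have "\<dots> = (LINT k|\<mu>'. F0 (N (corner (upper k)) (corner k)))"
    unfolding \<mu>'_def by (rule integral_distr[OF haar\<mu>(2) mk, symmetric])
  also have "\<dots> = (LINT p|(distr \<mu>' (borel \<Otimes>\<^sub>M borel) (\<lambda>k. (corner (upper k), corner k))). F0 (N (fst p) (snd p)))"
    using integral_distr[of "\<lambda>k. (corner (upper k), corner k)" \<mu>' "borel \<Otimes>\<^sub>M borel", OF _ mFN] pair
    by (simp add: measurable_cong_sets[OF haar\<mu>(3) refl])
  also have "\<dots> = (LINT p|(\<rho> \<Otimes>\<^sub>M \<nu>'). F0 (N (fst p) (snd p)))"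
  proof -
    have "distr \<mu>' (borel \<Otimes>\<^sub>M borel) (\<lambda>k. (corner (upper k), corner k)) = \<rho> \<Otimes>\<^sub>M \<nu>'"
      unfolding \<rho>_def by (rule haar_K1_marginals[OF haar\<mu>(3-6) haar\<nu>(3-6) measurable_corner])
    then show ?thesis by (simp only:)
  qed
  also have "\<dots> = (LINT w|\<rho>. I w)"
  proof -
    have "finite_measure (\<rho> \<Otimes>\<^sub>M \<nu>')" by (intro finite_measure_pair_measure) unfold_locales
    then interpret PP: finite_measure "\<rho> \<Otimes>\<^sub>M \<nu>'" .
    have "integrable (\<rho> \<Otimes>\<^sub>M \<nu>') (\<lambda>p. F0 (N (fst p) (snd p)))"
      by (rule PP.integrable_const_bound[of _ "max b0 0"]) (use F0_bound in auto)
    from P.integral_fst'[OF this] show ?thesis by (simp add: I_def)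
  qed
  also have "\<dots> = of_real c * (LINT w|lborel. trunc_weight e w *\<^sub>R I w)" by (rule int\<rho>) measurable
  also have "(LINT w|lborel. trunc_weight e w *\<^sub>R I w) = (LINT w|lborel. trunc_weight e (\<tau> w) *\<^sub>R I (\<tau> w))"
  proof -
    have lin: "linear \<tau>"
      by (rule linearI) (simp_all add: \<tau>_def vec_eq_iff matrix_matrix_mult_def algebra_simps sum.distrib sum_distrib_left scaleR_sum_right)
    have nt: "norm (\<tau> w) = norm w" for w unfolding \<tau>_def by (rule isometry_h_mat[OF assms(7,8)])
    have m\<tau>: "\<tau> \<in> borel_measurable borel"
      unfolding \<tau>_def by (intro borel_measurable_continuous_onI continuous_intros)
    have "(LINT w|lborel. trunc_weight e w *\<^sub>R I w) = (LINT w|(distr lborel borel \<tau>). trunc_weight e w *\<^sub>R I w)"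
      by (simp only: lborel_distr_isometry[OF lin nt])
    also have "\<dots> = (LINT w|lborel. trunc_weight e (\<tau> w) *\<^sub>R I (\<tau> w))"
      by (rule integral_distr) (use m\<tau> in simp, measurable)
    finally show ?thesis .
  qed
  also have "\<dots> = (LINT w:B_ball|lborel. LINT v|\<nu>.
         (let M = - (sin_mat t ** w ** sin_mat t') + cos_mat t ** v ** cos_mat t'
          in \<phi> (b_rep (cone_pt (sigma_sing M) (z * z' * arg_phase (det M)))))
         * det (mat 1 - cadjoint w ** w) ^ e)"
    unfolding set_lebesgue_integral_def
  proof (rule Bochner_Integration.integral_cong[OF refl])
    fix w :: "'q cmat"
    let ?X = "\<lambda>v. \<phi> (b_rep (cone_pt (sigma_sing (M w v)) (z * z' * arg_phase (det (M w v)))))"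
    show "trunc_weight e (\<tau> w) *\<^sub>R I (\<tau> w) = indicator B_ball w *\<^sub>R (LINT v|\<nu>.
         (let M = - (sin_mat t ** w ** sin_mat t') + cos_mat t ** v ** cos_mat t'
          in \<phi> (b_rep (cone_pt (sigma_sing M) (z * z' * arg_phase (det M)))))
         * det (mat 1 - cadjoint w ** w) ^ e)"
    proof (cases "w \<in> B_ball")
      case False
      then show ?thesis by (simp add: \<tau>_def trunc_weight_h_mat[OF assms(7,8)]) (simp add: trunc_weight_def)
    next
      case True
      have tw: "trunc_weight e (\<tau> w) = cmod (det (mat 1 - cadjoint w ** w)) ^ e"
        unfolding \<tau>_def trunc_weight_h_mat[OF assms(7,8)] using True by (simp add: trunc_weight_def)
      \<comment> \<open>With exponent 0 the weight is the indicator of the ball, so its invariance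
        shows that \<tau> preserves the ball.\<close>
      have "trunc_weight 0 (\<tau> w) = trunc_weight 0 w" unfolding \<tau>_def by (rule trunc_weight_h_mat[OF assms(7,8)])
      then have \<tau>B: "\<tau> w \<in> B_ball" using True by (simp add: trunc_weight_def indicator_def split: if_splits)
      have "I (\<tau> w) = (LINT v|\<nu>. F0 (N (\<tau> w) v))"
        unfolding I_def
      proof (rule int\<nu>)
        have "(\<lambda>v. N (\<tau> w) v) \<in> borel_measurable borel"
          unfolding N_def by (intro borel_measurable_continuous_onI continuous_intros)
        then show "(\<lambda>v. F0 (N (\<tau> w) v)) \<in> borel_measurable borel" by (rule measurable_compose[OF _ mF0])
      qed
      also have "\<dots> = (LINT v|\<nu>. ?X v)"
      proof (rule Bochner_Integration.integral_cong[OF refl])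
        fix v assume "v \<in> space \<nu>"
        then have "v \<in> SU" by (simp add: haar\<nu>(1))
        then have "F0 (N (\<tau> w) v) = F (\<tau> (M w v))" using N_B[OF \<tau>B] by (simp add: F0_def N\<tau>)
        then show "F0 (N (\<tau> w) v) = ?X v" unfolding F_def \<tau>_def cone_pt_twist[OF assms(7,8)] .
      qed
      finally have "I (\<tau> w) = (LINT v|\<nu>. ?X v)" .
      moreover have "(LINT v|\<nu>. ?X v * det (mat 1 - cadjoint w ** w) ^ e) = (LINT v|\<nu>. ?X v) * det (mat 1 - cadjoint w ** w) ^ e"
        by (rule integral_mult_left_zero)
      moreover have "det (mat 1 - cadjoint w ** w) ^ e = of_real (trunc_weight e (\<tau> w))"
        unfolding tw using det_B_ball[OF True] by simp
      ultimately show ?thesis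
        using True by (simp add: M_def Let_def scaleR_conv_of_real mult.commute)
    qed
  qed
  finally have "\<phi> b * \<phi> b' = of_real c * (LINT w:B_ball|lborel. LINT v|\<nu>.
         (let M = - (sin_mat t ** w ** sin_mat t') + cos_mat t ** v ** cos_mat t'
          in \<phi> (b_rep (cone_pt (sigma_sing M) (z * z' * arg_phase (det M)))))
         * det (mat 1 - cadjoint w ** w) ^ e)" .
  moreover have "of_real c = 1 / kappa TYPE('q) CARD('r + 'q)"
    using kap by (metis mult_zero_right nonzero_eq_divide_eq zero_neq_one)
  moreover have "b = b_rep (cone_pt (cos_vec t) z)" "b' = b_rep (cone_pt (cos_vec t') z')"
    unfolding b_def b'_def using assms(5-8) by (simp_all add: b_rep_cone_pt)
  ultimately show ?thesis by (simp only: e)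
qed

end
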